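(* Let $N\ge 2$ and let $\mathbf{Z}(n)=(Z_1(n),\dots,Z_N(n))$, $n=0,1,2,\dots$, be a decomposable $N$-type Galton-Watson branching process with $\mathbf{Z}(0)=\mathbf{e}_1$ satisfying Hypothesis A, and let $T_N$ be its extinction moment. Let $m=m(n)$ be nonnegative integers such that $k=k(n)=n-m\to\infty$ as $n\to\infty$ and $k=o(n)$. Then, for any $s_1,\dots,s_{N-1}\in[0,1]$ and $\lambda_N>0$, $$\lim_{n\to\infty}\mathbf{E}\left[s_1^{Z_1(m)}\cdots s_{N-1}^{Z_{N-1}(m)}\exp\left\{-\lambda_N\frac{Z_N(m)}{b_N k}\right\}\,\Big|\,T_N=n\right]=\frac{1}{(1+\lambda_N)^2}.$$
   Context: Consider a Galton-Watson branching process with $N$ types of particles labelled $1,\dots,N$ (discrete generations, independent reproduction, particles of the same type having the same offspring law). Let $\eta_{i,j}$ be the number of type $j$ children produced by a type $i$ parent particle; the $\eta_{i,j}$, $j=1,\dots,N$, for one parent may be dependent. The process is decomposable in the sense that $\eta_{i,j}=0$ if $i>j$. Here $Z_j(n)$ is the number of type $j$ particles at time $n$, and $\mathbf{e}_i$ is the $N$-dimensional vector with $i$-th component one and the others zero. Put $m_{i,j}=\mathbf{E}[\eta_{i,j}]$. Hypothesis A: $m_{i,i}=1$ for $i=1,\dots,N$; $m_{i,i+1}\in(0,\infty)$ for $i=1,\dots,N-1$; $\mathbf{E}[\eta_{i,j}\eta_{i,k}]<\infty$ for $i=1,\dots,N$ and $j,k=i,i+1,\dots,N$; and $b_i=\frac12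 \mathrm{Var}[\eta_{i,i}]\in(0,\infty)$ for $i=1,\dots,N$. The extinction moment is $T_N=\min\{n\ge 1: Z_1(n)+\dots+Z_N(n)=0\}$. Convention: $0^0=1$. *)

theory Defs
  imports "HOL-Probability.Probability" "HOL-Library.Landau_Symbols" "HOL-Library.Extended_Nat"
begin

text \<open>
  Particle types are the natural numbers in \<open>{1..N}\<close>.  The variable \<open>\<eta> t i r j\<close> is the number of
  type \<open>j\<close> children of the \<open>r\<close>-th type \<open>i\<close> particle (\<open>r = 0, 1, \<dots>\<close>) of generation \<open>t\<close>.
  Offspring vectors of different particles are independent; the components of one vector are not
  assumed to be.
\<close>

type_synonym 'w offspring = "nat \<Rightarrow> nat \<Rightarrow> nat \<Rightarrow> nat \<Rightarrow> 'w \<Rightarrow> nat"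

definition offspring_space :: "nat \<Rightarrow> (nat \<Rightarrow> nat) measure" where
  "offspring_space N = (\<Pi>\<^sub>M j\<in>{1..N}. count_space UNIV)"

definition offspring_vector :: "nat \<Rightarrow> 'w offspring \<Rightarrow> nat \<times> nat \<times> nat \<Rightarrow> 'w \<Rightarrow> (nat \<Rightarrow> nat)" where
  "offspring_vector N \<eta> = (\<lambda>(t, i, r) \<omega>. \<lambda>j\<in>{1..N}. \<eta> t i r j \<omega>)"

locale galton_watson = prob_space M for M :: "'w measure" +
  fixes N :: nat and \<eta> :: "'w offspring"
  assumes indep_offspring:
    "indep_vars (\<lambda>_. offspring_space N) (offspring_vector N \<eta>) (UNIV \<times> {1..N} \<times> UNIV)"
  and identical_offspring:
    "\<And>t i r. i \<in> {1..N} \<Longrightarrow>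
       distr M (offspring_space N) (offspring_vector N \<eta> (t, i, r)) =
       distr M (offspring_space N) (offspring_vector N \<eta> (0, i, 0))"

locale decomposable_galton_watson = galton_watson +
  assumes decomposable:
    "\<And>t i r j. i \<in> {1..N} \<Longrightarrow> j \<in> {1..N} \<Longrightarrow> j < i \<Longrightarrow> AE \<omega> in M. \<eta> t i r j \<omega> = 0"

text \<open>The initial population \<open>z\<close> is deterministic; \<open>population N \<eta> z t j\<close> is \<open>Z\<^sub>j(t)\<close>.\<close>

primrec population ::
    "nat \<Rightarrow> 'w offspring \<Rightarrow> (nat \<Rightarrow> nat) \<Rightarrow> nat \<Rightarrow> nat \<Rightarrow> 'w \<Rightarrow> nat" where
  "population N \<eta> z 0 = (\<lambda>j \<omega>. z j)"
| "population N \<eta> z (Suc t) =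
     (\<lambda>j \<omega>. \<Sum>i=1..N. \<Sum>r<population N \<eta> z t i \<omega>. \<eta> t i r j \<omega>)"

definition unit_population :: "nat \<Rightarrow> nat \<Rightarrow> nat" where
  "unit_population i = (\<lambda>j. if j = i then 1 else 0)"

text \<open>The extinction moment is \<open>\<infinity>\<close>, the infimum of the empty set, if the process survives forever.\<close>

definition extinction_time :: "nat \<Rightarrow> (nat \<Rightarrow> nat \<Rightarrow> 'w \<Rightarrow> nat) \<Rightarrow> 'w \<Rightarrow> enat" where
  "extinction_time N Z \<omega> = Inf {enat n | n. n \<ge> 1 \<and> (\<Sum>j=1..N. Z n j \<omega>) = 0}"

text \<open>
  By identical distribution, the particle with \<open>t = 0\<close> and \<open>r = 0\<close> represents its type.
\<close>

definition mean_offspring :: "'w measure \<Rightarrow> 'w offspring \<Rightarrow> nat \<Rightarrow> nat \<Rightarrow> real" where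
  "mean_offspring M \<eta> i j = (\<integral>\<omega>. real (\<eta> 0 i 0 j \<omega>) \<partial>M)"

definition half_variance :: "'w measure \<Rightarrow> 'w offspring \<Rightarrow> nat \<Rightarrow> real" where
  "half_variance M \<eta> i = 1 / 2 * (\<integral>\<omega>. (real (\<eta> 0 i 0 i \<omega>) - mean_offspring M \<eta> i i)\<^sup>2 \<partial>M)"

text \<open>
  The integrability clause makes all first moments \<open>m\<^sub>i\<^sub>j\<close> with \<open>i \<le> j\<close> and all variances finite,
  so the integrals in the remaining clauses are not default values.
\<close>

definition hypothesis_A :: "'w measure \<Rightarrow> nat \<Rightarrow> 'w offspring \<Rightarrow> bool" where
  "hypothesis_A M N \<eta> \<longleftrightarrow>
     (\<forall>i\<in>{1..N}. mean_offspring M \<eta> i i = 1) \<and>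
     (\<forall>i\<in>{1..<N}. mean_offspring M \<eta> i (i + 1) > 0) \<and>
     (\<forall>i\<in>{1..N}. \<forall>j\<in>{i..N}. \<forall>k\<in>{i..N}.
        integrable M (\<lambda>\<omega>. real (\<eta> 0 i 0 j \<omega>) * real (\<eta> 0 i 0 k \<omega>))) \<and>
     (\<forall>i\<in>{1..N}. half_variance M \<eta> i > 0)"

text \<open>\<open>E[X | A]\<close> for an event \<open>A\<close> of positive probability.\<close>

definition expectation_given :: "'w measure \<Rightarrow> ('w \<Rightarrow> real) \<Rightarrow> 'w set \<Rightarrow> real" where
  "expectation_given M X A = (\<integral>\<omega>. X \<omega> \<partial>uniform_measure M A)"

end

theory Submission
  imports Defs "HOL-Real_Asymp.Real_Asymp"
begin

text \<open>
  For the vector \<open>h\<close> of offspring generating functions and \<open>n = m + k\<close>, the branching property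
  turns the expectation of \<open>\<Prod>\<^sub>j w\<^sub>j ^ Z\<^sub>j(m)\<close> on the event \<open>T = n\<close> into a difference of two orbits,
  \<open>h\<^sup>m (w * h\<^sup>k 0) - h\<^sup>m (w * h\<^sup>k\<^sup>-\<^sup>1 0)\<close> in coordinate 1 (\<open>expectation_at_extinction\<close>; products of
  vectors are taken by coordinates).  The conditional expectation is the quotient of this by the same
  expression with \<open>w = 1\<close>.  Its limit is found from two observations.

  In a single critical type, here type \<open>N\<close>, the survival probability at time \<open>k\<close> is about
  \<open>1 / (b\<^sub>N * k)\<close>.  The weight \<open>w\<^sub>N = exp (- lam / (b\<^sub>N * k))\<close> multiplies the distance of the starting point
  from \<open>1\<close> by \<open>1 + lam\<close>, as if \<open>k\<close> were replaced by \<open>k / (1 + lam)\<close>.  One step of the orbit of \<open>0\<close> has length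
  about \<open>1 / (b\<^sub>N * k\<^sup>2)\<close> at time \<open>k\<close> and is longer by the factor \<open>(1 + lam)\<^sup>2\<close> at time \<open>k / (1 + lam)\<close>.  The
  generating function is convex, so a quotient of chords can be followed through the iteration, and
  after \<open>t\<close> steps the weighted difference is \<open>1 / (1 + lam)\<^sup>2\<close> times the unweighted one, for all \<open>t\<close> of
  the order of \<open>n\<close> or larger (\<open>gap_last_power_law\<close>).

  For a type \<open>i < N\<close> the difference of the orbits obeys a linear recursion: it contracts at the rate
  \<open>2 * b\<^sub>i\<close> times the survival probability, and it receives an inflow of \<open>m\<^sub>i\<^sub>,\<^sub>i\<^sub>+\<^sub>1\<close> times the difference
  for type \<open>i + 1\<close>.  The survival probability of type \<open>i\<close> decays like \<open>t powr - \<gamma> i\<close> with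
  \<open>\<gamma> i = 1 / 2 ^ (N - i) < 1\<close> (\<open>surv_power_law\<close>), so the relaxation time is much shorter than \<open>t\<close>: the
  recursion forgets its initial value, in particular the weights \<open>w\<^sub>i\<close> with \<open>i < N\<close>, and is always near
  its equilibrium (\<open>forced_linear_recursion\<close>).  The difference for type \<open>i\<close> is thus asymptotically a
  universal multiple of the one for type \<open>i + 1\<close>, up to a power of \<open>t\<close> (\<open>gap_power_law\<close>).  The multiples and powers
  cancel in the quotient, and the factor \<open>1 / (1 + lam)\<^sup>2\<close> of type \<open>N\<close> remains.

  The coefficients of the recursion depend on the orbits, but both orbits lie between that of \<open>0\<close> and
  that of \<open>h\<^sup>k 0\<close>, which is the same orbit ahead by \<open>k = o(n)\<close>.  On this account they are the same for all
  weights, to leading order (\<open>trapped_power_law\<close>).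
\<close>

section \<open>Limits along pairs with the second index at least proportional to the first\<close>

text \<open>
  Orbits of length \<open>t\<close> have to be compared for starting points that depend on \<open>n\<close>, uniformly in all
  \<open>t \<ge> \<delta> n\<close>.  This filter turns that uniformity into ordinary limits, so that sums, products and
  squeezing are available.  Every statement is made for all \<open>\<delta> > 0\<close>, since a recursion in \<open>t\<close>
  transfers information from the range of \<open>\<delta> / 2\<close> to that of \<open>\<delta>\<close>.
\<close>

definition linear_range :: "real \<Rightarrow> (nat \<times> nat) filter" where
  "linear_range \<delta> = inf (filtercomap fst at_top) (principal {(n, t). \<delta> * real n \<le> real t})"

lemma eventually_linear_range:
  "eventually P (linear_range \<delta>) \<longleftrightarrow> (\<exists>n0. \<forall>n\<ge>n0. \<forall>t. \<delta> * real n \<le> real t \<longrightarrow> P (n, t))"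
proof -
  have "eventually P (linear_range \<delta>) \<longleftrightarrow>
      (\<exists>Q. (\<exists>n0. \<forall>n\<ge>n0. Q n) \<and> (\<forall>n t. Q n \<longrightarrow> \<delta> * real n \<le> real t \<longrightarrow> P (n, t)))"
    unfolding linear_range_def eventually_inf_principal eventually_filtercomap eventually_sequentially
    by simp
  also have "\<dots> \<longleftrightarrow> (\<exists>n0. \<forall>n\<ge>n0. \<forall>t. \<delta> * real n \<le> real t \<longrightarrow> P (n, t))"
  proof
    assume "\<exists>n0. \<forall>n\<ge>n0. \<forall>t. \<delta> * real n \<le> real t \<longrightarrow> P (n, t)"
    then obtain n0 where "\<forall>n\<ge>n0. \<forall>t. \<delta> * real n \<le> real t \<longrightarrow> P (n, t)" ..
    then show "\<exists>Q. (\<exists>n0. \<forall>n\<ge>n0. Q n) \<and> (\<forall>n t. Q n \<longrightarrow> \<delta> * real n \<le> real t \<longrightarrow> P (n, t))"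
      by (intro exI[of _ "\<lambda>n. n \<ge> n0"]) auto
  qed blast
  finally show ?thesis .
qed

lemma filterlim_fst_linear_range: "filterlim fst at_top (linear_range \<delta>)"
  unfolding filterlim_iff eventually_linear_range eventually_sequentially by auto

lemma filterlim_snd_linear_range:
  assumes "\<delta> > 0"
  shows "filterlim snd at_top (linear_range \<delta>)"
  unfolding filterlim_at_top eventually_linear_range
proof (intro allI)
  fix K :: nat
  show "\<exists>n0. \<forall>n\<ge>n0. \<forall>t. \<delta> * real n \<le> real t \<longrightarrow> K \<le> snd (n, t)"
  proof (intro exI[of _ "nat \<lceil>real K / \<delta>\<rceil>"] allI impI)
    fix n t assume *: "n \<ge> nat \<lceil>real K / \<delta>\<rceil>" "\<delta> * real n \<le> real t"
    have "real K / \<delta> \<le> real n" using *(1) by linarith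
    then have "real K \<le> \<delta> * real n" using assms by (simp add: field_simps)
    then show "K \<le> snd (n, t)" using *(2) by simp
  qed
qed

lemma filterlim_Pair_linear_range:
  assumes "\<forall>\<^sub>F n in sequentially. \<delta> * real n \<le> real (\<tau> n)"
  shows "filterlim (\<lambda>n. (n, \<tau> n)) (linear_range \<delta>) sequentially"
  unfolding filterlim_iff eventually_linear_range
proof (intro allI impI)
  fix P assume "\<exists>n0. \<forall>n\<ge>n0. \<forall>t. \<delta> * real n \<le> real t \<longrightarrow> P (n, t)"
  then obtain n0 where n0: "\<forall>n\<ge>n0. \<forall>t. \<delta> * real n \<le> real t \<longrightarrow> P (n, t)" by blast
  show "\<forall>\<^sub>F n in sequentially. P (n, \<tau> n)"
    using assms eventually_ge_at_top[of n0] by eventually_elim (use n0 in blast)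
qed

text \<open>
  A contraction rate \<open>t powr - \<gamma>\<close> with \<open>\<gamma> < 1\<close>, applied over the time from \<open>t / 2\<close> to \<open>t\<close>, gives a
  factor of order \<open>exp (- c' * t powr (1 - \<gamma>))\<close>, which beats every polynomial bound on the starting
  value.  The tolerance \<open>\<epsilon>\<close> absorbs perturbations of smaller order than the contraction rate.
\<close>

lemma contraction_linear_range:
  fixes \<rho> :: "nat \<Rightarrow> nat \<Rightarrow> real"
  assumes c: "c > 0" and g: "0 \<le> \<gamma>" "\<gamma> < 1" and \<kappa>: "\<kappa> \<ge> 0"
    and bound: "\<And>\<delta>. \<delta> > 0 \<Longrightarrow> \<forall>\<^sub>F (n, t) in linear_range \<delta>. \<bar>\<rho> n t\<bar> \<le> K * real t powr \<kappa>"
    and contract: "\<And>\<delta> \<epsilon>. \<delta> > 0 \<Longrightarrow> \<epsilon> > 0 \<Longrightarrow> \<forall>\<^sub>F (n, t) in linear_range \<delta>.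
       max 0 (\<bar>\<rho> n (Suc t)\<bar> - \<epsilon>) \<le> (1 - c * real t powr - \<gamma>) * max 0 (\<bar>\<rho> n t\<bar> - \<epsilon>)"
    and d: "\<delta> > 0"
  shows "((\<lambda>(n, t). \<rho> n t) \<longlongrightarrow> 0) (linear_range \<delta>)"
proof (rule tendstoI)
  fix r :: real assume "r > 0"
  define \<epsilon> where "\<epsilon> = r / 3"
  have e: "\<epsilon> > 0" using \<open>r > 0\<close> by (simp add: \<epsilon>_def)
  have d2: "\<delta> / 2 > 0" using d by simp
  obtain n0 where n0: "\<And>n t. n \<ge> n0 \<Longrightarrow> \<delta> / 2 * real n \<le> real t \<Longrightarrow>
      1 \<le> t \<and> \<bar>\<rho> n t\<bar> \<le> K * real t powr \<kappa> \<and>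
      max 0 (\<bar>\<rho> n (Suc t)\<bar> - \<epsilon>) \<le> (1 - c * real t powr - \<gamma>) * max 0 (\<bar>\<rho> n t\<bar> - \<epsilon>)"
  proof -
    have "\<forall>\<^sub>F (n, t) in linear_range (\<delta> / 2). 1 \<le> t \<and> \<bar>\<rho> n t\<bar> \<le> K * real t powr \<kappa> \<and>
      max 0 (\<bar>\<rho> n (Suc t)\<bar> - \<epsilon>) \<le> (1 - c * real t powr - \<gamma>) * max 0 (\<bar>\<rho> n t\<bar> - \<epsilon>)"
      using bound[OF d2] contract[OF d2 e]
        filterlim_snd_linear_range[OF d2, unfolded filterlim_at_top, rule_format, of 1]
      by eventually_elim auto
    then show ?thesis using that unfolding eventually_linear_range by auto
  qed
  have lim: "((\<lambda>t. K * real t powr \<kappa> * exp (- (c * ((real t - 1) / 2) * real t powr - \<gamma>))) \<longlongrightarrow> 0) sequentially"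
    using c g \<kappa> by real_asymp
  have small: "\<forall>\<^sub>F t in sequentially.
      K * real t powr \<kappa> * exp (- (c * ((real t - 1) / 2) * real t powr - \<gamma>)) < \<epsilon>"
    using order_tendstoD(2)[OF lim e] .
  have step: "max 0 (\<bar>\<rho> n t\<bar> - \<epsilon>) \<le> K * real t powr \<kappa> * exp (- (c * ((real t - 1) / 2) * real t powr - \<gamma>))"
    if n: "n \<ge> n0" and t: "\<delta> * real n \<le> real t" for n t
  proof -
    \<comment> \<open>Contract from half-time on: half-time lies in the range of \<open>\<delta> / 2\<close>.\<close>
    define t0 where "t0 = (t + 1) div 2"
    have "t \<le> 2 * ((t + 1) div 2)" "2 * ((t + 1) div 2) \<le> t + 1" by auto
    then have "real t \<le> real (2 * ((t + 1) div 2))" "real (2 * ((t + 1) div 2)) \<le> real (t + 1)"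
      by (simp_all only: of_nat_le_iff)
    then have t0: "real t / 2 \<le> real t0" "real t0 \<le> (real t + 1) / 2" unfolding t0_def by simp_all
    then have start: "\<delta> / 2 * real n \<le> real t0" using t by (simp add: field_simps)
    have t01: "1 \<le> t0" using n0[OF n start] by simp
    then have tle: "t0 \<le> t" unfolding t0_def by linarith
    define p where "p = real t powr - \<gamma>"
    have ind: "max 0 (\<bar>\<rho> n (t0 + d)\<bar> - \<epsilon>) \<le> max 0 (\<bar>\<rho> n t0\<bar> - \<epsilon>) * exp (- (c * real d * p))" if "t0 + d \<le> t" for d
      using that
    proof (induction d)
      case 0 then show ?case by simp
    next
      case (Suc d)
      let ?v = "max 0 (\<bar>\<rho> n (t0 + d)\<bar> - \<epsilon>)"
      have u: "\<delta> / 2 * real n \<le> real (t0 + d)" using start by simp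
      have "p \<le> real (t0 + d) powr - \<gamma>" unfolding p_def
        using Suc.prems t01 g by (intro powr_mono2') auto
      then have "c * p \<le> c * real (t0 + d) powr - \<gamma>" using c by simp
      moreover have "1 - c * p \<le> exp (- (c * p))" using exp_ge_add_one_self[of "- (c * p)"] by simp
      ultimately have "1 - c * real (t0 + d) powr - \<gamma> \<le> exp (- (c * p))" by linarith
      then have "(1 - c * real (t0 + d) powr - \<gamma>) * ?v \<le> exp (- (c * p)) * ?v"
        by (intro mult_right_mono) auto
      moreover have "max 0 (\<bar>\<rho> n (t0 + Suc d)\<bar> - \<epsilon>) \<le> (1 - c * real (t0 + d) powr - \<gamma>) * ?v"
        using n0[OF n u] by simp
      moreover have "exp (- (c * p)) * ?v \<le> exp (- (c * p)) * (max 0 (\<bar>\<rho> n t0\<bar> - \<epsilon>) * exp (- (c * real d * p)))"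
        using Suc by (intro mult_left_mono) auto
      moreover have "exp (- (c * p)) * (max 0 (\<bar>\<rho> n t0\<bar> - \<epsilon>) * exp (- (c * real d * p)))
        = max 0 (\<bar>\<rho> n t0\<bar> - \<epsilon>) * exp (- (c * real (Suc d) * p))"
        by (simp add: algebra_simps flip: exp_add)
      ultimately show ?case by linarith
    qed
    have "max 0 (\<bar>\<rho> n t\<bar> - \<epsilon>) \<le> max 0 (\<bar>\<rho> n t0\<bar> - \<epsilon>) * exp (- (c * real (t - t0) * p))"
      using ind[of "t - t0"] tle by simp
    also have "\<dots> \<le> (K * real t powr \<kappa>) * exp (- (c * ((real t - 1) / 2) * p))"
    proof (intro mult_mono)
      have b: "\<bar>\<rho> n t0\<bar> \<le> K * real t0 powr \<kappa>" using n0[OF n start] by simp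
      then have "0 \<le> K * real t0 powr \<kappa>" by linarith
      then have K: "0 \<le> K" using t01 by (simp add: zero_le_mult_iff)
      have "K * real t0 powr \<kappa> \<le> K * real t powr \<kappa>"
        using K tle \<kappa> by (intro mult_left_mono powr_mono2) auto
      then show "max 0 (\<bar>\<rho> n t0\<bar> - \<epsilon>) \<le> K * real t powr \<kappa>" using b e by auto
      show "0 \<le> K * real t powr \<kappa>" using K by simp
      have "(real t - 1) / 2 \<le> real (t - t0)" using t0 tle by (simp add: of_nat_diff)
      then have "c * ((real t - 1) / 2) * p \<le> c * real (t - t0) * p"
        using c by (intro mult_right_mono mult_left_mono) (auto simp: p_def)
      then show "exp (- (c * real (t - t0) * p)) \<le> exp (- (c * ((real t - 1) / 2) * p))"
        by simp
    qed simp
    finally show ?thesis by (simp add: p_def)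
  qed
  have "\<forall>\<^sub>F x in linear_range \<delta>. K * real (snd x) powr \<kappa> * exp (- (c * ((real (snd x) - 1) / 2) * real (snd x) powr - \<gamma>)) < \<epsilon>"
    using filterlim_snd_linear_range[OF d] small unfolding filterlim_iff by blast
  moreover have "\<forall>\<^sub>F (n, t) in linear_range \<delta>. n \<ge> n0 \<and> \<delta> * real n \<le> real t"
    unfolding eventually_linear_range by auto
  ultimately show "\<forall>\<^sub>F x in linear_range \<delta>. dist (case x of (n, t) \<Rightarrow> \<rho> n t) 0 < r"
  proof eventually_elim
    case (elim x)
    obtain n t where x: "x = (n, t)" by fastforce
    have "\<bar>\<rho> n t\<bar> < 2 * \<epsilon>" using step[of n t] elim x by auto
    then show ?case using x e by (simp add: \<epsilon>_def)
  qed
qed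

text \<open>
  The relaxation time \<open>t powr \<gamma>\<close> of the homogeneous recursion is much shorter than the time \<open>t\<close> on
  which \<open>\<epsilon>\<close> and \<open>S\<close> change.  The solution therefore sits at the momentary equilibrium \<open>S / \<epsilon>\<close>, whatever
  its initial value.
\<close>

lemma forced_linear_recursion:
  fixes A \<epsilon> S :: "nat \<Rightarrow> nat \<Rightarrow> real"
  assumes e: "e > 0" and g: "0 < \<gamma>" "\<gamma> < 1" and \<kappa>: "\<kappa> \<ge> 0"
    and bound: "\<And>\<delta>. \<delta> > 0 \<Longrightarrow> \<forall>\<^sub>F (n, t) in linear_range \<delta>. \<bar>A n t\<bar> \<le> 1"
    and rec: "\<And>\<delta>. \<delta> > 0 \<Longrightarrow>
      \<forall>\<^sub>F (n, t) in linear_range \<delta>. A n (Suc t) = (1 - \<epsilon> n t) * A n t + S n t"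
    and lim_\<epsilon>: "\<And>\<delta>. \<delta> > 0 \<Longrightarrow> ((\<lambda>(n, t). \<epsilon> n t * real t powr \<gamma>) \<longlongrightarrow> e) (linear_range \<delta>)"
    and lim_S: "\<And>\<delta>. \<delta> > 0 \<Longrightarrow>
      ((\<lambda>(n, t). S n t * real t powr (\<kappa> + \<gamma>)) \<longlongrightarrow> \<sigma>) (linear_range \<delta>)"
    and d: "\<delta> > 0"
  shows "((\<lambda>(n, t). A n t * real t powr \<kappa>) \<longlongrightarrow> \<sigma> / e) (linear_range \<delta>)"
proof -
  define L where "L = \<sigma> / e"
  define \<rho> where "\<rho> = (\<lambda>n t. A n t * real t powr \<kappa> - L)"
  have "((\<lambda>(n, t). \<rho> n t) \<longlongrightarrow> 0) (linear_range \<delta>)"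
  proof (rule contraction_linear_range[where c = "e / 2" and \<gamma> = \<gamma> and \<kappa> = \<kappa> and K = "1 + \<bar>L\<bar>"])
    fix \<delta> :: real assume d: "\<delta> > 0"
    show "\<forall>\<^sub>F (n, t) in linear_range \<delta>. \<bar>\<rho> n t\<bar> \<le> (1 + \<bar>L\<bar>) * real t powr \<kappa>"
      using bound[OF d] filterlim_snd_linear_range[OF d, unfolded filterlim_at_top, rule_format, of 1]
    proof eventually_elim
      case (elim x)
      obtain n t where x: "x = (n, t)" by fastforce
      have t: "1 \<le> t" and A: "\<bar>A n t\<bar> \<le> 1" using elim x by auto
      have one: "1 \<le> real t powr \<kappa>" using t \<kappa> by (simp add: ge_one_powr_ge_zero)
      have "\<bar>A n t * real t powr \<kappa>\<bar> \<le> real t powr \<kappa>"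
        using A by (simp add: abs_mult mult_left_le_one_le)
      moreover have "\<bar>L\<bar> \<le> \<bar>L\<bar> * real t powr \<kappa>" using one by (simp add: mult_le_cancel_left1)
      ultimately have "\<bar>\<rho> n t\<bar> \<le> real t powr \<kappa> + \<bar>L\<bar> * real t powr \<kappa>" unfolding \<rho>_def by linarith
      then show ?case using x by (simp add: algebra_simps)
    qed
  next
    fix \<delta> \<eta> :: real assume d: "\<delta> > 0" and \<eta>: "\<eta> > 0"
    let ?F = "linear_range \<delta>"
    let ?g = "\<lambda>x. real (snd x) powr \<gamma>"
    define w where "w = (\<lambda>t. (1 + 1 / real t) powr \<kappa>)"
    \<comment> \<open>The error \<open>\<rho>\<close> satisfies \<open>\<rho> n (Suc t) = X n t * \<rho> n t + Y n t\<close>, with \<open>1 - X\<close> of order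
      \<open>e * t powr - \<gamma>\<close> and \<open>Y\<close> of smaller order.\<close>
    define X where "X = (\<lambda>n t. w t * (1 - \<epsilon> n t))"
    define Y where "Y = (\<lambda>n t. (X n t - 1) * L + w t * S n t * real t powr \<kappa>)"
    have w1: "((\<lambda>x. w (snd x)) \<longlongrightarrow> 1) ?F"
      by (rule filterlim_compose[OF _ filterlim_snd_linear_range[OF d]], unfold w_def, real_asymp)
    have w2: "((\<lambda>x. (1 - w (snd x)) * ?g x) \<longlongrightarrow> 0) ?F"
      by (rule filterlim_compose[OF _ filterlim_snd_linear_range[OF d]], unfold w_def, use g \<kappa> in real_asymp)
    have p0: "((\<lambda>x. real (snd x) powr - \<gamma>) \<longlongrightarrow> 0) ?F"
      by (rule filterlim_compose[OF _ filterlim_snd_linear_range[OF d]], use g in real_asymp)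
    have pos: "\<forall>\<^sub>F x in ?F. 1 \<le> snd x"
      using filterlim_snd_linear_range[OF d] unfolding filterlim_at_top by blast
    have "((\<lambda>x. (1 - w (snd x)) * ?g x
        + w (snd x) * (\<epsilon> (fst x) (snd x) * ?g x)) \<longlongrightarrow> 0 + 1 * e) ?F"
      by (intro tendsto_intros w1 w2 lim_\<epsilon>[OF d, unfolded case_prod_beta'])
    then have X1: "((\<lambda>x. (1 - X (fst x) (snd x)) * ?g x) \<longlongrightarrow> e) ?F"
      by (simp add: X_def algebra_simps)
    have "((\<lambda>x. - ((1 - X (fst x) (snd x)) * ?g x) * L
        + w (snd x) * (S (fst x) (snd x) * real (snd x) powr (\<kappa> + \<gamma>))) \<longlongrightarrow> - e * L + 1 * \<sigma>) ?F"
      by (intro tendsto_intros w1 X1 lim_S[OF d, unfolded case_prod_beta'])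
    then have Y1: "((\<lambda>x. Y (fst x) (snd x) * ?g x) \<longlongrightarrow> 0) ?F"
      using e by (simp add: Y_def L_def algebra_simps powr_add)
    have "((\<lambda>x. 1 - (1 - X (fst x) (snd x)) * ?g x * real (snd x) powr - \<gamma>) \<longlongrightarrow> 1 - e * 0) ?F"
      by (intro tendsto_intros X1 p0)
    from order_tendstoD(1)[OF this, of 0]
    have "\<forall>\<^sub>F x in ?F. 0 < 1 - (1 - X (fst x) (snd x)) * ?g x * real (snd x) powr - \<gamma>"
      by simp
    then have X0: "\<forall>\<^sub>F x in ?F. 0 \<le> X (fst x) (snd x)"
      using pos
    proof eventually_elim
      case (elim x)
      have "?g x * real (snd x) powr - \<gamma> = 1" using elim by (simp flip: powr_add)
      then show ?case using elim by (simp add: mult.assoc)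
    qed
    have "((\<lambda>x. (1 - X (fst x) (snd x)) * ?g x
        - \<bar>Y (fst x) (snd x) * ?g x\<bar> / \<eta>) \<longlongrightarrow> e - \<bar>0\<bar> / \<eta>) ?F"
      by (intro tendsto_intros X1 Y1) (use \<eta> in auto)
    from order_tendstoD(1)[OF this, of "e / 2"]
    have "\<forall>\<^sub>F x in ?F. e / 2 < (1 - X (fst x) (snd x)) * ?g x
        - \<bar>Y (fst x) (snd x) * ?g x\<bar> / \<eta>" using e by simp
    then show "\<forall>\<^sub>F (n, t) in ?F. max 0 (\<bar>\<rho> n (Suc t)\<bar> - \<eta>)
        \<le> (1 - e / 2 * real t powr - \<gamma>) * max 0 (\<bar>\<rho> n t\<bar> - \<eta>)"
      using X0 pos rec[OF d]
    proof eventually_elim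
      case (elim x)
      obtain n t where x: "x = (n, t)" by fastforce
      let ?X = "X n t" and ?Y = "Y n t" and ?p = "real t powr - \<gamma>"
      have t: "1 \<le> t" using elim x by simp
      have pg: "?p * real t powr \<gamma> = 1" "?p > 0" using t by (auto simp flip: powr_add)
      have "e / 2 < ((1 - ?X) - \<bar>?Y\<bar> / \<eta>) * real t powr \<gamma>"
        using elim x by (simp add: algebra_simps abs_mult)
      then have "e / 2 * ?p < ((1 - ?X) - \<bar>?Y\<bar> / \<eta>) * real t powr \<gamma> * ?p"
        using pg by simp
      then have 1: "e / 2 * ?p < (1 - ?X) - \<bar>?Y\<bar> / \<eta>" using pg by (simp add: algebra_simps)
      have 2: "?X \<le> 1 - e / 2 * ?p" using 1 \<eta> by (smt (verit) abs_ge_zero divide_nonneg_pos)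
      have "\<bar>?Y\<bar> / \<eta> \<le> 1 - ?X" using 1 e pg(2) by (smt (verit) mult_pos_pos divide_pos_pos)
      then have 3: "\<bar>?Y\<bar> \<le> \<eta> * (1 - ?X)" using \<eta> by (simp add: field_simps)
      have "real (Suc t) = (1 + 1 / real t) * real t" using t by (simp add: field_simps)
      then have w: "real (Suc t) powr \<kappa> = w t * real t powr \<kappa>"
        unfolding w_def by (metis powr_mult)
      have A: "A n (Suc t) = (1 - \<epsilon> n t) * A n t + S n t" using elim x by simp
      have "\<rho> n (Suc t) = ?X * \<rho> n t + ?Y"
        unfolding \<rho>_def X_def Y_def w A by (simp add: algebra_simps)
      then have "\<bar>\<rho> n (Suc t)\<bar> \<le> ?X * \<bar>\<rho> n t\<bar> + \<bar>?Y\<bar>"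
        using elim x abs_triangle_ineq[of "?X * \<rho> n t" ?Y] by (simp add: abs_mult)
      then have "\<bar>\<rho> n (Suc t)\<bar> - \<eta> \<le> ?X * (\<bar>\<rho> n t\<bar> - \<eta>)"
        using 3 by (simp add: algebra_simps)
      also have "\<dots> \<le> ?X * max 0 (\<bar>\<rho> n t\<bar> - \<eta>)"
        using elim x by (intro mult_left_mono) auto
      finally have 4: "\<bar>\<rho> n (Suc t)\<bar> - \<eta> \<le> ?X * max 0 (\<bar>\<rho> n t\<bar> - \<eta>)" .
      have "0 \<le> ?X * max 0 (\<bar>\<rho> n t\<bar> - \<eta>)" using elim x by simp
      then have "max 0 (\<bar>\<rho> n (Suc t)\<bar> - \<eta>) \<le> ?X * max 0 (\<bar>\<rho> n t\<bar> - \<eta>)" using 4 by simp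
      also have "\<dots> \<le> (1 - e / 2 * ?p) * max 0 (\<bar>\<rho> n t\<bar> - \<eta>)" using 2 by (intro mult_right_mono) auto
      finally show ?case using x by simp
    qed
  qed (use assms in auto)
  from tendsto_add[OF this tendsto_const[of L]] show ?thesis
    by (simp add: \<rho>_def L_def case_prod_beta')
qed

text \<open>
  The same mechanism as in \<open>forced_linear_recursion\<close> for a nonlinear equation: \<open>x\<close> follows the
  equilibrium \<open>\<beta> * x\<^sup>2 = S\<close>.  For \<open>r = x * t powr \<gamma>\<close> and the equilibrium \<open>c\<close> the drift is
  \<open>- b * t powr - \<gamma> * (r - c) * (r + c)\<close>, a contraction of \<open>r - c\<close> at a rate of at least
  \<open>b * c * t powr - \<gamma>\<close>; no bound on \<open>r\<close> is known beforehand, so all errors are measured in terms of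
  \<open>(r + c)\<^sup>2\<close>.
\<close>

lemma quadratic_recursion:
  fixes x \<beta> S :: "nat \<Rightarrow> real"
  assumes b: "b > 0" and g: "0 < \<gamma>" "\<gamma> < 1" and s: "s > 0"
    and nonneg: "\<And>t. x t \<ge> 0" and lim_x: "x \<longlonglongrightarrow> 0"
    and rec: "\<And>t. x (Suc t) = x t - \<beta> t * (x t)\<^sup>2 + S t"
    and lim_\<beta>: "\<beta> \<longlonglongrightarrow> b"
    and lim_S: "(\<lambda>t. S t * real t powr (2 * \<gamma>)) \<longlonglongrightarrow> s"
  shows "(\<lambda>t. x t * real t powr \<gamma>) \<longlonglongrightarrow> sqrt (s / b)"
proof -
  define c where "c = sqrt (s / b)"
  have c: "c > 0" "b * c\<^sup>2 = s" using b s by (auto simp: c_def)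
  define r where "r = (\<lambda>t. x t * real t powr \<gamma>)"
  define p where "p = (\<lambda>t. real t powr - \<gamma>)"
  define \<omega> where "\<omega> = (\<lambda>t. ((1 + 1 / real t) powr \<gamma> - 1) * real t powr \<gamma>)"
  define \<sigma> where "\<sigma> = (\<lambda>t. S t * real t powr (2 * \<gamma>))"
  define \<theta> where "\<theta> = (\<lambda>t. \<bar>b - \<beta> t\<bar> + \<bar>\<sigma> t - s\<bar> / c\<^sup>2 + \<bar>\<omega> t\<bar> * (1 / c + p t * (\<bar>\<sigma> t\<bar> / c\<^sup>2 + \<bar>\<beta> t\<bar>)))"
  have w0: "\<omega> \<longlonglongrightarrow> 0" unfolding \<omega>_def using g by real_asymp
  have p0: "p \<longlonglongrightarrow> 0" unfolding p_def using g by real_asymp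
  have s0: "\<sigma> \<longlonglongrightarrow> s" using lim_S by (simp add: \<sigma>_def)
  have "\<theta> \<longlonglongrightarrow> \<bar>b - b\<bar> + \<bar>s - s\<bar> / c\<^sup>2 + \<bar>0\<bar> * (1 / c + 0 * (\<bar>s\<bar> / c\<^sup>2 + \<bar>b\<bar>))"
    unfolding \<theta>_def using c by (intro tendsto_intros w0 p0 s0 lim_\<beta>) auto
  then have th0: "\<theta> \<longlonglongrightarrow> 0" by simp
  have th_nn: "\<theta> t \<ge> 0" for t unfolding \<theta>_def p_def using c by simp
  have ident: "x t = r t * p t" if "t \<ge> 1" for t
    using that by (simp add: r_def p_def flip: powr_add)
  have step: "r (Suc t) - c = (r t - c) * (1 - b * p t * (r t + c))
      + p t * ((b - \<beta> t) * (r t)\<^sup>2 + (\<sigma> t - s) + \<omega> t * (r t + p t * (\<sigma> t - \<beta> t * (r t)\<^sup>2)))"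
    if t: "t \<ge> 1" for t
  proof -
    let ?g = "real t powr \<gamma>"
    have pg: "p t * ?g = 1" using t by (simp add: p_def flip: powr_add)
    have "real (Suc t) = (1 + 1 / real t) * real t" using t by (simp add: field_simps)
    then have "real (Suc t) powr \<gamma> = (1 + 1 / real t) powr \<gamma> * ?g" by (metis powr_mult)
    also have "(1 + 1 / real t) powr \<gamma> = 1 + \<omega> t * p t" using pg by (simp add: \<omega>_def algebra_simps)
    finally have 1: "real (Suc t) powr \<gamma> = (1 + \<omega> t * p t) * ?g" .
    have S: "S t * ?g = \<sigma> t * p t"
      unfolding \<sigma>_def mult_2 powr_add using pg by (simp add: algebra_simps)
    have x2: "(x t)\<^sup>2 * ?g = (r t)\<^sup>2 * p t"
      using pg ident[OF t] by (simp add: power2_eq_square algebra_simps)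
    have "r (Suc t) = (1 + \<omega> t * p t) * (x t * ?g - \<beta> t * ((x t)\<^sup>2 * ?g) + S t * ?g)"
      unfolding r_def rec 1 by (simp add: algebra_simps)
    also have "\<dots> = (1 + \<omega> t * p t) * (r t - \<beta> t * ((r t)\<^sup>2 * p t) + \<sigma> t * p t)"
      unfolding S x2 by (simp add: r_def)
    finally show ?thesis
      unfolding c(2)[symmetric] by (simp add: algebra_simps power2_eq_square)
  qed
  have r_nn: "r t \<ge> 0" for t by (simp add: r_def nonneg)
  have err: "\<bar>(b - \<beta> t) * (r t)\<^sup>2 + (\<sigma> t - s) + \<omega> t * (r t + p t * (\<sigma> t - \<beta> t * (r t)\<^sup>2))\<bar>
      \<le> \<theta> t * (r t + c)\<^sup>2" for t
  proof -
    let ?q = "(r t + c)\<^sup>2"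
    have pn: "p t \<ge> 0" by (simp add: p_def)
    have q1: "(r t)\<^sup>2 \<le> ?q" using r_nn c by (intro power_mono) auto
    have q2: "1 \<le> ?q / c\<^sup>2" using r_nn[of t] c(1) by (simp add: power_mono)
    have q3: "r t \<le> ?q / c" using r_nn[of t] c(1) by (simp add: field_simps power2_eq_square)
    have "\<bar>(b - \<beta> t) * (r t)\<^sup>2\<bar> \<le> \<bar>b - \<beta> t\<bar> * ?q" by (simp add: abs_mult mult_left_mono q1)
    moreover have "\<bar>\<sigma> t - s\<bar> \<le> \<bar>\<sigma> t - s\<bar> * (?q / c\<^sup>2)"
      using mult_left_mono[OF q2, of "\<bar>\<sigma> t - s\<bar>"] by simp
    moreover have "\<bar>\<sigma> t - \<beta> t * (r t)\<^sup>2\<bar> \<le> \<bar>\<sigma> t\<bar> * (?q / c\<^sup>2) + \<bar>\<beta> t\<bar> * ?q"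
    proof -
      have "\<bar>\<sigma> t\<bar> \<le> \<bar>\<sigma> t\<bar> * (?q / c\<^sup>2)" using mult_left_mono[OF q2, of "\<bar>\<sigma> t\<bar>"] by simp
      moreover have "\<bar>\<beta> t * (r t)\<^sup>2\<bar> \<le> \<bar>\<beta> t\<bar> * ?q" by (simp add: abs_mult mult_left_mono q1)
      ultimately show ?thesis by linarith
    qed
    then have "p t * \<bar>\<sigma> t - \<beta> t * (r t)\<^sup>2\<bar> \<le> p t * (\<bar>\<sigma> t\<bar> * (?q / c\<^sup>2) + \<bar>\<beta> t\<bar> * ?q)"
      using pn by (intro mult_left_mono)
    then have "\<bar>r t + p t * (\<sigma> t - \<beta> t * (r t)\<^sup>2)\<bar> \<le> ?q / c + p t * (\<bar>\<sigma> t\<bar> * (?q / c\<^sup>2) + \<bar>\<beta> t\<bar> * ?q)"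
      using q3 r_nn[of t] abs_triangle_ineq[of "r t" "p t * (\<sigma> t - \<beta> t * (r t)\<^sup>2)"] pn
      by (simp add: abs_mult)
    then have "\<bar>\<omega> t * (r t + p t * (\<sigma> t - \<beta> t * (r t)\<^sup>2))\<bar>
        \<le> \<bar>\<omega> t\<bar> * (?q / c + p t * (\<bar>\<sigma> t\<bar> * (?q / c\<^sup>2) + \<bar>\<beta> t\<bar> * ?q))"
      by (simp add: abs_mult mult_left_mono)
    moreover have "\<theta> t * ?q = \<bar>b - \<beta> t\<bar> * ?q + \<bar>\<sigma> t - s\<bar> * (?q / c\<^sup>2)
        + \<bar>\<omega> t\<bar> * (?q / c + p t * (\<bar>\<sigma> t\<bar> * (?q / c\<^sup>2) + \<bar>\<beta> t\<bar> * ?q))"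
      unfolding \<theta>_def by (simp add: algebra_simps)
    ultimately show ?thesis by linarith
  qed
  have "((\<lambda>(n :: nat, t). r t - c) \<longlongrightarrow> 0) (linear_range 1)"
  proof (rule contraction_linear_range[where c = "b / 2 * c" and \<gamma> = \<gamma> and \<kappa> = \<gamma> and K = "1 + c"])
    fix \<delta> :: real assume d: "\<delta> > 0"
    have "\<forall>\<^sub>F t in sequentially. \<bar>r t - c\<bar> \<le> (1 + c) * real t powr \<gamma>"
      using order_tendstoD(2)[OF lim_x, of 1, simplified] eventually_ge_at_top[of 1]
    proof eventually_elim
      case (elim t)
      have one: "1 \<le> real t powr \<gamma>" using elim g by (simp add: ge_one_powr_ge_zero)
      have "r t \<le> 1 * real t powr \<gamma>" unfolding r_def using elim by (intro mult_right_mono) auto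
      moreover have "c \<le> c * real t powr \<gamma>" using one c by simp
      ultimately show ?case using r_nn[of t] c unfolding distrib_right by linarith
    qed
    from eventually_compose_filterlim[OF this filterlim_snd_linear_range[OF d]]
    show "\<forall>\<^sub>F (n, t) in linear_range \<delta>. \<bar>r t - c\<bar> \<le> (1 + c) * real t powr \<gamma>"
      by (simp add: case_prod_beta')
  next
    fix \<delta> \<eta> :: real assume d: "\<delta> > 0" and \<eta>: "\<eta> > 0"
    have "(\<lambda>t. b * (x t + p t * c)) \<longlonglongrightarrow> b * (0 + 0 * c)" by (intro tendsto_intros lim_x p0)
    from order_tendstoD(2)[OF this, of 1]
    have ev1: "\<forall>\<^sub>F t in sequentially. b * (x t + p t * c) < 1" by simp
    have "(\<lambda>t. 2 * c * \<theta> t - (b - \<theta> t) * \<eta>) \<longlonglongrightarrow> 2 * c * 0 - (b - 0) * \<eta>" by (intro tendsto_intros th0)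
    from order_tendstoD(2)[OF this, of 0]
    have ev2: "\<forall>\<^sub>F t in sequentially. 2 * c * \<theta> t - (b - \<theta> t) * \<eta> < 0" using b \<eta> by simp
    have ev3: "\<forall>\<^sub>F t in sequentially. \<theta> t < b / 2" using order_tendstoD(2)[OF th0, of "b / 2"] b by simp
    have "\<forall>\<^sub>F t in sequentially. max 0 (\<bar>r (Suc t) - c\<bar> - \<eta>)
        \<le> (1 - b / 2 * c * real t powr - \<gamma>) * max 0 (\<bar>r t - c\<bar> - \<eta>)"
      using ev1 ev2 ev3 eventually_ge_at_top[of 1]
    proof eventually_elim
      case (elim t)
      let ?R = "r t + c" and ?d = "\<bar>r t - c\<bar>" and ?p = "p t"
      define X where "X = (b - \<theta> t) * ?p * ?R"
      have p: "?p > 0" using elim by (simp add: p_def)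
      have R: "?R > 0" using r_nn[of t] c by linarith
      have "b * ?p * ?R < 1" using elim ident[of t] by (simp add: algebra_simps)
      moreover have "\<theta> t * ?p * ?R \<ge> 0" using th_nn[of t] p R by simp
      ultimately have X1: "X \<le> 1" and bp: "0 \<le> 1 - b * ?p * ?R" unfolding X_def by (auto simp: algebra_simps)
      have "b / 2 * (?p * c) \<le> (b - \<theta> t) * (?p * ?R)"
        using elim p R c r_nn[of t] b by (intro mult_mono) auto
      then have X2: "b / 2 * c * ?p \<le> X" unfolding X_def by (simp add: algebra_simps)
      have "\<bar>r (Suc t) - c\<bar> \<le> ?d * (1 - b * ?p * ?R) + ?p * (\<theta> t * ?R\<^sup>2)"
        unfolding step[OF elim(4)] using abs_triangle_ineq bp p err[of t]
        by (intro order_trans[OF abs_triangle_ineq] add_mono) (auto simp: abs_mult intro!: mult_left_mono)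
      \<comment> \<open>\<open>r + c \<le> 2 * c + \<bar>r - c\<bar>\<close> trades one factor of the quadratic error for the contraction.\<close>
      also have "?p * (\<theta> t * ?R\<^sup>2) \<le> ?p * (\<theta> t * (?R * (2 * c + ?d)))"
        using p th_nn[of t] R by (intro mult_left_mono) (auto simp: power2_eq_square)
      also have "?d * (1 - b * ?p * ?R) + ?p * (\<theta> t * (?R * (2 * c + ?d)))
          = ?d * (1 - X) + (2 * c * \<theta> t) * (?p * ?R)" unfolding X_def by (simp add: algebra_simps)
      also have "(2 * c * \<theta> t) * (?p * ?R) \<le> ((b - \<theta> t) * \<eta>) * (?p * ?R)"
        using elim p R by (intro mult_right_mono) auto
      also have "\<dots> = X * \<eta>" unfolding X_def by simp
      finally have "\<bar>r (Suc t) - c\<bar> - \<eta> \<le> (1 - X) * (?d - \<eta>)" by (simp add: algebra_simps)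
      also have "\<dots> \<le> (1 - X) * max 0 (?d - \<eta>)" using X1 by (intro mult_left_mono) auto
      finally have "max 0 (\<bar>r (Suc t) - c\<bar> - \<eta>) \<le> (1 - X) * max 0 (?d - \<eta>)"
        using X1 by (simp add: max_def)
      also have "\<dots> \<le> (1 - b / 2 * c * ?p) * max 0 (?d - \<eta>)" using X2 by (intro mult_right_mono) auto
      finally show ?case by (simp add: p_def)
    qed
    from eventually_compose_filterlim[OF this filterlim_snd_linear_range[OF d]]
    show "\<forall>\<^sub>F (n, t) in linear_range \<delta>. max 0 (\<bar>r (Suc t) - c\<bar> - \<eta>)
        \<le> (1 - b / 2 * c * real t powr - \<gamma>) * max 0 (\<bar>r t - c\<bar> - \<eta>)"
      by (simp add: case_prod_beta')
  qed (use b c g in auto)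
  from filterlim_compose[OF this filterlim_Pair_linear_range[of 1 "\<lambda>n. n"]]
  have "(\<lambda>t. r t - c) \<longlonglongrightarrow> 0" by simp
  from tendsto_add[OF this tendsto_const[of c]] show ?thesis by (simp add: r_def c_def)
qed

lemma stolz_cesaro:
  fixes a :: "nat \<Rightarrow> real"
  assumes "(\<lambda>t. a (Suc t) - a t) \<longlonglongrightarrow> b"
  shows "(\<lambda>t. a t / real t) \<longlonglongrightarrow> b"
proof (rule tendstoI)
  fix r :: real assume "r > 0"
  then have "r / 2 > 0" by simp
  then obtain K where K: "\<And>t. t \<ge> K \<Longrightarrow> \<bar>a (Suc t) - a t - b\<bar> < r / 2"
    using assms unfolding tendsto_iff eventually_sequentially dist_real_def by metis
  have ind: "\<bar>a (K + d) - a K - b * real d\<bar> \<le> r / 2 * real d" for d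
  proof (induction d)
    case (Suc d)
    have "\<bar>a (Suc (K + d)) - a (K + d) - b\<bar> < r / 2" using K[of "K + d"] by simp
    moreover have "a (K + Suc d) - a K - b * real (Suc d)
        = (a (K + d) - a K - b * real d) + (a (Suc (K + d)) - a (K + d) - b)" by (simp add: algebra_simps)
    moreover have "r / 2 * real (Suc d) = r / 2 * real d + r / 2" by (simp add: algebra_simps)
    ultimately show ?case using Suc by linarith
  qed simp
  have "(\<lambda>t. (\<bar>a K\<bar> + \<bar>b\<bar> * real K) / real t) \<longlonglongrightarrow> 0" by real_asymp
  from order_tendstoD(2)[OF this \<open>r / 2 > 0\<close>]
  show "\<forall>\<^sub>F t in sequentially. dist (a t / real t) b < r"
    using eventually_gt_at_top[of K]
  proof eventually_elim
    case (elim t)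
    then have t: "real t > 0" by simp
    have "\<bar>a t - a K - b * (real t - real K)\<bar> \<le> r / 2 * (real t - real K)"
      using ind[of "t - K"] elim by (simp add: of_nat_diff)
    moreover have "r / 2 * (real t - real K) \<le> r / 2 * real t" using \<open>r > 0\<close> by simp
    moreover have "\<bar>a K - b * real K\<bar> \<le> \<bar>a K\<bar> + \<bar>b\<bar> * real K"
      using abs_triangle_ineq4[of "a K" "b * real K"] by (simp add: abs_mult)
    moreover have "a t - b * real t = (a t - a K - b * (real t - real K)) + (a K - b * real K)"
      "r / 2 * (real t - real K) = r / 2 * real t - r / 2 * real K" "r / 2 * real K \<ge> 0"
      using \<open>r > 0\<close> by (simp_all add: field_simps)
    ultimately have "\<bar>a t - b * real t\<bar> \<le> r / 2 * real t + (\<bar>a K\<bar> + \<bar>b\<bar> * real K)"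
      by linarith
    also have "\<bar>a K\<bar> + \<bar>b\<bar> * real K < r / 2 * real t" using elim t by (simp add: divide_less_eq)
    finally have "\<bar>a t - b * real t\<bar> < r * real t" by simp
    moreover have "\<bar>a t / real t - b\<bar> = \<bar>a t - b * real t\<bar> / real t" using t by (simp add: field_simps)
    ultimately show ?case using t by (simp add: dist_real_def divide_less_eq)
  qed
qed

text \<open>
  The reciprocals \<open>1 / x\<close> have increments tending to \<open>b\<close>.
\<close>

lemma critical_recursion:
  fixes x \<beta> :: "nat \<Rightarrow> real"
  assumes b: "b > 0" and pos: "\<And>t. x t > 0" and lim_x: "x \<longlonglongrightarrow> 0"
    and rec: "\<And>t. x (Suc t) = x t - \<beta> t * (x t)\<^sup>2"
    and lim_\<beta>: "\<beta> \<longlonglongrightarrow> b"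
  shows "(\<lambda>t. x t * real t) \<longlonglongrightarrow> 1 / b"
proof -
  have "1 / x (Suc t) - 1 / x t = \<beta> t / (1 - \<beta> t * x t)" for t
  proof -
    have e: "x (Suc t) = x t * (1 - \<beta> t * x t)" unfolding rec by (simp add: power2_eq_square algebra_simps)
    then have "1 - \<beta> t * x t > 0" using pos[of t] pos[of "Suc t"] by (simp add: zero_less_mult_iff)
    then show ?thesis unfolding e using pos[of t] by (simp add: field_simps)
  qed
  moreover have "(\<lambda>t. \<beta> t / (1 - \<beta> t * x t)) \<longlonglongrightarrow> b / (1 - b * 0)"
    by (intro tendsto_intros lim_\<beta> lim_x) simp
  ultimately have "(\<lambda>t. 1 / x (Suc t) - 1 / x t) \<longlonglongrightarrow> b" by simp
  from tendsto_inverse[OF stolz_cesaro[OF this]] b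
  show ?thesis by (simp add: field_simps)
qed

section \<open>Generating function of one critical offspring law\<close>

text \<open>
  Bounds uniform in \<open>q\<close>, so that dominated convergence needs no more than a second moment.
\<close>

lemma power_expansion_dominated:
  fixes q :: real assumes "0 < q" "q \<le> 1"
  shows "0 \<le> ((1 - q) ^ n - 1 + real n * q) / q\<^sup>2" "((1 - q) ^ n - 1 + real n * q) / q\<^sup>2 \<le> (real n)\<^sup>2"
proof -
  have 1: "1 - real n * q \<le> (1 - q) ^ n"
    using Bernoulli_inequality[of "- q" n] assms by simp
  have "(1 - q) ^ n \<le> 1 - real n * q + (real n)\<^sup>2 * q\<^sup>2"
  proof (induction n)
    case (Suc n)
    have "(1 - q) ^ Suc n \<le> (1 - q) * (1 - real n * q + (real n)\<^sup>2 * q\<^sup>2)"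
      using Suc assms by (simp add: mult_left_mono)
    also have "\<dots> = 1 - real (Suc n) * q + ((real n)\<^sup>2 + real n) * q\<^sup>2 - (real n)\<^sup>2 * q ^ 3"
      by (simp add: algebra_simps power2_eq_square power3_eq_cube)
    also have "\<dots> \<le> 1 - real (Suc n) * q + (real (Suc n))\<^sup>2 * q\<^sup>2"
    proof -
      have "((real n)\<^sup>2 + real n) * q\<^sup>2 \<le> (real (Suc n))\<^sup>2 * q\<^sup>2"
        by (intro mult_right_mono) (auto simp: power2_eq_square algebra_simps)
      moreover have "0 \<le> (real n)\<^sup>2 * q ^ 3" using assms by simp
      ultimately show ?thesis by linarith
    qed
    finally show ?case .
  qed simp
  then show "((1 - q) ^ n - 1 + real n * q) / q\<^sup>2 \<le> (real n)\<^sup>2"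
    using assms by (simp add: divide_le_eq)
  show "0 \<le> ((1 - q) ^ n - 1 + real n * q) / q\<^sup>2" using 1 by simp
qed

text \<open>
  The derivative of \<open>x ^ n\<close> at the two ends bounds the difference; every estimate below on differences
  of generating functions is an expectation of this one.
\<close>

lemma power_difference_le:
  fixes x y :: real assumes "0 \<le> x" "x \<le> y"
  shows "y ^ n - x ^ n \<le> real n * y ^ (n - 1) * (y - x)" "real n * x ^ (n - 1) * (y - x) \<le> y ^ n - x ^ n"
proof -
  have e: "y ^ n - x ^ n = (y - x) * (\<Sum>i<n. x ^ (n - Suc i) * y ^ i)"
    using power_diff_sumr2[of y n x] by simp
  have "(\<Sum>i<n. x ^ (n - Suc i) * y ^ i) \<le> (\<Sum>i<n. y ^ (n - 1))"
  proof (rule sum_mono)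
    fix i assume "i \<in> {..<n}"
    then have "y ^ (n - 1) = y ^ (n - Suc i) * y ^ i" by (simp flip: power_add)
    then show "x ^ (n - Suc i) * y ^ i \<le> y ^ (n - 1)" using assms by (auto intro!: mult_right_mono power_mono)
  qed
  from mult_left_mono[OF this, of "y - x"] show "y ^ n - x ^ n \<le> real n * y ^ (n - 1) * (y - x)"
    unfolding e using assms by (simp add: algebra_simps)
  have "(\<Sum>i<n. x ^ (n - 1)) \<le> (\<Sum>i<n. x ^ (n - Suc i) * y ^ i)"
  proof (rule sum_mono)
    fix i assume "i \<in> {..<n}"
    then have "x ^ (n - 1) = x ^ (n - Suc i) * x ^ i" by (simp flip: power_add)
    then show "x ^ (n - 1) \<le> x ^ (n - Suc i) * y ^ i" using assms by (auto intro!: mult_left_mono power_mono)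
  qed
  from mult_left_mono[OF this, of "y - x"] show "real n * x ^ (n - 1) * (y - x) \<le> y ^ n - x ^ n"
    unfolding e using assms by (simp add: algebra_simps)
qed

lemma one_minus_prod_power_le:
  fixes x :: "'i \<Rightarrow> real"
  assumes "finite J" "\<And>j. j \<in> J \<Longrightarrow> x j \<in> {0..1}"
  shows "1 - (\<Prod>j\<in>J. x j ^ n j) \<le> (\<Sum>j\<in>J. real (n j) * (1 - x j))"
  using assms
proof (induction J)
  case (insert a J)
  let ?P = "\<Prod>j\<in>J. x j ^ n j"
  have a: "0 \<le> x a" "x a \<le> 1" using insert.prems[of a] by auto
  have P: "?P \<le> 1" using insert.prems by (intro prod_le_1) (auto simp: power_le_one)
  have "1 - x a ^ n a \<le> real (n a) * (1 - x a)"
    using a Bernoulli_inequality[of "x a - 1" "n a"] by (simp add: algebra_simps)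
  moreover have "x a ^ n a * (1 - ?P) \<le> 1 * (1 - ?P)"
    using a P by (intro mult_right_mono power_le_one) auto
  moreover have "1 - ?P \<le> (\<Sum>j\<in>J. real (n j) * (1 - x j))" using insert by simp
  ultimately show ?case using insert.hyps by (simp add: algebra_simps)
qed simp

lemma tendsto_sum_geometric:
  "((\<lambda>q::real. \<Sum>j<n. (1 - q) ^ j) \<longlongrightarrow> real n) (at_right 0)"
proof -
  have "((\<lambda>q::real. \<Sum>j<n. (1 - q) ^ j) \<longlongrightarrow> (\<Sum>j<n. (1 - 0) ^ j)) (at_right 0)"
    by (intro tendsto_intros)
  then show ?thesis by simp
qed

lemma one_minus_power_sum: "1 - (1 - q) ^ n = q * (\<Sum>j<n. (1 - q) ^ j)" for q :: real
  using one_diff_power_eq[of "1 - q" n] by simp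

lemma power_expansion_limit:
  "((\<lambda>q::real. ((1 - q) ^ n - 1 + real n * q) / q\<^sup>2) \<longlongrightarrow> real n * (real n - 1) / 2) (at_right 0)"
proof -
  have eq: "((1 - q) ^ n - 1 + real n * q) / q\<^sup>2 = (\<Sum>j<n. \<Sum>l<j. (1 - q) ^ l)" if "q > 0" for q :: real
  proof -
    have "(1 - q) ^ n - 1 + real n * q = q * (\<Sum>j<n. 1 - (1 - q) ^ j)"
      using one_minus_power_sum[of q n] by (simp add: sum_subtractf algebra_simps)
    also have "(\<Sum>j<n. 1 - (1 - q) ^ j) = q * (\<Sum>j<n. \<Sum>l<j. (1 - q) ^ l)"
      by (simp add: one_minus_power_sum sum_distrib_left)
    finally show ?thesis using that by (simp add: power2_eq_square)
  qed
  have s: "(\<Sum>j<n. real j) = real n * (real n - 1) / 2" by (induction n) (auto simp: field_simps)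
  have "((\<lambda>q::real. \<Sum>j<n. \<Sum>l<j. (1 - q) ^ l) \<longlongrightarrow> real n * (real n - 1) / 2) (at_right 0)"
    unfolding s[symmetric] by (intro tendsto_sum tendsto_sum_geometric)
  then show ?thesis
    by (rule Lim_transform_eventually) (use eq in \<open>auto simp: eventually_at_filter\<close>)
qed

lemma integral_dominated_at_right:
  fixes s :: "real \<Rightarrow> 'w \<Rightarrow> real"
  assumes meas: "\<And>q. s q \<in> borel_measurable M" and f: "f \<in> borel_measurable M" and w: "integrable M w"
    and lim: "\<And>\<omega>. ((\<lambda>q. s q \<omega>) \<longlongrightarrow> f \<omega>) (at_right 0)"
    and bound: "\<And>q \<omega>. 0 < q \<Longrightarrow> q \<le> 1 \<Longrightarrow> \<bar>s q \<omega>\<bar> \<le> w \<omega>"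
  shows "((\<lambda>q. \<integral>\<omega>. s q \<omega> \<partial>M) \<longlongrightarrow> (\<integral>\<omega>. f \<omega> \<partial>M)) (at_right 0)"
proof -
  have "((\<lambda>q. \<integral>\<omega>. s (inverse q) \<omega> \<partial>M) \<longlongrightarrow> (\<integral>\<omega>. f \<omega> \<partial>M)) at_top"
  proof (rule integral_dominated_convergence_at_top[where w = w])
    have "((\<lambda>q. s (inverse q) \<omega>) \<longlongrightarrow> f \<omega>) at_top" for \<omega>
      using lim[of \<omega>] filterlim_at_right_to_top[of "\<lambda>q. s q \<omega>" "nhds (f \<omega>)"] by simp
    then show "AE \<omega> in M. ((\<lambda>q. s (inverse q) \<omega>) \<longlongrightarrow> f \<omega>) at_top" by simp
    show "\<forall>\<^sub>F q in at_top. AE \<omega> in M. norm (s (inverse q) \<omega>) \<le> w \<omega>"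
      using eventually_ge_at_top[of 1] by eventually_elim (auto intro!: bound simp: inverse_le_1_iff)
  qed (use assms in auto)
  then show ?thesis
    using filterlim_at_right_to_top[of "\<lambda>q. \<integral>\<omega>. s q \<omega> \<partial>M" "nhds (\<integral>\<omega>. f \<omega> \<partial>M)"] by simp
qed

text \<open>
  The law of the number of children of a particle's own type.
\<close>

locale critical_offspring = prob_space M for M :: "'w measure" +
  fixes \<xi> :: "'w \<Rightarrow> nat" and b :: real
  assumes rv [measurable]: "\<xi> \<in> M \<rightarrow>\<^sub>M count_space UNIV"
    and square_integrable: "integrable M (\<lambda>\<omega>. (real (\<xi> \<omega>))\<^sup>2)"
    and critical: "(\<integral>\<omega>. real (\<xi> \<omega>) \<partial>M) = 1"
    and half_var: "b = 1 / 2 * (\<integral>\<omega>. (real (\<xi> \<omega>) - 1)\<^sup>2 \<partial>M)"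
    and half_var_pos: "b > 0"
begin

lemma integrable_offspring: "integrable M (\<lambda>\<omega>. real (\<xi> \<omega>))"
  by (rule Bochner_Integration.integrable_bound[OF square_integrable])
    (auto intro!: AE_I2 simp: power2_eq_square mult_le_cancel_left1 le_square)

definition pgf :: "real \<Rightarrow> real" where "pgf x = (\<integral>\<omega>. x ^ \<xi> \<omega> \<partial>M)"
definition pgf_deriv :: "real \<Rightarrow> real" where "pgf_deriv x = (\<integral>\<omega>. real (\<xi> \<omega>) * x ^ (\<xi> \<omega> - 1) \<partial>M)"

lemma integrable_power: "(x :: real) \<in> {0..1} \<Longrightarrow> integrable M (\<lambda>\<omega>. x ^ \<xi> \<omega>)"
  by (rule integrable_const_bound[where B = 1]) (auto simp: power_le_one)

lemma integrable_deriv: "(x :: real) \<in> {0..1} \<Longrightarrow> integrable M (\<lambda>\<omega>. real (\<xi> \<omega>) * x ^ (\<xi> \<omega> - 1))"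
  by (rule Bochner_Integration.integrable_bound[OF integrable_offspring])
    (auto intro!: AE_I2 simp: power_le_one mult_left_le)

lemma expectation_factorial: "(\<integral>\<omega>. real (\<xi> \<omega>) * (real (\<xi> \<omega>) - 1) \<partial>M) = 2 * b"
proof -
  have "(\<integral>\<omega>. (real (\<xi> \<omega>) - 1)\<^sup>2 \<partial>M) = (\<integral>\<omega>. (real (\<xi> \<omega>))\<^sup>2 - 2 * real (\<xi> \<omega>) + 1 \<partial>M)"
    by (simp add: power2_eq_square algebra_simps)
  also have "\<dots> = (\<integral>\<omega>. (real (\<xi> \<omega>))\<^sup>2 \<partial>M) - 1"
    using square_integrable integrable_offspring by (simp add: critical prob_space)
  also have "\<dots> = (\<integral>\<omega>. (real (\<xi> \<omega>))\<^sup>2 - real (\<xi> \<omega>) \<partial>M)"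
    using square_integrable integrable_offspring by (simp add: critical)
  finally show ?thesis using half_var by (simp add: power2_eq_square algebra_simps)
qed

lemma pgf_expansion_eq:
  assumes "0 < q" "q \<le> 1"
  shows "(pgf (1 - q) - 1 + q) / q\<^sup>2 = (\<integral>\<omega>. ((1 - q) ^ \<xi> \<omega> - 1 + real (\<xi> \<omega>) * q) / q\<^sup>2 \<partial>M)"
  using assms integrable_power[of "1 - q"] integrable_offspring
  by (simp add: pgf_def critical prob_space)

lemma pgf_expansion: "((\<lambda>q. (pgf (1 - q) - 1 + q) / q\<^sup>2) \<longlongrightarrow> b) (at_right 0)"
proof -
  have "((\<lambda>q. \<integral>\<omega>. ((1 - q) ^ \<xi> \<omega> - 1 + real (\<xi> \<omega>) * q) / q\<^sup>2 \<partial>M) \<longlongrightarrow>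
      (\<integral>\<omega>. real (\<xi> \<omega>) * (real (\<xi> \<omega>) - 1) / 2 \<partial>M)) (at_right 0)"
  proof (rule integral_dominated_at_right[OF _ _ square_integrable])
    fix q \<omega> assume "0 < q" "q \<le> (1::real)"
    from power_expansion_dominated[OF this, of "\<xi> \<omega>"]
    show "\<bar>((1 - q) ^ \<xi> \<omega> - 1 + real (\<xi> \<omega>) * q) / q\<^sup>2\<bar> \<le> (real (\<xi> \<omega>))\<^sup>2" by simp
  qed (auto intro: power_expansion_limit)
  also have "(\<integral>\<omega>. real (\<xi> \<omega>) * (real (\<xi> \<omega>) - 1) / 2 \<partial>M) = b"
    using expectation_factorial by simp
  finally show ?thesis
  proof (rule Lim_transform_eventually)
    show "\<forall>\<^sub>F q in at_right 0. (\<integral>\<omega>. ((1 - q) ^ \<xi> \<omega> - 1 + real (\<xi> \<omega>) * q) / q\<^sup>2 \<partial>M)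
        = (pgf (1 - q) - 1 + q) / q\<^sup>2"
      using eventually_at_right_real[OF zero_less_one]
      by eventually_elim (rule pgf_expansion_eq[symmetric]; simp)
  qed
qed

lemma pgf_deriv_expansion: "((\<lambda>q. (1 - pgf_deriv (1 - q)) / q) \<longlongrightarrow> 2 * b) (at_right 0)"
proof -
  have "((\<lambda>q. \<integral>\<omega>. real (\<xi> \<omega>) * (\<Sum>j<\<xi> \<omega> - 1. (1 - q) ^ j) \<partial>M) \<longlongrightarrow>
      (\<integral>\<omega>. real (\<xi> \<omega>) * real (\<xi> \<omega> - 1) \<partial>M)) (at_right 0)"
  proof (rule integral_dominated_at_right[OF _ _ square_integrable])
    fix q \<omega> assume q: "0 < q" "q \<le> (1::real)"
    have "(\<Sum>j<\<xi> \<omega> - 1. (1 - q) ^ j) \<le> (\<Sum>j<\<xi> \<omega> - 1. 1)"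
      using q by (intro sum_mono) (auto simp: power_le_one)
    moreover have "0 \<le> (\<Sum>j<\<xi> \<omega> - 1. (1 - q) ^ j)" using q by (intro sum_nonneg) auto
    ultimately show "\<bar>real (\<xi> \<omega>) * (\<Sum>j<\<xi> \<omega> - 1. (1 - q) ^ j)\<bar> \<le> (real (\<xi> \<omega>))\<^sup>2"
      by (auto simp: power2_eq_square abs_mult intro!: mult_left_mono)
  qed (auto intro!: tendsto_intros tendsto_sum_geometric)
  also have "(\<integral>\<omega>. real (\<xi> \<omega>) * real (\<xi> \<omega> - 1) \<partial>M) = 2 * b"
    unfolding expectation_factorial[symmetric]
    by (intro Bochner_Integration.integral_cong refl) (auto simp: of_nat_diff_if)
  finally show ?thesis
  proof (rule Lim_transform_eventually)
    have "(\<integral>\<omega>. real (\<xi> \<omega>) * (\<Sum>j<\<xi> \<omega> - 1. (1 - q) ^ j) \<partial>M) = (1 - pgf_deriv (1 - q)) / q"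
      if q: "0 < q" "q < 1" for q
    proof -
      have "(1 - pgf_deriv (1 - q)) / q = (\<integral>\<omega>. (real (\<xi> \<omega>) - real (\<xi> \<omega>) * (1 - q) ^ (\<xi> \<omega> - 1)) / q \<partial>M)"
        using integrable_deriv[of "1 - q"] integrable_offspring q by (simp add: pgf_deriv_def critical)
      also have "(\<lambda>\<omega>. (real (\<xi> \<omega>) - real (\<xi> \<omega>) * (1 - q) ^ (\<xi> \<omega> - 1)) / q)
          = (\<lambda>\<omega>. real (\<xi> \<omega>) * (\<Sum>j<\<xi> \<omega> - 1. (1 - q) ^ j))"
      proof
        fix \<omega>
        have "real (\<xi> \<omega>) - real (\<xi> \<omega>) * (1 - q) ^ (\<xi> \<omega> - 1) = real (\<xi> \<omega>) * (1 - (1 - q) ^ (\<xi> \<omega> - 1))"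
          by (simp add: algebra_simps)
        then show "(real (\<xi> \<omega>) - real (\<xi> \<omega>) * (1 - q) ^ (\<xi> \<omega> - 1)) / q
          = real (\<xi> \<omega>) * (\<Sum>j<\<xi> \<omega> - 1. (1 - q) ^ j)" using q by (simp add: one_minus_power_sum)
      qed
      finally show ?thesis by simp
    qed
    then show "\<forall>\<^sub>F q in at_right 0. (\<integral>\<omega>. real (\<xi> \<omega>) * (\<Sum>j<\<xi> \<omega> - 1. (1 - q) ^ j) \<partial>M) = (1 - pgf_deriv (1 - q)) / q"
      by (auto simp: eventually_at_right[of 0 1] intro!: exI[of _ 1])
  qed
qed

lemma prob_ge_2: "prob {\<omega> \<in> space M. \<xi> \<omega> \<ge> 2} > 0"
proof (rule ccontr)
  assume "\<not> ?thesis"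
  then have "prob {\<omega> \<in> space M. \<xi> \<omega> \<ge> 2} = 0" using measure_nonneg by (metis less_eq_real_def)
  then have "AE \<omega> in M. \<not> \<xi> \<omega> \<ge> 2"
    by (subst (asm) prob_eq_0) auto
  then have "(\<integral>\<omega>. real (\<xi> \<omega>) * (real (\<xi> \<omega>) - 1) \<partial>M) = (\<integral>\<omega>. 0 \<partial>M)"
    by (intro integral_cong_AE) (auto elim!: eventually_mono simp: not_le less_2_cases_iff)
  then show False using expectation_factorial half_var_pos by simp
qed

text \<open>
  For \<open>n \<ge> 2\<close> one has \<open>(1 - q) ^ n \<ge> 1 - n * q + q\<^sup>2\<close>, with equality at \<open>n = 2\<close>.  Unlike the expansion at
  \<open>q = 0\<close> this holds for all \<open>q\<close>, and it forces extinction.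
\<close>

lemma pgf_strictly_convex:
  assumes "q \<in> {0..1}"
  shows "1 - q + prob {\<omega> \<in> space M. \<xi> \<omega> \<ge> 2} * q\<^sup>2 \<le> pgf (1 - q)"
proof -
  have base: "1 - real n * q + of_bool (n \<ge> 2) * q\<^sup>2 \<le> (1 - q) ^ n" for n
  proof (cases "n \<ge> 2")
    case True
    then have "1 - real n * q + q\<^sup>2 \<le> (1 - q) ^ n"
    proof (induction n rule: dec_induct)
      case (step n)
      have "0 \<le> (real n - q) * q\<^sup>2" using step assms by (intro mult_nonneg_nonneg) auto
      then have "1 - real (Suc n) * q + q\<^sup>2 \<le> (1 - q) * (1 - real n * q + q\<^sup>2)"
        by (simp add: algebra_simps power2_eq_square)
      also have "\<dots> \<le> (1 - q) * (1 - q) ^ n" using step assms by (intro mult_left_mono) auto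
      finally show ?case by simp
    qed (simp add: power2_eq_square algebra_simps)
    then show ?thesis using True by simp
  next
    case False
    then have "n = 0 \<or> n = 1" by auto
    then show ?thesis by auto
  qed
  have i: "integrable M (\<lambda>\<omega>. indicator {\<omega> \<in> space M. \<xi> \<omega> \<ge> 2} \<omega> :: real)" by (rule integrable_real_indicator) (auto simp: emeasure_eq_measure)
  have "(\<integral>\<omega>. 1 - real (\<xi> \<omega>) * q + indicator {\<omega> \<in> space M. \<xi> \<omega> \<ge> 2} \<omega> * q\<^sup>2 \<partial>M) \<le> pgf (1 - q)"
    unfolding pgf_def
  proof (rule integral_mono)
    show "integrable M (\<lambda>\<omega>. 1 - real (\<xi> \<omega>) * q + indicator {\<omega> \<in> space M. \<xi> \<omega> \<ge> 2} \<omega> * q\<^sup>2)"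
      using integrable_offspring i by auto
    show "integrable M (\<lambda>\<omega>. (1 - q) ^ \<xi> \<omega>)" using assms by (intro integrable_power) auto
  qed (use base in \<open>auto simp: indicator_def\<close>)
  also have "(\<integral>\<omega>. 1 - real (\<xi> \<omega>) * q + indicator {\<omega> \<in> space M. \<xi> \<omega> \<ge> 2} \<omega> * q\<^sup>2 \<partial>M)
      = 1 - q + prob {\<omega> \<in> space M. \<xi> \<omega> \<ge> 2} * q\<^sup>2"
    using integrable_offspring i by (simp add: critical prob_space)
  finally show ?thesis .
qed

lemma pgf_le_one_minus:
  assumes "q \<in> {0..1}"
  shows "pgf (1 - q) \<le> 1 - q * prob {\<omega> \<in> space M. \<xi> \<omega> \<ge> 2}"
proof -
  have i: "integrable M (\<lambda>\<omega>. indicator {\<omega> \<in> space M. \<xi> \<omega> \<ge> 2} \<omega> :: real)" by (rule integrable_real_indicator) (auto simp: emeasure_eq_measure)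
  have "pgf (1 - q) \<le> (\<integral>\<omega>. 1 - q * indicator {\<omega> \<in> space M. \<xi> \<omega> \<ge> 2} \<omega> \<partial>M)"
    unfolding pgf_def
  proof (rule integral_mono)
    fix \<omega> assume "\<omega> \<in> space M"
    have "(1 - q) ^ \<xi> \<omega> \<le> (1 - q) ^ 1" if "\<xi> \<omega> \<ge> 2" using that assms by (intro power_decreasing) auto
    then show "(1 - q) ^ \<xi> \<omega> \<le> 1 - q * indicator {\<omega> \<in> space M. \<xi> \<omega> \<ge> 2} \<omega>"
      using assms by (auto simp: indicator_def power_le_one)
  qed (use assms integrable_power[of "1 - q"] i in auto)
  also have "\<dots> = 1 - q * prob {\<omega> \<in> space M. \<xi> \<omega> \<ge> 2}" using i by (simp add: prob_space)
  finally show ?thesis .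
qed

lemma pgf_mono: "0 \<le> x \<Longrightarrow> x \<le> y \<Longrightarrow> y \<le> 1 \<Longrightarrow> pgf x \<le> pgf y"
  unfolding pgf_def by (intro integral_mono integrable_power power_mono) auto

lemma pgf_range: "x \<in> {0..1} \<Longrightarrow> pgf x \<in> {0..1}"
  using pgf_mono[of x 1] by (auto simp: pgf_def prob_space intro!: integral_nonneg_AE)

text \<open>
  Convexity in the form needed for iteration: a chord to the left is not steeper than one to the right.
\<close>

lemma pgf_convex:
  assumes "0 \<le> x" "x \<le> y" "y \<le> v" "v \<le> z" "z \<le> 1"
  shows "(pgf y - pgf x) * (z - v) \<le> (pgf z - pgf v) * (y - x)"
proof -
  have "(y ^ n - x ^ n) * (z - v) \<le> (z ^ n - v ^ n) * (y - x)" for n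
  proof -
    have "y ^ n - x ^ n \<le> real n * y ^ (n - 1) * (y - x)" using assms by (intro power_difference_le) auto
    also have "\<dots> \<le> real n * v ^ (n - 1) * (y - x)"
      using assms by (intro mult_right_mono mult_left_mono power_mono) auto
    finally have "(y ^ n - x ^ n) * (z - v) \<le> real n * v ^ (n - 1) * (y - x) * (z - v)" using assms by (intro mult_right_mono) auto
    also have "\<dots> = real n * v ^ (n - 1) * (z - v) * (y - x)" by simp
    also have "\<dots> \<le> (z ^ n - v ^ n) * (y - x)"
      using assms by (intro mult_right_mono power_difference_le) auto
    finally show ?thesis .
  qed
  then have "(\<integral>\<omega>. (y ^ \<xi> \<omega> - x ^ \<xi> \<omega>) * (z - v) \<partial>M) \<le> (\<integral>\<omega>. (z ^ \<xi> \<omega> - v ^ \<xi> \<omega>) * (y - x) \<partial>M)"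
    using assms by (intro integral_mono integrable_mult_left Bochner_Integration.integrable_diff integrable_power) auto
  then show ?thesis using assms by (simp add: pgf_def integrable_power)
qed

end

section \<open>The branching property\<close>

lemma expectation_given_eq:
  assumes "prob_space M" "A \<in> sets M" "measure M A > 0" "X \<in> borel_measurable M"
  shows "expectation_given M X A = (\<integral>\<omega>. X \<omega> * indicator A \<omega> \<partial>M) / measure M A"
proof -
  interpret prob_space M by fact
  have "uniform_measure M A = density M (\<lambda>\<omega>. ennreal (indicator A \<omega> / measure M A))"
    unfolding uniform_measure_def using assms(3)
    by (simp add: emeasure_eq_measure divide_ennreal flip: ennreal_indicator)
  then have "expectation_given M X A = (\<integral>\<omega>. (indicator A \<omega> / measure M A) * X \<omega> \<partial>M)"
    unfolding expectation_given_def using assms by (simp add: integral_density)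
  also have "\<dots> = (\<integral>\<omega>. X \<omega> * indicator A \<omega> / measure M A \<partial>M)"
    by (intro Bochner_Integration.integral_cong) auto
  finally show ?thesis by simp
qed

lemma measurable_sum_nat:
  fixes f :: "'i \<Rightarrow> 'a \<Rightarrow> nat"
  assumes "\<And>i. i \<in> I \<Longrightarrow> f i \<in> M \<rightarrow>\<^sub>M count_space UNIV"
  shows "(\<lambda>x. \<Sum>i\<in>I. f i x) \<in> M \<rightarrow>\<^sub>M count_space UNIV"
proof -
  have eq: "M \<rightarrow>\<^sub>M (borel :: nat measure) = M \<rightarrow>\<^sub>M count_space UNIV"
    by (rule measurable_cong_sets) (simp_all add: sets_borel_eq_count_space)
  show ?thesis by (rule borel_measurable_sum[of I f M, unfolded eq]) (rule assms)
qed

text \<open>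
  The population up to time \<open>t\<close> is a function of the offspring vectors of the generations before \<open>t\<close>,
  which are independent of those of generation \<open>t\<close>.
\<close>

context galton_watson
begin

abbreviation pop :: "(nat \<Rightarrow> nat) \<Rightarrow> nat \<Rightarrow> nat \<Rightarrow> 'w \<Rightarrow> nat" where "pop \<equiv> population N \<eta>"

abbreviation offspring :: "nat \<times> nat \<times> nat \<Rightarrow> 'w \<Rightarrow> (nat \<Rightarrow> nat)" where
  "offspring \<equiv> offspring_vector N \<eta>"

definition past :: "nat \<Rightarrow> (nat \<times> nat \<times> nat) set" where "past t = {..<t} \<times> {1..N} \<times> UNIV"
definition generation :: "nat \<Rightarrow> (nat \<times> nat \<times> nat) set" where "generation t = {t} \<times> {1..N} \<times> UNIV"

text \<open>
  The same population recursion, run on a table of offspring vectors in place of a sample point: this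
  exhibits the population as a measurable function of the history.
\<close>

definition path_pop :: "(nat \<Rightarrow> nat) \<Rightarrow> nat \<Rightarrow> nat \<Rightarrow> (nat \<times> nat \<times> nat \<Rightarrow> nat \<Rightarrow> nat) \<Rightarrow> nat" where
  "path_pop = population N (\<lambda>t i r j p. p (t, i, r) j)"

definition history :: "nat \<Rightarrow> 'w \<Rightarrow> (nat \<times> nat \<times> nat \<Rightarrow> nat \<Rightarrow> nat)" where
  "history t \<omega> = (\<lambda>x\<in>past t. offspring x \<omega>)"

abbreviation paths :: "(nat \<times> nat \<times> nat) set \<Rightarrow> (nat \<times> nat \<times> nat \<Rightarrow> nat \<Rightarrow> nat) measure" where
  "paths A \<equiv> \<Pi>\<^sub>M x\<in>A. offspring_space N"

lemma path_pop_history: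
  "s \<le> t \<Longrightarrow> j \<in> {1..N} \<Longrightarrow> path_pop z s j (history t \<omega>) = pop z s j \<omega>"
proof (induction s arbitrary: j)
  case (Suc s)
  have "path_pop z s i (history t \<omega>) = pop z s i \<omega>" if "i \<in> {1..N}" for i
    using Suc that by simp
  moreover have "history t \<omega> (s, i, r) j = \<eta> s i r j \<omega>" if "i \<in> {1..N}" for i r
    using Suc.prems that by (simp add: history_def past_def offspring_vector_def)
  ultimately show ?case by (simp add: path_pop_def)
qed (simp add: path_pop_def)

lemma coordinate_measurable:
  assumes "x \<in> A" "j \<in> {1..N}"
  shows "(\<lambda>p. p x j) \<in> paths A \<rightarrow>\<^sub>M count_space UNIV"
proof -
  have "(\<lambda>p. p x) \<in> paths A \<rightarrow>\<^sub>M offspring_space N" using assms by (rule_tac measurable_component_singleton)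
  from measurable_compose[OF this[unfolded offspring_space_def] measurable_component_singleton[OF assms(2)]]
  show ?thesis by (simp add: offspring_space_def)
qed

lemma path_pop_measurable:
  "s \<le> t \<Longrightarrow> j \<in> {1..N} \<Longrightarrow> path_pop z s j \<in> paths (past t) \<rightarrow>\<^sub>M count_space UNIV"
proof (induction s arbitrary: j)
  case (Suc s)
  have "(\<lambda>p. \<Sum>i\<in>{1..N}. \<Sum>r<path_pop z s i p. p (s, i, r) j) \<in> paths (past t) \<rightarrow>\<^sub>M count_space UNIV"
  proof (rule measurable_sum_nat)
    fix i assume i: "i \<in> {1..N}"
    show "(\<lambda>p. \<Sum>r<path_pop z s i p. p (s, i, r) j) \<in> paths (past t) \<rightarrow>\<^sub>M count_space UNIV"
    proof (rule measurable_compose_countable[where f = "\<lambda>n p. \<Sum>r<n. p (s, i, r) j"])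
      show "(\<lambda>p. \<Sum>r<n. p (s, i, r) j) \<in> paths (past t) \<rightarrow>\<^sub>M count_space UNIV" for n
        using i Suc.prems by (intro measurable_sum_nat coordinate_measurable) (auto simp: past_def)
      show "path_pop z s i \<in> paths (past t) \<rightarrow>\<^sub>M count_space UNIV" using Suc i by simp
    qed
  qed
  then show ?case by (simp add: path_pop_def)
qed (simp add: path_pop_def)

lemma offspring_vector_measurable:
  "x \<in> UNIV \<times> {1..N} \<times> UNIV \<Longrightarrow> offspring x \<in> M \<rightarrow>\<^sub>M offspring_space N"
  using indep_offspring unfolding indep_vars_def by auto

lemma population_measurable:
  assumes "j \<in> {1..N}"
  shows "pop z t j \<in> M \<rightarrow>\<^sub>M count_space UNIV"
proof -
  have "history t \<in> M \<rightarrow>\<^sub>M paths (past t)" unfolding history_def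
    by (intro measurable_restrict offspring_vector_measurable) (auto simp: past_def)
  from measurable_compose[OF this path_pop_measurable[OF order_refl assms, of z]]
  show ?thesis using assms by (simp add: path_pop_history)
qed

definition weight :: "(nat \<Rightarrow> real) \<Rightarrow> (nat \<Rightarrow> nat) \<Rightarrow> real" where
  "weight w v = (\<Prod>j\<in>{1..N}. w j ^ v j)"

lemma weight_measurable: "weight w \<in> borel_measurable (offspring_space N)"
  unfolding weight_def offspring_space_def
  by (intro borel_measurable_prod measurable_compose[OF measurable_component_singleton]) auto

lemma weight_range: "\<forall>j\<in>{1..N}. w j \<in> {0..1} \<Longrightarrow> weight w v \<in> {0..1}"
  unfolding weight_def by (auto intro!: prod_nonneg prod_le_1 power_le_one)

lemma weight_offspring_vector:
  "weight w (offspring (t, i, r) \<omega>) = (\<Prod>j\<in>{1..N}. w j ^ \<eta> t i r j \<omega>)"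
  by (simp add: weight_def offspring_vector_def)

lemma expectation_weight:
  assumes "i \<in> {1..N}"
  shows "(\<integral>\<omega>. weight w (offspring (t, i, r) \<omega>) \<partial>M) = (\<integral>\<omega>. weight w (offspring (0, i, 0) \<omega>) \<partial>M)"
proof -
  have "(\<integral>\<omega>. weight w (offspring (t, i, r) \<omega>) \<partial>M)
      = (\<integral>v. weight w v \<partial>distr M (offspring_space N) (offspring (t, i, r)))" for t r
    using assms by (intro integral_distr[symmetric] offspring_vector_measurable weight_measurable) auto
  then show ?thesis using identical_offspring[OF assms, of t r] by simp
qed

definition generating_function :: "(nat \<Rightarrow> real) \<Rightarrow> nat \<Rightarrow> real" where
  "generating_function x i = (\<integral>\<omega>. (\<Prod>j\<in>{1..N}. x j ^ \<eta> 0 i 0 j \<omega>) \<partial>M)"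

text \<open>
  All particles of one generation are independent, so for a fixed population their generating functions
  multiply.
\<close>

lemma expectation_generation:
  assumes w: "\<forall>j\<in>{1..N}. w j \<in> {0..1}"
  shows "(\<integral>\<omega>. (\<Prod>i\<in>{1..N}. \<Prod>r<n i. weight w (offspring (t, i, r) \<omega>)) \<partial>M)
    = (\<Prod>i\<in>{1..N}. generating_function w i ^ n i)"
proof -
  define K where "K = Sigma {t} (\<lambda>_. Sigma {1..N} (\<lambda>i. {..<n i}))"
  have split: "(\<Prod>i\<in>{1..N}. \<Prod>r<n i. G (t, i, r)) = (\<Prod>x\<in>K. G x)" for G :: "nat \<times> nat \<times> nat \<Rightarrow> real"
  proof -
    have "(\<Prod>i\<in>{1..N}. \<Prod>r<n i. G (t, i, r)) = (\<Prod>y\<in>Sigma {1..N} (\<lambda>i. {..<n i}). G (t, y))"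
      by (subst prod.Sigma) (auto simp: case_prod_beta')
    also have "\<dots> = (\<Prod>t'\<in>{t}. \<Prod>y\<in>Sigma {1..N} (\<lambda>i. {..<n i}). G (t', y))" by simp
    also have "\<dots> = (\<Prod>x\<in>K. G x)" unfolding K_def
      by (subst prod.Sigma) (auto simp: case_prod_beta')
    finally show ?thesis .
  qed
  have Ksub: "K \<subseteq> UNIV \<times> {1..N} \<times> UNIV" by (auto simp: K_def)
  have "indep_vars (\<lambda>_. borel) (\<lambda>x \<omega>. weight w (offspring x \<omega>)) K"
    by (rule indep_vars_compose2[OF indep_vars_subset[OF indep_offspring Ksub]]) (rule weight_measurable)
  then have "(\<integral>\<omega>. (\<Prod>x\<in>K. weight w (offspring x \<omega>)) \<partial>M)
      = (\<Prod>x\<in>K. \<integral>\<omega>. weight w (offspring x \<omega>) \<partial>M)"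
  proof (rule indep_vars_lebesgue_integral[rotated 1])
    show "finite K" by (simp add: K_def)
    fix x assume "x \<in> K"
    then have "(\<lambda>\<omega>. weight w (offspring x \<omega>)) \<in> borel_measurable M"
      using Ksub by (intro measurable_compose[OF offspring_vector_measurable weight_measurable]) auto
    then show "integrable M (\<lambda>\<omega>. weight w (offspring x \<omega>))"
      using weight_range[OF w] by (intro integrable_const_bound[where B = 1]) auto
  qed
  then have "(\<integral>\<omega>. (\<Prod>i\<in>{1..N}. \<Prod>r<n i. weight w (offspring (t, i, r) \<omega>)) \<partial>M)
      = (\<Prod>i\<in>{1..N}. \<Prod>r<n i. \<integral>\<omega>. weight w (offspring (t, i, r) \<omega>) \<partial>M)"
    unfolding split[of "\<lambda>x. weight w (offspring x _)"]
      split[of "\<lambda>x. \<integral>\<omega>. weight w (offspring x \<omega>) \<partial>M"] .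
  also have "\<dots> = (\<Prod>i\<in>{1..N}. generating_function w i ^ n i)"
  proof (intro prod.cong refl)
    fix i assume "i \<in> {1..N}"
    then have "(\<integral>\<omega>. weight w (offspring (t, i, r) \<omega>) \<partial>M) = generating_function w i" for r
      using expectation_weight[of i w t r] by (simp only: generating_function_def weight_offspring_vector)
    then show "(\<Prod>r<n i. \<integral>\<omega>. weight w (offspring (t, i, r) \<omega>) \<partial>M) = generating_function w i ^ n i"
      by simp
  qed
  finally show ?thesis .
qed

lemma weight_population_Suc:
  "weight w (\<lambda>j. pop z (Suc t) j \<omega>)
    = (\<Prod>i\<in>{1..N}. \<Prod>r<pop z t i \<omega>. weight w (offspring (t, i, r) \<omega>))"
proof -
  have "weight w (\<lambda>j. pop z (Suc t) j \<omega>)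
      = (\<Prod>j\<in>{1..N}. \<Prod>i\<in>{1..N}. \<Prod>r<pop z t i \<omega>. w j ^ \<eta> t i r j \<omega>)"
    by (simp add: weight_def power_sum)
  also have "\<dots> = (\<Prod>i\<in>{1..N}. \<Prod>j\<in>{1..N}. \<Prod>r<pop z t i \<omega>. w j ^ \<eta> t i r j \<omega>)"
    by (rule prod.swap)
  also have "\<dots> = (\<Prod>i\<in>{1..N}. \<Prod>r<pop z t i \<omega>. \<Prod>j\<in>{1..N}. w j ^ \<eta> t i r j \<omega>)"
    by (intro prod.cong refl prod.swap)
  finally show ?thesis by (simp add: weight_offspring_vector)
qed

text \<open>
  By independence of the history and the current generation the expectation is an iterated integral;
  the inner one is over the current generation with the population held fixed.
\<close>

lemma branching_step:
  assumes w: "\<forall>j\<in>{1..N}. w j \<in> {0..1}"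
    and g: "g \<in> borel_measurable (paths (past t))" and g1: "\<And>p. \<bar>g p\<bar> \<le> (1::real)"
  shows "(\<integral>\<omega>. g (history t \<omega>) * weight w (\<lambda>j. pop z (Suc t) j \<omega>) \<partial>M)
    = (\<integral>\<omega>. g (history t \<omega>) * weight (generating_function w) (\<lambda>j. pop z t j \<omega>) \<partial>M)"
proof -
  define future where "future = (\<lambda>\<omega>. \<lambda>x\<in>generation t. offspring x \<omega>)"
  let ?A = "paths (past t)" and ?B = "paths (generation t)"
  define \<Phi> where "\<Phi> = (\<lambda>p q. g p * (\<Prod>i\<in>{1..N}. \<Prod>r<path_pop z t i p. weight w (q (t, i, r))))"
  have ind: "indep_var ?A (history t) ?B future"
    unfolding history_def future_def
    by (rule indep_var_restrict[OF indep_offspring]) (auto simp: past_def generation_def)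
  have mh: "history t \<in> M \<rightarrow>\<^sub>M ?A" using indep_var_rv1[OF ind] .
  have mf: "future \<in> M \<rightarrow>\<^sub>M ?B" using indep_var_rv2[OF ind] .
  interpret A: prob_space "distr M ?A (history t)" by (rule prob_space_distr[OF mh])
  interpret B: prob_space "distr M ?B future" by (rule prob_space_distr[OF mf])
  interpret AB: pair_prob_space "distr M ?A (history t)" "distr M ?B future" ..
  have joint: "distr M ?A (history t) \<Otimes>\<^sub>M distr M ?B future = distr M (?A \<Otimes>\<^sub>M ?B) (\<lambda>\<omega>. (history t \<omega>, future \<omega>))"
    using ind unfolding indep_var_distribution_eq by blast
  have m\<Phi>: "(\<lambda>(p, q). \<Phi> p q) \<in> borel_measurable (?A \<Otimes>\<^sub>M ?B)"
    unfolding \<Phi>_def case_prod_beta'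
  proof (intro borel_measurable_times borel_measurable_prod)
    show "(\<lambda>x. g (fst x)) \<in> borel_measurable (?A \<Otimes>\<^sub>M ?B)"
      by (rule measurable_compose[OF measurable_fst g])
    fix i assume i: "i \<in> {1..N}"
    show "(\<lambda>x. \<Prod>r<path_pop z t i (fst x). weight w (snd x (t, i, r))) \<in> borel_measurable (?A \<Otimes>\<^sub>M ?B)"
    proof (rule measurable_compose_countable[where f = "\<lambda>n x. \<Prod>r<n. weight w (snd x (t, i, r))"])
      show "(\<lambda>x. path_pop z t i (fst x)) \<in> ?A \<Otimes>\<^sub>M ?B \<rightarrow>\<^sub>M count_space UNIV"
        by (rule measurable_compose[OF measurable_fst path_pop_measurable[OF order_refl i]])
      show "(\<lambda>x. \<Prod>r<n. weight w (snd x (t, i, r))) \<in> borel_measurable (?A \<Otimes>\<^sub>M ?B)" for n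
      proof (intro borel_measurable_prod)
        fix r
        have "(\<lambda>q. q (t, i, r)) \<in> ?B \<rightarrow>\<^sub>M offspring_space N"
          using i by (intro measurable_component_singleton) (simp add: generation_def)
        from measurable_compose[OF measurable_snd measurable_compose[OF this weight_measurable[of w]]]
        show "(\<lambda>x. weight w (snd x (t, i, r))) \<in> borel_measurable (?A \<Otimes>\<^sub>M ?B)" .
      qed
    qed
  qed
  have bound: "\<bar>\<Phi> p q\<bar> \<le> 1" for p q
  proof -
    have "(\<Prod>i\<in>{1..N}. \<Prod>r<path_pop z t i p. weight w (q (t, i, r))) \<in> {0..1}"
      using weight_range[OF w] by (auto intro!: prod_nonneg prod_le_1)
    then show ?thesis unfolding \<Phi>_def abs_mult using g1[of p] by (auto intro!: mult_le_one)
  qed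
  have "g (history t \<omega>) * weight w (\<lambda>j. pop z (Suc t) j \<omega>) = \<Phi> (history t \<omega>) (future \<omega>)" for \<omega>
  proof -
    have "(\<Prod>i\<in>{1..N}. \<Prod>r<pop z t i \<omega>. weight w (offspring (t, i, r) \<omega>))
        = (\<Prod>i\<in>{1..N}. \<Prod>r<path_pop z t i (history t \<omega>). weight w (future \<omega> (t, i, r)))"
      by (intro prod.cong) (auto simp: path_pop_history future_def generation_def)
    then show ?thesis by (simp only: \<Phi>_def weight_population_Suc)
  qed
  then have "(\<integral>\<omega>. g (history t \<omega>) * weight w (\<lambda>j. pop z (Suc t) j \<omega>) \<partial>M)
      = (\<integral>\<omega>. (case (history t \<omega>, future \<omega>) of (p, q) \<Rightarrow> \<Phi> p q) \<partial>M)" by simp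
  also have "\<dots> = (\<integral>x. (case x of (p, q) \<Rightarrow> \<Phi> p q) \<partial>distr M (?A \<Otimes>\<^sub>M ?B) (\<lambda>\<omega>. (history t \<omega>, future \<omega>)))"
    using m\<Phi> mh mf by (intro integral_distr[symmetric]) auto
  also have "\<dots> = (\<integral>p. (\<integral>q. \<Phi> p q \<partial>distr M ?B future) \<partial>distr M ?A (history t))"
    unfolding joint[symmetric]
  proof (rule AB.integral_fst'[symmetric, of "\<lambda>(p, q). \<Phi> p q", simplified])
    show "integrable (distr M ?A (history t) \<Otimes>\<^sub>M distr M ?B future) (\<lambda>(p, q). \<Phi> p q)"
      using m\<Phi> bound by (intro AB.integrable_const_bound[where B = 1]) auto
  qed
  also have "\<dots> = (\<integral>p. g p * (\<Prod>i\<in>{1..N}. generating_function w i ^ path_pop z t i p) \<partial>distr M ?A (history t))"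
  proof (intro Bochner_Integration.integral_cong refl)
    fix p assume "p \<in> space (distr M ?A (history t))"
    then have p: "p \<in> space ?A" by simp
    have "(\<integral>q. \<Phi> p q \<partial>distr M ?B future) = (\<integral>\<omega>. \<Phi> p (future \<omega>) \<partial>M)"
      using measurable_Pair2[OF m\<Phi> p] by (intro integral_distr[OF mf]) simp
    also have "\<dots> = g p * (\<integral>\<omega>. (\<Prod>i\<in>{1..N}. \<Prod>r<path_pop z t i p. weight w (future \<omega> (t, i, r))) \<partial>M)"
      by (simp add: \<Phi>_def)
    also have "(\<integral>\<omega>. (\<Prod>i\<in>{1..N}. \<Prod>r<path_pop z t i p. weight w (future \<omega> (t, i, r))) \<partial>M)
        = (\<integral>\<omega>. (\<Prod>i\<in>{1..N}. \<Prod>r<path_pop z t i p. weight w (offspring (t, i, r) \<omega>)) \<partial>M)"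
      by (intro Bochner_Integration.integral_cong prod.cong refl) (auto simp: future_def generation_def)
    finally show "(\<integral>q. \<Phi> p q \<partial>distr M ?B future)
        = g p * (\<Prod>i\<in>{1..N}. generating_function w i ^ path_pop z t i p)"
      by (simp only: expectation_generation[OF w])
  qed
  also have "\<dots> = (\<integral>\<omega>. g (history t \<omega>) * (\<Prod>i\<in>{1..N}. generating_function w i ^ path_pop z t i (history t \<omega>)) \<partial>M)"
    by (intro integral_distr mh borel_measurable_times g borel_measurable_prod
        measurable_compose[OF path_pop_measurable[OF order_refl]]) auto
  also have "\<dots> = (\<integral>\<omega>. g (history t \<omega>) * weight (generating_function w) (\<lambda>j. pop z t j \<omega>) \<partial>M)"
    by (intro Bochner_Integration.integral_cong refl) (simp add: weight_def path_pop_history)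
  finally show ?thesis .
qed

lemma generating_function_range:
  assumes w: "\<forall>j\<in>{1..N}. w j \<in> {0..1}"
  shows "generating_function w i \<in> {0..1}"
proof -
  have "(\<Prod>j\<in>{1..N}. w j ^ \<eta> 0 i 0 j \<omega>) \<in> {0..1}" for \<omega>
    using weight_range[OF w, of "\<lambda>j. \<eta> 0 i 0 j \<omega>"] by (simp add: weight_def)
  moreover have "(\<integral>\<omega>. (\<Prod>j\<in>{1..N}. w j ^ \<eta> 0 i 0 j \<omega>) \<partial>M) \<le> (\<integral>\<omega>. 1 \<partial>M)"
    by (rule integral_mono') (use calculation in auto)
  ultimately show ?thesis unfolding generating_function_def by (auto simp: prob_space intro!: integral_nonneg_AE)
qed

text \<open>
  The factor at time \<open>m\<close> is part of the history of every later generation, so the generations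
  \<open>m + k - 1, \<dots>, m\<close> can be integrated out one after the other.
\<close>

lemma branching_property:
  assumes s: "\<forall>j\<in>{1..N}. s j \<in> {0..1}" and w: "\<forall>j\<in>{1..N}. w j \<in> {0..1}"
  shows "(\<integral>\<omega>. weight s (\<lambda>j. pop z m j \<omega>) * weight w (\<lambda>j. pop z (m + k) j \<omega>) \<partial>M)
    = (\<integral>\<omega>. weight (\<lambda>j. s j * (generating_function ^^ k) w j) (\<lambda>j. pop z m j \<omega>) \<partial>M)"
  using w
proof (induction k arbitrary: w)
  case 0
  show ?case by (simp add: weight_def power_mult_distrib prod.distrib)
next
  case (Suc k)
  let ?g = "\<lambda>p. weight s (\<lambda>j. path_pop z m j p)"
  have "(\<integral>\<omega>. ?g (history (m + k) \<omega>) * weight w (\<lambda>j. pop z (Suc (m + k)) j \<omega>) \<partial>M)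
      = (\<integral>\<omega>. ?g (history (m + k) \<omega>) * weight (generating_function w) (\<lambda>j. pop z (m + k) j \<omega>) \<partial>M)"
  proof (rule branching_step[OF Suc.prems])
    show "?g \<in> borel_measurable (paths (past (m + k)))" unfolding weight_def
      by (intro borel_measurable_prod measurable_compose[OF path_pop_measurable]) auto
    show "\<bar>?g p\<bar> \<le> 1" for p using weight_range[OF s, of "\<lambda>j. path_pop z m j p"] by auto
  qed
  moreover have "?g (history (m + k) \<omega>) = weight s (\<lambda>j. pop z m j \<omega>)" for \<omega>
    by (simp add: weight_def path_pop_history)
  moreover have "(generating_function ^^ k) (generating_function w) = (generating_function ^^ Suc k) w"
    by (simp only: funpow_Suc_right comp_apply)
  moreover have "\<forall>j\<in>{1..N}. generating_function w j \<in> {0..1}"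
    using generating_function_range[OF Suc.prems] by blast
  note Suc.IH[OF this]
  ultimately show ?case by (simp only: add_Suc_right)
qed

lemma expectation_weight_population:
  assumes w: "\<forall>j\<in>{1..N}. w j \<in> {0..1}" and N: "N \<ge> 1"
  shows "(\<integral>\<omega>. weight w (\<lambda>j. pop (unit_population 1) m j \<omega>) \<partial>M) = (generating_function ^^ m) w 1"
proof -
  have "(\<integral>\<omega>. weight w (\<lambda>j. pop (unit_population 1) m j \<omega>) \<partial>M)
      = (\<integral>\<omega>. weight (\<lambda>_. 1) (\<lambda>j. pop (unit_population 1) 0 j \<omega>)
          * weight w (\<lambda>j. pop (unit_population 1) (0 + m) j \<omega>) \<partial>M)"
    by (simp add: weight_def)
  also have "\<dots> = (\<integral>\<omega>. weight (\<lambda>j. 1 * (generating_function ^^ m) w j) (\<lambda>j. pop (unit_population 1) 0 j \<omega>) \<partial>M)"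
    by (rule branching_property[OF _ w]) auto
  also have "\<dots> = (\<integral>\<omega>. (generating_function ^^ m) w 1 \<partial>M)"
  proof (intro Bochner_Integration.integral_cong refl)
    fix \<omega>
    have "weight (\<lambda>j. 1 * (generating_function ^^ m) w j) (\<lambda>j. pop (unit_population 1) 0 j \<omega>)
       = (\<Prod>j\<in>{1..N}. if j = 1 then (generating_function ^^ m) w 1 else 1)"
      unfolding weight_def by (intro prod.cong) (auto simp: unit_population_def)
    also have "\<dots> = (generating_function ^^ m) w 1" using N by (subst prod.delta) auto
    finally show "weight (\<lambda>j. 1 * (generating_function ^^ m) w j) (\<lambda>j. pop (unit_population 1) 0 j \<omega>)
      = (generating_function ^^ m) w 1" .
  qed
  finally show ?thesis by (simp add: prob_space)
qed

definition extinct :: "(nat \<Rightarrow> nat) \<Rightarrow> nat \<Rightarrow> 'w \<Rightarrow> bool" where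
  "extinct z t \<omega> \<longleftrightarrow> (\<forall>j\<in>{1..N}. pop z t j \<omega> = 0)"

lemma extinct_Suc: "extinct z t \<omega> \<Longrightarrow> extinct z (Suc t) \<omega>"
  by (simp add: extinct_def)

lemma extinct_mono: "extinct z s \<omega> \<Longrightarrow> s \<le> t \<Longrightarrow> extinct z t \<omega>"
  by (induction t) (auto simp: le_Suc_eq intro: extinct_Suc)

text \<open>
  Since \<open>0 ^ 0 = 1\<close>, the zero weight is the indicator of extinction.
\<close>

lemma weight_zero_population: "weight (\<lambda>_. 0) (\<lambda>j. pop z t j \<omega>) = of_bool (extinct z t \<omega>)"
  by (auto simp: weight_def extinct_def power_0_left)

lemma extinction_time_iff:
  assumes n: "n \<ge> 1" and N: "N \<ge> 1"
  shows "extinction_time N (pop (unit_population 1)) \<omega> = enat n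
    \<longleftrightarrow> extinct (unit_population 1) n \<omega> \<and> \<not> extinct (unit_population 1) (n - 1) \<omega>"
proof -
  let ?E = "extinct (unit_population 1)"
  let ?S = "{enat n | n. n \<ge> 1 \<and> ?E n \<omega>}"
  have T: "extinction_time N (pop (unit_population 1)) \<omega> = Inf ?S"
    by (simp add: extinction_time_def extinct_def)
  have alive: "\<not> ?E 0 \<omega>" using N by (auto simp: extinct_def unit_population_def)
  show ?thesis
  proof
    assume "extinction_time N (pop (unit_population 1)) \<omega> = enat n"
    then have Inf: "Inf ?S = enat n" using T by simp
    have ne: "?S \<noteq> {}"
    proof
      assume "?S = {}"
      then have "Inf ?S = \<infinity>" unfolding Inf_enat_def by (rule if_P)
      then show False using Inf by simp
    qed
    then obtain l where "l \<in> ?S" by blast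
    then have "(LEAST l. l \<in> ?S) \<in> ?S" by (rule LeastI)
    then have "enat n \<in> ?S" using Inf unfolding Inf_enat_def if_not_P[OF ne] by (simp only:)
    then have "?E n \<omega>" by auto
    moreover have "\<not> ?E (n - 1) \<omega>"
    proof
      assume e: "?E (n - 1) \<omega>"
      then have "n - 1 \<ge> 1" using alive by (cases "n - 1") auto
      then have "enat (n - 1) \<in> ?S" using e by blast
      then have "Inf ?S \<le> enat (n - 1)" by (rule Inf_lower)
      then show False using Inf n by simp
    qed
    ultimately show "?E n \<omega> \<and> \<not> ?E (n - 1) \<omega>" by simp
  next
    assume e: "?E n \<omega> \<and> \<not> ?E (n - 1) \<omega>"
    have "Inf ?S = enat n"
    proof (rule antisym)
      show "Inf ?S \<le> enat n" using e n by (intro Inf_lower) blast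
      show "enat n \<le> Inf ?S"
      proof (rule Inf_greatest)
        fix l assume "l \<in> ?S"
        then obtain l' where "l = enat l'" "?E l' \<omega>" by blast
        then show "enat n \<le> l" using e extinct_mono[of _ l' \<omega> "n - 1"] by (cases "l' \<le> n - 1") auto
      qed
    qed
    then show "extinction_time N (pop (unit_population 1)) \<omega> = enat n" using T by simp
  qed
qed

text \<open>
  The event \<open>T = m + k\<close> is the difference of the events of extinction by time \<open>m + k\<close> and by time
  \<open>m + k - 1\<close>.  This writes the quantity of interest as a difference of two orbits of the generating
  functions, of length \<open>m\<close> and with nearby starting points.
\<close>

lemma expectation_at_extinction:
  assumes s: "\<forall>j\<in>{1..N}. s j \<in> {0..1}" and N: "N \<ge> 1" and k: "k \<ge> 1"
    and Z: "Z = pop (unit_population 1)"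
  shows "(\<integral>\<omega>. weight s (\<lambda>j. Z m j \<omega>) * indicator {\<omega> \<in> space M. extinction_time N Z \<omega> = enat (m + k)} \<omega> \<partial>M)
    = (generating_function ^^ m) (\<lambda>j. s j * (generating_function ^^ k) (\<lambda>_. 0) j) 1
      - (generating_function ^^ m) (\<lambda>j. s j * (generating_function ^^ (k - 1)) (\<lambda>_. 0) j) 1"
proof -
  let ?E = "extinct (unit_population 1)"
  have range: "\<forall>j\<in>{1..N}. (generating_function ^^ l) (\<lambda>_. 0) j \<in> {0..1}" for l
  proof (induction l)
    case (Suc l)
    then show ?case using generating_function_range[OF Suc] by simp
  qed simp
  have prod: "\<forall>j\<in>{1..N}. s j * (generating_function ^^ l) (\<lambda>_. 0) j \<in> {0..1}" for l
  proof
    fix j assume "j \<in> {1..N}"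
    then have "s j \<in> {0..1}" "(generating_function ^^ l) (\<lambda>_. 0) j \<in> {0..1}" using s range[of l] by blast+
    then show "s j * (generating_function ^^ l) (\<lambda>_. 0) j \<in> {0..1}" by (simp add: mult_le_one)
  qed
  have zero: "\<forall>j\<in>{1..N}. (0::real) \<in> {0..1}" by simp
  have dead: "(\<integral>\<omega>. weight s (\<lambda>j. Z m j \<omega>) * of_bool (?E (m + l) \<omega>) \<partial>M)
      = (generating_function ^^ m) (\<lambda>j. s j * (generating_function ^^ l) (\<lambda>_. 0) j) 1" for l
    using branching_property[OF s zero, of "unit_population 1" m l]
      expectation_weight_population[OF prod N, of l m] by (simp only: Z weight_zero_population)
  have meas: "(\<lambda>\<omega>. weight v (\<lambda>j. Z t j \<omega>)) \<in> borel_measurable M" for v t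
    unfolding weight_def Z
    by (intro borel_measurable_prod measurable_compose[OF population_measurable]) auto
  have int: "integrable M (\<lambda>\<omega>. weight s (\<lambda>j. Z m j \<omega>) * of_bool (?E t \<omega>))" for t
  proof (rule integrable_const_bound[where B = 1])
    show "(\<lambda>\<omega>. weight s (\<lambda>j. Z m j \<omega>) * of_bool (?E t \<omega>)) \<in> borel_measurable M"
      using borel_measurable_times[OF meas[of s m] meas[of "\<lambda>_. 0" t]] by (simp only: Z weight_zero_population)
    show "AE \<omega> in M. norm (weight s (\<lambda>j. Z m j \<omega>) * of_bool (?E t \<omega>)) \<le> 1"
    proof (rule AE_I2)
      fix \<omega>
      show "norm (weight s (\<lambda>j. Z m j \<omega>) * of_bool (?E t \<omega>)) \<le> 1"
        using weight_range[OF s, of "\<lambda>j. Z m j \<omega>"] by (simp add: of_bool_def)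
    qed
  qed
  have "(\<integral>\<omega>. weight s (\<lambda>j. Z m j \<omega>) * indicator {\<omega> \<in> space M. extinction_time N Z \<omega> = enat (m + k)} \<omega> \<partial>M)
      = (\<integral>\<omega>. weight s (\<lambda>j. Z m j \<omega>) * of_bool (?E (m + k) \<omega>) - weight s (\<lambda>j. Z m j \<omega>) * of_bool (?E (m + (k - 1)) \<omega>) \<partial>M)"
  proof (intro Bochner_Integration.integral_cong refl)
    fix \<omega> assume \<omega>: "\<omega> \<in> space M"
    have iff: "extinction_time N Z \<omega> = enat (m + k) \<longleftrightarrow> ?E (m + k) \<omega> \<and> \<not> ?E (m + (k - 1)) \<omega>"
      using extinction_time_iff[of "m + k" \<omega>] k N by (simp add: Z)
    have "?E (m + (k - 1)) \<omega> \<Longrightarrow> ?E (m + k) \<omega>" by (rule extinct_mono) auto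
    then show "weight s (\<lambda>j. Z m j \<omega>) * indicator {\<omega> \<in> space M. extinction_time N Z \<omega> = enat (m + k)} \<omega>
      = weight s (\<lambda>j. Z m j \<omega>) * of_bool (?E (m + k) \<omega>) - weight s (\<lambda>j. Z m j \<omega>) * of_bool (?E (m + (k - 1)) \<omega>)"
      using \<omega> by (simp add: indicator_def iff of_bool_def)
  qed
  also have "\<dots> = (\<integral>\<omega>. weight s (\<lambda>j. Z m j \<omega>) * of_bool (?E (m + k) \<omega>) \<partial>M)
      - (\<integral>\<omega>. weight s (\<lambda>j. Z m j \<omega>) * of_bool (?E (m + (k - 1)) \<omega>) \<partial>M)"
    by (rule Bochner_Integration.integral_diff[OF int int])
  finally show ?thesis unfolding dead .
qed

end

section \<open>Second order estimates of the offspring generating functions\<close>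

locale critical_decomposable_gw = decomposable_galton_watson +
  assumes hypothesis_A: "hypothesis_A M N \<eta>"
begin

abbreviation \<mu> :: "nat \<Rightarrow> nat \<Rightarrow> real" where "\<mu> \<equiv> mean_offspring M \<eta>"

abbreviation child :: "nat \<Rightarrow> nat \<Rightarrow> 'a \<Rightarrow> nat" where "child i j \<equiv> \<eta> 0 i 0 j"

lemma offspring_measurable:
  assumes "i \<in> {1..N}" "j \<in> {1..N}"
  shows "\<eta> t i r j \<in> M \<rightarrow>\<^sub>M count_space UNIV"
proof -
  have "offspring (t, i, r) \<in> M \<rightarrow>\<^sub>M offspring_space N"
    using indep_offspring assms unfolding indep_vars_def by auto
  from measurable_compose[OF this[unfolded offspring_space_def] measurable_component_singleton[OF assms(2)]]
  show ?thesis using assms by (simp add: offspring_vector_def)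
qed

lemma child_borel [measurable]:
  assumes "i \<in> {1..N}" "j \<in> {1..N}"
  shows "(\<lambda>\<omega>. real (child i j \<omega>)) \<in> borel_measurable M" "(\<lambda>\<omega>. (c::real) ^ child i j \<omega>) \<in> borel_measurable M"
    "(\<lambda>\<omega>. (c::real) ^ (child i j \<omega> - 1)) \<in> borel_measurable M"
  using measurable_compose[OF offspring_measurable[OF assms], of _ borel] by auto

lemma mean_one: "i \<in> {1..N} \<Longrightarrow> (\<integral>\<omega>. real (child i i \<omega>) \<partial>M) = 1"
  using hypothesis_A unfolding hypothesis_A_def mean_offspring_def by auto

lemma integrable_child_product:
  "i \<in> {1..N} \<Longrightarrow> j \<in> {i..N} \<Longrightarrow> k \<in> {i..N} \<Longrightarrow> integrable M (\<lambda>\<omega>. real (child i j \<omega>) * real (child i k \<omega>))"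
  using hypothesis_A unfolding hypothesis_A_def by auto

lemma integrable_child:
  assumes "i \<in> {1..N}" "j \<in> {i..N}"
  shows "integrable M (\<lambda>\<omega>. real (child i j \<omega>))"
proof (rule Bochner_Integration.integrable_bound[OF integrable_child_product[OF assms(1,2,2)]])
  show "(\<lambda>\<omega>. real (child i j \<omega>)) \<in> borel_measurable M" using assms by (intro child_borel) auto
qed (auto intro!: AE_I2 simp: mult_le_cancel_left1)

lemma critical_offspring: "i \<in> {1..N} \<Longrightarrow> critical_offspring M (child i i) (half_variance M \<eta> i)"
proof
  assume i: "i \<in> {1..N}"
  show "child i i \<in> M \<rightarrow>\<^sub>M count_space UNIV" using i by (intro offspring_measurable)
  show "integrable M (\<lambda>\<omega>. (real (child i i \<omega>))\<^sup>2)"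
    using integrable_child_product[OF i, of i i] i by (simp add: power2_eq_square)
  show "(\<integral>\<omega>. real (child i i \<omega>) \<partial>M) = 1" using i by (rule mean_one)
  show "half_variance M \<eta> i = 1 / 2 * (\<integral>\<omega>. (real (child i i \<omega>) - 1)\<^sup>2 \<partial>M)"
    using mean_one[OF i] by (simp add: half_variance_def mean_offspring_def)
  show "half_variance M \<eta> i > 0" using hypothesis_A i unfolding hypothesis_A_def by auto
qed

definition box :: "(nat \<Rightarrow> real) set" where "box = {x. \<forall>j\<in>{1..N}. x j \<in> {0..1}}"

abbreviation h :: "(nat \<Rightarrow> real) \<Rightarrow> nat \<Rightarrow> real" where "h \<equiv> generating_function"

abbreviation f :: "nat \<Rightarrow> real \<Rightarrow> real" where "f i \<equiv> critical_offspring.pgf M (child i i)"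
abbreviation f' :: "nat \<Rightarrow> real \<Rightarrow> real" where "f' i \<equiv> critical_offspring.pgf_deriv M (child i i)"

definition later :: "nat \<Rightarrow> (nat \<Rightarrow> real) \<Rightarrow> 'a \<Rightarrow> real" where
  "later i x \<omega> = (\<Prod>j\<in>{i<..N}. x j ^ child i j \<omega>)"

text \<open>
  A difference \<open>h y i - h x i\<close> is split into the part due to the change in coordinate \<open>i\<close> and the part
  due to the change in the later coordinates.
\<close>

definition inflow :: "nat \<Rightarrow> (nat \<Rightarrow> real) \<Rightarrow> (nat \<Rightarrow> real) \<Rightarrow> real" where
  "inflow i y x = (\<integral>\<omega>. x i ^ child i i \<omega> * (later i y \<omega> - later i x \<omega>) \<partial>M)"

text \<open>
  A common bound for all mixed second moments of a type \<open>i\<close> offspring vector.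
\<close>

definition moments :: "nat \<Rightarrow> real" where
  "moments i = (\<Sum>j\<in>{i..N}. \<Sum>k\<in>{i..N}. \<integral>\<omega>. real (child i j \<omega>) * real (child i k \<omega>) \<partial>M)"

lemma moments_nonneg: "moments i \<ge> 0"
  unfolding moments_def by (intro sum_nonneg integral_nonneg_AE) auto

lemma expectation_product_le_moments:
  assumes "j \<in> {i..N}" "k \<in> {i..N}"
  shows "(\<integral>\<omega>. real (child i j \<omega>) * real (child i k \<omega>) \<partial>M) \<le> moments i"
proof -
  have "(\<integral>\<omega>. real (child i j \<omega>) * real (child i k \<omega>) \<partial>M)
      \<le> (\<Sum>k\<in>{i..N}. \<integral>\<omega>. real (child i j \<omega>) * real (child i k \<omega>) \<partial>M)"
    using assms by (intro member_le_sum[where i = k]) (auto intro!: integral_nonneg_AE)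
  also have "\<dots> \<le> moments i" unfolding moments_def
    using assms by (intro member_le_sum[where i = j]) (auto intro!: integral_nonneg_AE sum_nonneg)
  finally show ?thesis .
qed

lemma later_measurable: "i \<in> {1..N} \<Longrightarrow> later i x \<in> borel_measurable M"
  unfolding later_def by (intro borel_measurable_prod child_borel) auto

lemma later_range: "x \<in> box \<Longrightarrow> i \<in> {1..N} \<Longrightarrow> later i x \<omega> \<in> {0..1}"
  unfolding later_def box_def by (auto intro!: prod_nonneg prod_le_1 power_le_one)

lemma integrable_power_later:
  assumes "i \<in> {1..N}" "x \<in> box" "y \<in> box"
  shows "integrable M (\<lambda>\<omega>. x i ^ child i i \<omega> * later i y \<omega>)"
proof (rule integrable_const_bound[where B = 1])
  show "(\<lambda>\<omega>. x i ^ child i i \<omega> * later i y \<omega>) \<in> borel_measurable M"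
    using assms by (intro borel_measurable_times child_borel later_measurable) auto
  show "AE \<omega> in M. norm (x i ^ child i i \<omega> * later i y \<omega>) \<le> 1"
    using assms later_range[OF assms(3,1)] by (auto intro!: AE_I2 mult_le_one power_le_one simp: abs_mult box_def)
qed

lemma h_eq:
  assumes "i \<in> {1..N}"
  shows "h x i = (\<integral>\<omega>. x i ^ child i i \<omega> * later i x \<omega> \<partial>M)"
  unfolding generating_function_def
proof (rule integral_cong_AE)
  have "AE \<omega> in M. \<forall>j\<in>{1..<i}. child i j \<omega> = 0"
    using assms by (intro AE_finite_allI decomposable) auto
  then show "AE \<omega> in M. (\<Prod>j\<in>{1..N}. x j ^ child i j \<omega>) = x i ^ child i i \<omega> * later i x \<omega>"
  proof eventually_elim
    case (elim \<omega>)
    have "{1..N} = {1..<i} \<union> insert i {i<..N}" using assms by auto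
    moreover have "(\<Prod>j\<in>{1..<i} \<union> insert i {i<..N}. x j ^ child i j \<omega>)
        = (\<Prod>j\<in>{1..<i}. x j ^ child i j \<omega>) * (\<Prod>j\<in>insert i {i<..N}. x j ^ child i j \<omega>)"
      by (rule prod.union_disjoint) auto
    ultimately show ?case using elim by (simp add: later_def)
  qed
qed (use assms in \<open>auto intro!: borel_measurable_prod borel_measurable_times child_borel later_measurable\<close>)

lemma h_last: "N \<ge> 1 \<Longrightarrow> h x N = f N (x N)"
  by (subst h_eq) (auto simp: later_def critical_offspring.pgf_def[OF critical_offspring])

lemma inflow_last: "inflow N y x = 0" by (simp add: inflow_def later_def)

context
  fixes i :: nat and x y :: "nat \<Rightarrow> real"
  assumes i: "i \<in> {1..N}" and x: "x \<in> box" and y: "y \<in> box" and le: "\<And>j. j \<in> {1..N} \<Longrightarrow> x j \<le> y j"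
begin

lemma range_i: "0 \<le> x i" "x i \<le> y i" "y i \<le> 1" "x i \<le> 1" "0 \<le> y i"
  using i x y le by (auto simp: box_def intro: order_trans)

lemma range_j: "j \<in> {i..N} \<Longrightarrow> 0 \<le> x j \<and> x j \<le> y j \<and> y j \<le> 1"
  using i x y le by (auto simp: box_def)

lemma later_mono: "later i x \<omega> \<le> later i y \<omega>"
  unfolding later_def by (intro prod_mono) (auto intro!: power_mono dest: range_j simp: range_j)

lemma h_diff:
  "h y i - h x i = (\<integral>\<omega>. (y i ^ child i i \<omega> - x i ^ child i i \<omega>) * later i y \<omega> \<partial>M) + inflow i y x"
  using integrable_power_later[OF i y y] integrable_power_later[OF i x y] integrable_power_later[OF i x x]
  by (simp add: h_eq[OF i] inflow_def left_diff_distrib right_diff_distrib)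

lemma inflow_nonneg: "0 \<le> inflow i y x"
  unfolding inflow_def using later_mono range_i by (intro integral_nonneg_AE) auto

lemma integrable_inflow: "integrable M (\<lambda>\<omega>. x i ^ child i i \<omega> * (later i y \<omega> - later i x \<omega>))"
  using integrable_power_later[OF i x y] integrable_power_later[OF i x x] by (simp add: right_diff_distrib)

lemma inflow_le: "inflow i y x \<le> (\<Sum>j\<in>{i<..N}. \<mu> i j * (y j - x j))"
proof -
  have "inflow i y x \<le> (\<integral>\<omega>. (\<Sum>j\<in>{i<..N}. real (child i j \<omega>) * (y j - x j)) \<partial>M)"
    unfolding inflow_def
  proof (rule integral_mono[OF integrable_inflow])
    show "integrable M (\<lambda>\<omega>. \<Sum>j\<in>{i<..N}. real (child i j \<omega>) * (y j - x j))"
      using i by (intro Bochner_Integration.integrable_sum integrable_mult_left integrable_child) auto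
    fix \<omega>
    have "later i y \<omega> - later i x \<omega> \<le> (\<Sum>j\<in>{i<..N}. \<bar>y j ^ child i j \<omega> - x j ^ child i j \<omega>\<bar>)"
    proof -
      have "norm ((\<Prod>j\<in>{i<..N}. y j ^ child i j \<omega>) - (\<Prod>j\<in>{i<..N}. x j ^ child i j \<omega>))
          \<le> (\<Sum>j\<in>{i<..N}. norm (y j ^ child i j \<omega> - x j ^ child i j \<omega>))"
      proof (rule norm_prod_diff)
        fix j assume "j \<in> {i<..N}"
        then have "0 \<le> x j" "x j \<le> 1" "0 \<le> y j" "y j \<le> 1" using range_j[of j] by auto
        then show "norm (y j ^ child i j \<omega>) \<le> 1" "norm (x j ^ child i j \<omega>) \<le> 1"
          by (simp_all add: power_le_one)
      qed
      then show ?thesis by (simp add: later_def)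
    qed
    also have "\<dots> \<le> (\<Sum>j\<in>{i<..N}. real (child i j \<omega>) * (y j - x j))"
    proof (rule sum_mono)
      fix j assume "j \<in> {i<..N}"
      then have r: "0 \<le> x j" "x j \<le> y j" "y j \<le> 1" using range_j[of j] by auto
      have "y j ^ child i j \<omega> - x j ^ child i j \<omega> \<le> real (child i j \<omega>) * y j ^ (child i j \<omega> - 1) * (y j - x j)"
        using r by (intro power_difference_le)
      also have "\<dots> \<le> real (child i j \<omega>) * 1 * (y j - x j)"
        using r by (intro mult_right_mono mult_left_mono power_le_one) auto
      finally show "\<bar>y j ^ child i j \<omega> - x j ^ child i j \<omega>\<bar> \<le> real (child i j \<omega>) * (y j - x j)"
        using r by (simp add: power_mono)
    qed
    finally have "later i y \<omega> - later i x \<omega> \<le> (\<Sum>j\<in>{i<..N}. real (child i j \<omega>) * (y j - x j))" .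
    moreover have "x i ^ child i i \<omega> * (later i y \<omega> - later i x \<omega>) \<le> 1 * (later i y \<omega> - later i x \<omega>)"
      using later_mono[of \<omega>] range_i by (intro mult_right_mono power_le_one) auto
    ultimately show "x i ^ child i i \<omega> * (later i y \<omega> - later i x \<omega>) \<le> (\<Sum>j\<in>{i<..N}. real (child i j \<omega>) * (y j - x j))"
      by simp
  qed
  also have "\<dots> = (\<Sum>j\<in>{i<..N}. \<mu> i j * (y j - x j))"
    using i by (subst Bochner_Integration.integral_sum)
      (auto simp: mean_offspring_def intro!: integrable_mult_left integrable_child)
  finally show ?thesis .
qed

text \<open>
  To first order only type \<open>i + 1\<close> matters, because later types change on smaller scales.  Its
  coefficient is at least \<open>E (\<xi>\<^sub>i\<^sub>+\<^sub>1 * \<Prod>\<^sub>j x\<^sub>j ^ \<xi>\<^sub>j)\<close>, where \<open>\<xi>\<close> is the offspring vector, and Bernoulli's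
  inequality bounds the loss against the mean by second moments.
\<close>

lemma inflow_ge:
  assumes "i < N"
  shows "(\<mu> i (Suc i) - moments i * (\<Sum>j\<in>{i..N}. 1 - x j)) * (y (Suc i) - x (Suc i)) \<le> inflow i y x"
proof -
  let ?c = "\<lambda>\<omega>. real (child i (Suc i) \<omega>)" and ?D = "y (Suc i) - x (Suc i)"
  let ?S = "\<lambda>\<omega>. \<Sum>j\<in>{i..N}. ?c \<omega> * real (child i j \<omega>) * (1 - x j)"
  let ?ES = "\<Sum>j\<in>{i..N}. (\<integral>\<omega>. ?c \<omega> * real (child i j \<omega>) \<partial>M) * (1 - x j)"
  have rs: "0 \<le> x (Suc i)" "x (Suc i) \<le> y (Suc i)" "y (Suc i) \<le> 1" using range_j[of "Suc i"] assms i by auto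
  have int: "integrable M (\<lambda>\<omega>. (?c \<omega> - ?S \<omega>) * ?D)"
    using i assms by (intro integrable_mult_left Bochner_Integration.integrable_diff
       Bochner_Integration.integrable_sum integrable_child integrable_child_product) auto
  have "?ES \<le> (\<Sum>j\<in>{i..N}. moments i * (1 - x j))"
    using i assms range_j by (intro sum_mono mult_right_mono expectation_product_le_moments) (auto intro: order_trans)
  then have "(\<mu> i (Suc i) - moments i * (\<Sum>j\<in>{i..N}. 1 - x j)) * ?D
      \<le> (\<mu> i (Suc i) - ?ES) * ?D"
    using rs by (intro mult_right_mono) (auto simp: sum_distrib_left)
  also have "\<dots> = (\<integral>\<omega>. (?c \<omega> - ?S \<omega>) * ?D \<partial>M)"
  proof -
    have "(\<integral>\<omega>. ?c \<omega> - ?S \<omega> \<partial>M)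
      = (\<integral>\<omega>. ?c \<omega> \<partial>M) - (\<integral>\<omega>. ?S \<omega> \<partial>M)"
      using i assms by (intro Bochner_Integration.integral_diff Bochner_Integration.integrable_sum
        integrable_mult_left integrable_child integrable_child_product) auto
    also have "(\<integral>\<omega>. ?S \<omega> \<partial>M)
      = ?ES"
      using i assms by (subst Bochner_Integration.integral_sum)
        (auto intro!: integrable_mult_left integrable_child_product)
    finally show ?thesis by (simp add: mean_offspring_def)
  qed
  also have "\<dots> \<le> inflow i y x" unfolding inflow_def
  proof (rule integral_mono[OF int integrable_inflow])
    fix \<omega>
    let ?n = "child i (Suc i) \<omega>"
    let ?P = "\<lambda>x. \<Prod>j\<in>{Suc i<..N}. x j ^ child i j \<omega>"
    have split: "later i z \<omega> = z (Suc i) ^ ?n * ?P z" for z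
    proof -
      have "{i<..N} = insert (Suc i) {Suc i<..N}" using assms by auto
      then show ?thesis by (simp add: later_def)
    qed
    have P: "0 \<le> ?P x" "?P x \<le> ?P y"
      using range_j by (auto intro!: prod_nonneg prod_mono power_mono)
    have all: "x i ^ child i i \<omega> * (x (Suc i) ^ ?n * ?P x) = (\<Prod>j\<in>{i..N}. x j ^ child i j \<omega>)"
    proof -
      have "{i..N} = insert i (insert (Suc i) {Suc i<..N})" using assms by auto
      then show ?thesis by simp
    qed
    have w: "1 - (\<Sum>j\<in>{i..N}. real (child i j \<omega>) * (1 - x j)) \<le> (\<Prod>j\<in>{i..N}. x j ^ child i j \<omega>)"
      using one_minus_prod_power_le[of "{i..N}" x "\<lambda>j. child i j \<omega>"] range_j by force
    have "?S \<omega>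
        = ?c \<omega> * (\<Sum>j\<in>{i..N}. real (child i j \<omega>) * (1 - x j))"
      by (simp add: sum_distrib_left mult.assoc)
    then have "(?c \<omega> - ?S \<omega>) * ?D
        = ?c \<omega> * ?D * (1 - (\<Sum>j\<in>{i..N}. real (child i j \<omega>) * (1 - x j)))"
      by (simp add: algebra_simps)
    also have "\<dots> \<le> ?c \<omega> * ?D * (x i ^ child i i \<omega> * (x (Suc i) ^ ?n * ?P x))"
      unfolding all using w rs by (intro mult_left_mono) auto
    also have "\<dots> = x i ^ child i i \<omega> * ((?c \<omega> * x (Suc i) ^ ?n * ?D) * ?P x)" by simp
    also have "\<dots> \<le> x i ^ child i i \<omega> * ((y (Suc i) ^ ?n - x (Suc i) ^ ?n) * ?P x)"
    proof (intro mult_left_mono mult_right_mono)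
      have "?c \<omega> * x (Suc i) ^ ?n * ?D \<le> ?c \<omega> * x (Suc i) ^ (?n - 1) * ?D"
        using rs by (intro mult_right_mono mult_left_mono power_decreasing) auto
      also have "\<dots> \<le> y (Suc i) ^ ?n - x (Suc i) ^ ?n" using rs by (intro power_difference_le)
      finally show "?c \<omega> * x (Suc i) ^ ?n * ?D \<le> y (Suc i) ^ ?n - x (Suc i) ^ ?n" .
    qed (use P range_i in auto)
    also have "\<dots> \<le> x i ^ child i i \<omega> * (later i y \<omega> - later i x \<omega>)"
      unfolding split using P rs range_i
      by (intro mult_left_mono) (auto simp: left_diff_distrib intro!: mult_left_mono)
    finally show "(?c \<omega> - ?S \<omega>) * ?D
      \<le> x i ^ child i i \<omega> * (later i y \<omega> - later i x \<omega>)" .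
  qed
  finally show ?thesis .
qed

text \<open>
  Coordinate \<open>i\<close> contracts with a factor \<open>1 - e\<close>, where \<open>e\<close> is nearly \<open>1 - f' i\<close>, hence nearly \<open>2 * b\<^sub>i\<close> times
  the distance from \<open>1\<close>.
\<close>

lemma self_slope:
  obtains e where "h y i - h x i = (1 - e) * (y i - x i) + inflow i y x"
    "1 - f' i (y i) \<le> e" "e \<le> 1 - f' i (x i) + moments i * (\<Sum>j\<in>{i<..N}. 1 - y j)"
proof -
  interpret co: critical_offspring M "child i i" "half_variance M \<eta> i" using i by (rule critical_offspring)
  let ?I = "\<integral>\<omega>. (y i ^ child i i \<omega> - x i ^ child i i \<omega>) * later i y \<omega> \<partial>M"
  let ?S = "\<lambda>\<omega>. \<Sum>j\<in>{i<..N}. real (child i i \<omega>) * real (child i j \<omega>) * (1 - y j)"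
  let ?q = "\<Sum>j\<in>{i<..N}. 1 - y j"
  have int: "integrable M (\<lambda>\<omega>. (y i ^ child i i \<omega> - x i ^ child i i \<omega>) * later i y \<omega>)"
    using integrable_power_later[OF i y y] integrable_power_later[OF i x y] by (simp add: left_diff_distrib)
  have upper: "?I \<le> f' i (y i) * (y i - x i)"
  proof -
    have "?I \<le> (\<integral>\<omega>. real (child i i \<omega>) * y i ^ (child i i \<omega> - 1) * (y i - x i) \<partial>M)"
    proof (rule integral_mono[OF int])
      show "integrable M (\<lambda>\<omega>. real (child i i \<omega>) * y i ^ (child i i \<omega> - 1) * (y i - x i))"
        using range_i by (intro integrable_mult_left co.integrable_deriv) auto
      fix \<omega>
      have "(y i ^ child i i \<omega> - x i ^ child i i \<omega>) * later i y \<omega> \<le> y i ^ child i i \<omega> - x i ^ child i i \<omega>"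
        using range_i later_range[OF y i, of \<omega>] by (intro mult_left_le) (auto simp: power_mono)
      also have "\<dots> \<le> real (child i i \<omega>) * y i ^ (child i i \<omega> - 1) * (y i - x i)"
        using range_i by (intro power_difference_le)
      finally show "(y i ^ child i i \<omega> - x i ^ child i i \<omega>) * later i y \<omega>
        \<le> real (child i i \<omega>) * y i ^ (child i i \<omega> - 1) * (y i - x i)" .
    qed
    then show ?thesis by (simp add: co.pgf_deriv_def)
  qed
  have lower: "(f' i (x i) - moments i * ?q) * (y i - x i) \<le> ?I"
  proof -
    have d: "integrable M (\<lambda>\<omega>. real (child i i \<omega>) * x i ^ (child i i \<omega> - 1))"
      using range_i by (intro co.integrable_deriv) auto
    have s: "integrable M (\<lambda>\<omega>. ?S \<omega>)"
      using i by (intro Bochner_Integration.integrable_sum integrable_mult_left integrable_child_product) auto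
    have "(\<Sum>j\<in>{i<..N}. (\<integral>\<omega>. real (child i i \<omega>) * real (child i j \<omega>) \<partial>M) * (1 - y j)) \<le> (\<Sum>j\<in>{i<..N}. moments i * (1 - y j))"
      using i range_j by (intro sum_mono mult_right_mono expectation_product_le_moments) auto
    then have "(f' i (x i) - moments i * ?q) * (y i - x i)
      \<le> (f' i (x i) - (\<Sum>j\<in>{i<..N}. (\<integral>\<omega>. real (child i i \<omega>) * real (child i j \<omega>) \<partial>M) * (1 - y j))) * (y i - x i)"
      using range_i by (intro mult_right_mono) (auto simp: sum_distrib_left)
    also have "(\<Sum>j\<in>{i<..N}. (\<integral>\<omega>. real (child i i \<omega>) * real (child i j \<omega>) \<partial>M) * (1 - y j))
      = (\<integral>\<omega>. ?S \<omega> \<partial>M)"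
      using i by (subst Bochner_Integration.integral_sum) (auto intro!: integrable_mult_left integrable_child_product)
    also have "(f' i (x i) - (\<integral>\<omega>. ?S \<omega> \<partial>M)) * (y i - x i)
      = (\<integral>\<omega>. (real (child i i \<omega>) * x i ^ (child i i \<omega> - 1)
          - ?S \<omega>) * (y i - x i) \<partial>M)"
      using d s by (simp add: co.pgf_deriv_def)
    also have "\<dots> \<le> ?I"
    proof (rule integral_mono[OF integrable_mult_left[OF Bochner_Integration.integrable_diff[OF d s]] int])
      fix \<omega>
      let ?c = "real (child i i \<omega>)"
      have L: "1 - later i y \<omega> \<le> (\<Sum>j\<in>{i<..N}. real (child i j \<omega>) * (1 - y j))"
        unfolding later_def
      proof (rule one_minus_prod_power_le)
        fix j assume "j \<in> {i<..N}"
        then show "y j \<in> {0..1}" using range_j[of j] by auto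
      qed simp
      have "?c * x i ^ (child i i \<omega> - 1) * (1 - later i y \<omega>) \<le> ?c * 1 * (1 - later i y \<omega>)"
        using range_i later_range[OF y i, of \<omega>] by (intro mult_right_mono mult_left_mono power_le_one) auto
      also have "\<dots> \<le> ?c * 1 * (\<Sum>j\<in>{i<..N}. real (child i j \<omega>) * (1 - y j))"
        using L by (intro mult_left_mono) auto
      also have "\<dots> = ?S \<omega>"
        by (simp add: sum_distrib_left mult.assoc)
      finally have "?c * x i ^ (child i i \<omega> - 1) - ?S \<omega>
        \<le> ?c * x i ^ (child i i \<omega> - 1) * later i y \<omega>" by (simp add: algebra_simps)
      then have "(?c * x i ^ (child i i \<omega> - 1) - ?S \<omega>) * (y i - x i)
        \<le> ?c * x i ^ (child i i \<omega> - 1) * later i y \<omega> * (y i - x i)" using range_i by (intro mult_right_mono) auto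
      also have "\<dots> = (?c * x i ^ (child i i \<omega> - 1) * (y i - x i)) * later i y \<omega>" by simp
      also have "\<dots> \<le> (y i ^ child i i \<omega> - x i ^ child i i \<omega>) * later i y \<omega>"
        using range_i later_range[OF y i, of \<omega>] by (intro mult_right_mono power_difference_le) auto
      finally show "(?c * x i ^ (child i i \<omega> - 1) - ?S \<omega>) * (y i - x i)
        \<le> (y i ^ child i i \<omega> - x i ^ child i i \<omega>) * later i y \<omega>" .
    qed
    finally show ?thesis .
  qed
  show ?thesis
  proof (cases "y i = x i")
    case True
    \<comment> \<open>With no difference in coordinate \<open>i\<close> any admissible \<open>e\<close> will do.\<close>
    have "0 \<le> moments i * ?q" using moments_nonneg range_j by (intro mult_nonneg_nonneg sum_nonneg) auto
    then show ?thesis using that[of "1 - f' i (y i)"] True h_diff by simp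
  next
    case False
    then have pos: "y i - x i > 0" using range_i by simp
    define e where "e = 1 - ?I / (y i - x i)"
    show ?thesis
    proof (rule that[of e])
      show "h y i - h x i = (1 - e) * (y i - x i) + inflow i y x" using pos h_diff by (simp add: e_def)
      show "1 - f' i (y i) \<le> e" using upper pos by (simp add: e_def divide_le_eq)
      have "f' i (x i) - moments i * ?q \<le> ?I / (y i - x i)"
        using lower pos by (simp add: le_divide_eq)
      then show "e \<le> 1 - f' i (x i) + moments i * ?q" by (simp add: e_def)
    qed
  qed
qed

lemma h_mono: "h x i \<le> h y i"
proof -
  have "0 \<le> (\<integral>\<omega>. (y i ^ child i i \<omega> - x i ^ child i i \<omega>) * later i y \<omega> \<partial>M)"
    using range_i later_range[OF y i] by (intro integral_nonneg_AE) (auto intro!: AE_I2 mult_nonneg_nonneg simp: power_mono)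
  then show ?thesis using h_diff inflow_nonneg by linarith
qed

end

lemma one_in_box: "(\<lambda>_. 1) \<in> box" by (simp add: box_def)

lemma h_one: "h (\<lambda>_. 1) i = 1" by (simp add: generating_function_def prob_space)

lemma one_minus_h:
  assumes "i \<in> {1..N}" "x \<in> box"
  shows "1 - h x i = 1 - f i (x i) + inflow i (\<lambda>_. 1) x"
proof -
  have x: "x i \<in> {0..1}" "\<And>j. j \<in> {1..N} \<Longrightarrow> x j \<le> 1" using assms by (auto simp: box_def)
  have "1 - h x i = (\<integral>\<omega>. (1 - x i ^ child i i \<omega>) \<partial>M) + inflow i (\<lambda>_. 1) x"
    using h_diff[OF assms(1,2) one_in_box] x by (simp add: h_one later_def)
  also have "(\<integral>\<omega>. (1 - x i ^ child i i \<omega>) \<partial>M) = 1 - f i (x i)"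
    using critical_offspring.integrable_power[OF critical_offspring[OF assms(1)] x(1)]
    by (simp add: prob_space critical_offspring.pgf_def[OF critical_offspring[OF assms(1)]])
  finally show ?thesis .
qed

end

section \<open>Power laws for the survival probabilities\<close>

lemma powr_scaled_vanish:
  fixes a T :: "'x \<Rightarrow> real"
  assumes "((\<lambda>x. a x * T x powr p) \<longlongrightarrow> c) F" "filterlim T at_top F" "p' < p"
  shows "((\<lambda>x. a x * T x powr p') \<longlongrightarrow> 0) F"
proof -
  have "((\<lambda>x. T x powr (p' - p)) \<longlongrightarrow> 0) F"
    using assms by (intro tendsto_neg_powr) auto
  from tendsto_mult[OF assms(1) this]
  have "((\<lambda>x. a x * T x powr p * T x powr (p' - p)) \<longlongrightarrow> 0) F" by simp
  then show ?thesis
  proof (rule Lim_transform_eventually)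
    show "\<forall>\<^sub>F x in F. a x * T x powr p * T x powr (p' - p) = a x * T x powr p'"
      using assms(2)[unfolded filterlim_at_top_dense, rule_format, of 0]
      by eventually_elim (simp add: powr_diff)
  qed
qed

text \<open>
  A delay \<open>K n = o(n)\<close> is invisible to a power law when \<open>t\<close> is at least of order \<open>n\<close>.
\<close>

lemma shifted_power_law:
  fixes g :: "nat \<Rightarrow> real" and K :: "nat \<Rightarrow> nat"
  assumes g: "(\<lambda>t. g t * real t powr p) \<longlonglongrightarrow> c" and K: "(\<lambda>n. real (K n) / real n) \<longlonglongrightarrow> 0" and d: "\<delta> > 0"
  shows "((\<lambda>x. g (snd x + K (fst x)) * real (snd x) powr p) \<longlongrightarrow> c) (linear_range \<delta>)"
proof -
  let ?r = "\<lambda>x. real (K (fst x)) / real (snd x)"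
  let ?F = "linear_range \<delta>"
  have pos: "\<forall>\<^sub>F x in ?F. 1 \<le> snd x" "\<forall>\<^sub>F x in ?F. 1 \<le> fst x"
    using filterlim_snd_linear_range[OF d] filterlim_fst_linear_range[of \<delta>] unfolding filterlim_at_top by blast+
  have range: "\<forall>\<^sub>F x in ?F. \<delta> * real (fst x) \<le> real (snd x)"
    unfolding eventually_linear_range by auto
  have "((\<lambda>x. ?r x) \<longlongrightarrow> 0) ?F"
  proof (rule tendsto_sandwich[where f = "\<lambda>_. 0"])
    have "((\<lambda>x. real (K (fst x)) / real (fst x) / \<delta>) \<longlongrightarrow> 0 / \<delta>) ?F"
      by (intro tendsto_divide tendsto_const filterlim_compose[OF K filterlim_fst_linear_range]) (use d in auto)
    then show "((\<lambda>x. real (K (fst x)) / real (fst x) / \<delta>) \<longlongrightarrow> 0) ?F" by simp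
    show "\<forall>\<^sub>F x in ?F. ?r x \<le> real (K (fst x)) / real (fst x) / \<delta>"
      using pos range
    proof eventually_elim
      case (elim x)
      then have "?r x \<le> real (K (fst x)) / (\<delta> * real (fst x))"
        using d by (intro divide_left_mono) auto
      then show ?case by (simp add: mult.commute)
    qed
    show "\<forall>\<^sub>F x in ?F. 0 \<le> ?r x" by simp
  qed (rule tendsto_const)
  then have "((\<lambda>x. (1 + ?r x) powr - p) \<longlongrightarrow> (1 + 0) powr - p) ?F"
    by (intro tendsto_intros) auto
  moreover have "((\<lambda>x. g (snd x + K (fst x)) * real (snd x + K (fst x)) powr p) \<longlongrightarrow> c) ?F"
    by (rule filterlim_compose[OF g])
      (rule filterlim_at_top_mono[OF filterlim_snd_linear_range[OF d]], simp)
  ultimately have "((\<lambda>x. g (snd x + K (fst x)) * real (snd x + K (fst x)) powr p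
      * (1 + ?r x) powr - p) \<longlongrightarrow> c * 1) ?F"
    by (intro tendsto_mult) auto
  then have "((\<lambda>x. g (snd x + K (fst x)) * real (snd x + K (fst x)) powr p
      * (1 + ?r x) powr - p) \<longlongrightarrow> c) ?F" by simp
  then show ?thesis
  proof (rule Lim_transform_eventually)
    show "\<forall>\<^sub>F x in ?F. g (snd x + K (fst x)) * real (snd x + K (fst x)) powr p
      * (1 + ?r x) powr - p = g (snd x + K (fst x)) * real (snd x) powr p"
      using pos(1)
    proof eventually_elim
      case (elim x)
      let ?s = "real (snd x)" and ?k = "real (K (fst x))"
      have "real (snd x + K (fst x)) = ?s * (1 + ?k / ?s)" using elim by (simp add: field_simps)
      then have "real (snd x + K (fst x)) powr p = ?s powr p * (1 + ?k / ?s) powr p" by (metis powr_mult)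
      moreover have "(1 + ?k / ?s) powr p * (1 + ?k / ?s) powr - p = 1"
        by (simp add: add_nonneg_eq_0_iff flip: powr_add)
      ultimately show ?case by simp
    qed
  qed
qed

context critical_decomposable_gw
begin

lemma iterate_box: "x \<in> box \<Longrightarrow> (h ^^ t) x \<in> box"
proof (induction t)
  case (Suc t)
  then have "(h ^^ t) x \<in> box" by simp
  then show ?case using generating_function_range[of "(h ^^ t) x"] unfolding box_def by simp
qed simp

lemma iterate_mono:
  assumes "x \<in> box" "y \<in> box" "\<And>j. j \<in> {1..N} \<Longrightarrow> x j \<le> y j" "i \<in> {1..N}"
  shows "(h ^^ t) x i \<le> (h ^^ t) y i"
  using assms(4)
proof (induction t arbitrary: i)
  case (Suc t)
  show ?case using h_mono[OF Suc.prems iterate_box[OF assms(1), of t] iterate_box[OF assms(2), of t]] Suc.IH by simp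
qed (use assms in simp)

text \<open>
  The orbit of \<open>0\<close> consists of the extinction probabilities, so \<open>surv t i\<close> is the probability that the
  descendants of one type \<open>i\<close> particle, of all types, are not extinct at time \<open>t\<close>.
\<close>

definition surv :: "nat \<Rightarrow> nat \<Rightarrow> real" where "surv t i = 1 - (h ^^ t) (\<lambda>_. 0) i"

lemma zero_in_box: "(\<lambda>_. 0) \<in> box" by (simp add: box_def)

lemma surv_range: "i \<in> {1..N} \<Longrightarrow> 0 \<le> surv t i \<and> surv t i \<le> 1"
  using iterate_box[OF zero_in_box, of t] unfolding surv_def box_def by auto

lemma iterate_zero_add_le:
  assumes "i \<in> {1..N}"
  shows "(h ^^ t) (\<lambda>_. 0) i \<le> (h ^^ (t + k)) (\<lambda>_. 0) i"
  unfolding funpow_add comp_def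
  using assms iterate_box[OF zero_in_box, of k] zero_in_box by (intro iterate_mono) (auto simp: box_def)

lemma surv_decreasing: "i \<in> {1..N} \<Longrightarrow> s \<le> t \<Longrightarrow> surv t i \<le> surv s i"
  using iterate_zero_add_le[of i s "t - s"] by (simp add: surv_def)

definition two_children :: "nat \<Rightarrow> real" where "two_children i = prob {\<omega> \<in> space M. child i i \<omega> \<ge> 2}"

lemma two_children_pos: "i \<in> {1..N} \<Longrightarrow> two_children i > 0"
  unfolding two_children_def by (rule critical_offspring.prob_ge_2[OF critical_offspring])

lemma surv_Suc: "i \<in> {1..N} \<Longrightarrow>
   surv (Suc t) i = 1 - f i (1 - surv t i) + inflow i (\<lambda>_. 1) ((h ^^ t) (\<lambda>_. 0))"
  using one_minus_h[OF _ iterate_box[OF zero_in_box, of t], of i] by (simp add: surv_def)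

lemma surv_inflow_nonneg: "i \<in> {1..N} \<Longrightarrow> 0 \<le> inflow i (\<lambda>_. 1) ((h ^^ t) (\<lambda>_. 0))"
  using iterate_box[OF zero_in_box, of t] by (intro inflow_nonneg one_in_box) (auto simp: box_def)

lemma surv_pos:
  assumes i: "i \<in> {1..N}"
  shows "surv t i > 0"
proof (induction t)
  case (Suc t)
  have "f i (1 - surv t i) \<le> 1 - surv t i * two_children i" unfolding two_children_def
    using surv_range[OF i, of t] by (intro critical_offspring.pgf_le_one_minus[OF critical_offspring] i) auto
  moreover have "surv t i * two_children i > 0" using Suc two_children_pos[OF i] by simp
  ultimately show ?case using surv_Suc[OF i, of t] surv_inflow_nonneg[OF i, of t] by linarith
qed (simp add: surv_def)

text \<open>
  By induction the inflow from the later types vanishes in the limit, and the limit \<open>L\<close> of the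
  decreasing sequence satisfies \<open>L \<le> L - \<kappa> * L\<^sup>2\<close> with \<open>\<kappa> > 0\<close>.
\<close>

lemma surv_tendsto_0: "i \<in> {1..N} \<Longrightarrow> (\<lambda>t. surv t i) \<longlonglongrightarrow> 0"
proof (induction "N - i" arbitrary: i rule: less_induct)
  case less
  note i = less.prems
  have "(\<lambda>t. surv t j) \<longlonglongrightarrow> 0" if "j \<in> {i<..N}" for j using that i by (intro less.hyps) auto
  then have "(\<lambda>t. \<Sum>j\<in>{i<..N}. \<mu> i j * surv t j) \<longlonglongrightarrow> (\<Sum>j\<in>{i<..N}. \<mu> i j * 0)"
    by (intro tendsto_intros)
  then have S: "(\<lambda>t. \<Sum>j\<in>{i<..N}. \<mu> i j * surv t j) \<longlonglongrightarrow> 0" by simp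
  have step: "surv (Suc t) i \<le> surv t i - two_children i * (surv t i)\<^sup>2 + (\<Sum>j\<in>{i<..N}. \<mu> i j * surv t j)" for t
  proof -
    have "1 - surv t i + two_children i * (surv t i)\<^sup>2 \<le> f i (1 - surv t i)" unfolding two_children_def
      using surv_range[OF i, of t] by (intro critical_offspring.pgf_strictly_convex[OF critical_offspring] i) auto
    moreover have "inflow i (\<lambda>_. 1) ((h ^^ t) (\<lambda>_. 0)) \<le> (\<Sum>j\<in>{i<..N}. \<mu> i j * surv t j)"
      using inflow_le[OF i iterate_box[OF zero_in_box, of t] one_in_box] iterate_box[OF zero_in_box, of t]
      by (auto simp: surv_def box_def)
    ultimately show ?thesis using surv_Suc[OF i, of t] by linarith
  qed
  have "decseq (\<lambda>t. surv t i)" using surv_decreasing[OF i] by (auto simp: decseq_def)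
  from decseq_convergent[OF this, of 0] surv_range[OF i] obtain L where L: "(\<lambda>t. surv t i) \<longlonglongrightarrow> L" by blast
  have "L \<le> L - two_children i * L\<^sup>2 + 0"
  proof (rule LIMSEQ_le[OF LIMSEQ_Suc[OF L]])
    show "(\<lambda>t. surv t i - two_children i * (surv t i)\<^sup>2 + (\<Sum>j\<in>{i<..N}. \<mu> i j * surv t j))
        \<longlonglongrightarrow> L - two_children i * L\<^sup>2 + 0"
      by (intro tendsto_intros L S)
  qed (use step in auto)
  then have "L = 0" using two_children_pos[OF i] by (simp add: mult_le_0_iff)
  then show ?case using L by simp
qed

text \<open>
  In equilibrium \<open>b\<^sub>i * surv\<^sub>i\<^sup>2\<close> balances the mean inflow, of the order of \<open>surv\<^sub>i\<^sub>+\<^sub>1\<close>: every step back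
  from type \<open>N\<close>, where the exponent is 1, halves the decay exponent.
\<close>

definition \<gamma> :: "nat \<Rightarrow> real" where "\<gamma> i = 1 / 2 ^ (N - i)"

lemma \<gamma>_Suc: "i < N \<Longrightarrow> \<gamma> (Suc i) = 2 * \<gamma> i"
  by (simp add: \<gamma>_def flip: Suc_diff_Suc)

lemma \<gamma>_pos: "\<gamma> i > 0" by (simp add: \<gamma>_def)

lemma \<gamma>_less: "i < j \<Longrightarrow> j \<le> N \<Longrightarrow> \<gamma> i < \<gamma> j"
  unfolding \<gamma>_def by (intro divide_strict_left_mono power_strict_increasing) auto

lemma \<gamma>_N: "\<gamma> N = 1" by (simp add: \<gamma>_def)

abbreviation b :: "nat \<Rightarrow> real" where "b \<equiv> half_variance M \<eta>"

lemma b_pos: "i \<in> {1..N} \<Longrightarrow> b i > 0"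
  using hypothesis_A unfolding hypothesis_A_def by auto

lemma mean_next_pos: "i \<in> {1..<N} \<Longrightarrow> \<mu> i (Suc i) > 0"
  using hypothesis_A unfolding hypothesis_A_def by auto

text \<open>
  The scales of the types beyond \<open>i + 1\<close> are smaller, so the inflow is asymptotically that from type
  \<open>i + 1\<close>.  The filter and the exponents are left open since the lemma serves both the survival
  probabilities and the differences of orbits.
\<close>

lemma inflow_power_law:
  fixes X Y :: "'x \<Rightarrow> nat \<Rightarrow> real"
  assumes i: "i \<in> {1..<N}"
    and ev: "\<forall>\<^sub>F z in F. X z \<in> box \<and> Y z \<in> box \<and> (\<forall>j\<in>{1..N}. X z j \<le> Y z j)"
    and X1: "\<And>j. j \<in> {i..N} \<Longrightarrow> ((\<lambda>z. X z j) \<longlongrightarrow> 1) F"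
    and T: "filterlim T at_top F"
    and p: "\<And>j. j \<in> {Suc i<..N} \<Longrightarrow> p (Suc i) < p j"
    and lim: "\<And>j. j \<in> {i<..N} \<Longrightarrow> ((\<lambda>z. (Y z j - X z j) * T z powr p j) \<longlongrightarrow> d j) F"
  shows "((\<lambda>z. inflow i (Y z) (X z) * T z powr p (Suc i)) \<longlongrightarrow> \<mu> i (Suc i) * d (Suc i)) F"
proof (rule tendsto_sandwich)
  let ?m = "\<mu> i"
  let ?D = "\<lambda>z. (Y z (Suc i) - X z (Suc i)) * T z powr p (Suc i)"
  let ?k = "\<lambda>z. ?m (Suc i) - moments i * (\<Sum>j\<in>{i..N}. 1 - X z j)"
  have i': "i \<in> {1..N}" using i by auto
  have "((\<lambda>z. ?k z * ?D z)
      \<longlongrightarrow> (?m (Suc i) - moments i * (\<Sum>j\<in>{i..N}. 1 - 1)) * d (Suc i)) F"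
    using i by (intro tendsto_intros X1 lim) auto
  then show "((\<lambda>z. ?k z * ?D z)
      \<longlongrightarrow> ?m (Suc i) * d (Suc i)) F" by simp
  have lim0: "((\<lambda>z. (Y z j - X z j) * T z powr p (Suc i)) \<longlongrightarrow> (if j = Suc i then d j else 0)) F"
    if "j \<in> {i<..N}" for j
    using lim[OF that] powr_scaled_vanish[OF lim[OF that] T p] that by (cases "j = Suc i") auto
  have "((\<lambda>z. \<Sum>j\<in>{i<..N}. ?m j * ((Y z j - X z j) * T z powr p (Suc i)))
      \<longlongrightarrow> (\<Sum>j\<in>{i<..N}. ?m j * (if j = Suc i then d j else 0))) F"
    by (intro tendsto_intros lim0)
  also have "(\<Sum>j\<in>{i<..N}. ?m j * (if j = Suc i then d j else 0)) = ?m (Suc i) * d (Suc i)"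
    using i by (subst sum.mono_neutral_right[of _ "{Suc i}"]) auto
  finally show "((\<lambda>z. \<Sum>j\<in>{i<..N}. ?m j * ((Y z j - X z j) * T z powr p (Suc i))) \<longlongrightarrow> ?m (Suc i) * d (Suc i)) F" .
  show "\<forall>\<^sub>F z in F. ?k z * ?D z
      \<le> inflow i (Y z) (X z) * T z powr p (Suc i)"
    using ev
  proof eventually_elim
    case (elim z)
    have "?k z * (Y z (Suc i) - X z (Suc i)) \<le> inflow i (Y z) (X z)"
      using elim i i' by (intro inflow_ge) auto
    from mult_right_mono[OF this, of "T z powr p (Suc i)"] show ?case by (simp add: mult.assoc)
  qed
  show "\<forall>\<^sub>F z in F. inflow i (Y z) (X z) * T z powr p (Suc i)
      \<le> (\<Sum>j\<in>{i<..N}. ?m j * ((Y z j - X z j) * T z powr p (Suc i)))"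
    using ev
  proof eventually_elim
    case (elim z)
    have "inflow i (Y z) (X z) \<le> (\<Sum>j\<in>{i<..N}. ?m j * (Y z j - X z j))"
      using elim i' by (intro inflow_le) auto
    from mult_right_mono[OF this, of "T z powr p (Suc i)"] show ?case
      by (simp add: sum_distrib_right mult.assoc)
  qed
qed

text \<open>
  The coefficient that makes the quadratic recursion for \<open>surv\<close> exact.
\<close>

definition \<beta> :: "nat \<Rightarrow> nat \<Rightarrow> real" where "\<beta> i t = (f i (1 - surv t i) - 1 + surv t i) / (surv t i)\<^sup>2"

lemma filterlim_surv: "i \<in> {1..N} \<Longrightarrow> filterlim (\<lambda>t. surv t i) (at_right 0) sequentially"
  using surv_tendsto_0[of i] surv_pos[of i] by (intro tendsto_imp_filterlim_at_right) auto

lemma \<beta>_tendsto: "i \<in> {1..N} \<Longrightarrow> \<beta> i \<longlonglongrightarrow> b i"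
  unfolding \<beta>_def
  by (rule filterlim_compose[OF critical_offspring.pgf_expansion[OF critical_offspring] filterlim_surv])

lemma surv_recursion:
  "i \<in> {1..N} \<Longrightarrow> surv (Suc t) i = surv t i - \<beta> i t * (surv t i)\<^sup>2 + inflow i (\<lambda>_. 1) ((h ^^ t) (\<lambda>_. 0))"
  using surv_pos[of i t] by (simp add: surv_Suc \<beta>_def)

lemma surv_last: "N \<ge> 1 \<Longrightarrow> (\<lambda>t. surv t N * real t) \<longlonglongrightarrow> 1 / b N"
  using surv_recursion[of N] surv_pos[of N]
  by (intro critical_recursion[OF b_pos _ surv_tendsto_0 _ \<beta>_tendsto]) (auto simp: inflow_last)

lemma surv_power_law: "i \<in> {1..N} \<Longrightarrow> \<exists>c>0. (\<lambda>t. surv t i * real t powr \<gamma> i) \<longlonglongrightarrow> c"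
proof (induction "N - i" arbitrary: i rule: less_induct)
  case less
  note i = less.prems
  show ?case
  proof (cases "i = N")
    case True
    then show ?thesis using surv_last b_pos[OF i] i by (intro exI[of _ "1 / b N"]) (auto simp: \<gamma>_N)
  next
    case False
    then have i': "i \<in> {1..<N}" using i by auto
    have "\<exists>c>0. (\<lambda>t. surv t j * real t powr \<gamma> j) \<longlonglongrightarrow> c" if "j \<in> {i<..N}" for j
      using that i by (intro less.hyps) auto
    then have "\<forall>j\<in>{i<..N}. \<exists>c. c > 0 \<and> (\<lambda>t. surv t j * real t powr \<gamma> j) \<longlonglongrightarrow> c" by blast
    from bchoice[OF this]
    obtain c where c: "\<And>j. j \<in> {i<..N} \<Longrightarrow> c j > 0 \<and> (\<lambda>t. surv t j * real t powr \<gamma> j) \<longlonglongrightarrow> c j"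
      by blast
    have c': "c (Suc i) > 0" using c[of "Suc i"] i' by auto
    have "(\<lambda>t. inflow i (\<lambda>_. 1) ((h ^^ t) (\<lambda>_. 0)) * real t powr \<gamma> (Suc i))
        \<longlonglongrightarrow> \<mu> i (Suc i) * c (Suc i)"
    proof (rule inflow_power_law[OF i'])
      show "\<forall>\<^sub>F t in sequentially. (h ^^ t) (\<lambda>_. 0) \<in> box \<and> (\<lambda>_. 1) \<in> box \<and> (\<forall>j\<in>{1..N}. (h ^^ t) (\<lambda>_. 0) j \<le> 1)"
        using iterate_box[OF zero_in_box] one_in_box by (intro always_eventually) (auto simp: box_def)
      show "(\<lambda>t. (h ^^ t) (\<lambda>_. 0) j) \<longlonglongrightarrow> 1" if "j \<in> {i..N}" for j
      proof -
        have "(\<lambda>t. 1 - surv t j) \<longlonglongrightarrow> 1 - 0" using that i by (intro tendsto_intros surv_tendsto_0) auto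
        then show ?thesis by (simp add: surv_def)
      qed
      show "\<gamma> (Suc i) < \<gamma> j" if "j \<in> {Suc i<..N}" for j using that by (intro \<gamma>_less) auto
      show "(\<lambda>t. (1 - (h ^^ t) (\<lambda>_. 0) j) * real t powr \<gamma> j) \<longlonglongrightarrow> c j" if "j \<in> {i<..N}" for j
        using c[OF that] by (simp add: surv_def)
    qed (rule filterlim_real_sequentially)
    then have "(\<lambda>t. surv t i * real t powr \<gamma> i) \<longlonglongrightarrow> sqrt (\<mu> i (Suc i) * c (Suc i) / b i)"
      using b_pos[OF i] mean_next_pos[OF i'] c' \<gamma>_pos \<gamma>_less[of i N] \<gamma>_N i' surv_range[OF i] surv_recursion[OF i]
      by (intro quadratic_recursion[OF _ _ _ _ _ surv_tendsto_0[OF i] _ \<beta>_tendsto[OF i]]) (auto simp: \<gamma>_Suc)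
    then show ?thesis using b_pos[OF i] mean_next_pos[OF i'] c'
      by (intro exI[of _ "sqrt (\<mu> i (Suc i) * c (Suc i) / b i)"]) auto
  qed
qed

section \<open>Differences of two nearby orbits\<close>

text \<open>
  Starting points below the extinction probabilities at time \<open>K n = o(n)\<close>: by monotonicity their orbits
  stay between those of \<open>0\<close> and of its \<open>K n\<close>-th iterate, which are indistinguishable on the scale \<open>n\<close>.
\<close>

definition trapped :: "(nat \<Rightarrow> nat) \<Rightarrow> (nat \<Rightarrow> nat \<Rightarrow> real) \<Rightarrow> (nat \<Rightarrow> nat \<Rightarrow> real) \<Rightarrow> bool" where
  "trapped K X Y \<longleftrightarrow> (\<lambda>n. real (K n) / real n) \<longlonglongrightarrow> 0 \<and>
     (\<forall>\<^sub>F n in sequentially. X n \<in> box \<and> Y n \<in> box \<and>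
        (\<forall>j\<in>{1..N}. X n j \<le> Y n j \<and> Y n j \<le> (h ^^ K n) (\<lambda>_. 0) j))"

definition gap :: "nat \<Rightarrow> (nat \<Rightarrow> nat \<Rightarrow> real) \<Rightarrow> (nat \<Rightarrow> nat \<Rightarrow> real) \<Rightarrow> nat \<Rightarrow> nat \<Rightarrow> real" where
  "gap i X Y n t = (h ^^ t) (Y n) i - (h ^^ t) (X n) i"

lemma trapped_bounds:
  assumes "trapped K X Y"
  shows "\<forall>\<^sub>F x in linear_range \<delta>. (h ^^ snd x) (X (fst x)) \<in> box \<and> (h ^^ snd x) (Y (fst x)) \<in> box \<and>
    (\<forall>j\<in>{1..N}. (h ^^ snd x) (X (fst x)) j \<le> (h ^^ snd x) (Y (fst x)) j \<and>
       surv (snd x + K (fst x)) j \<le> 1 - (h ^^ snd x) (Y (fst x)) j \<and>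
       1 - (h ^^ snd x) (X (fst x)) j \<le> surv (snd x) j)"
proof -
  have "\<forall>\<^sub>F n in sequentially. X n \<in> box \<and> Y n \<in> box \<and>
        (\<forall>j\<in>{1..N}. X n j \<le> Y n j \<and> Y n j \<le> (h ^^ K n) (\<lambda>_. 0) j)"
    using assms unfolding trapped_def by blast
  from eventually_compose_filterlim[OF this filterlim_fst_linear_range]
  show ?thesis
  proof eventually_elim
    case (elim x)
    obtain n t where x: "x = (n, t)" by fastforce
    have X: "X n \<in> box" and Y: "Y n \<in> box" and XY: "\<And>j. j \<in> {1..N} \<Longrightarrow> X n j \<le> Y n j"
      and YK: "\<And>j. j \<in> {1..N} \<Longrightarrow> Y n j \<le> (h ^^ K n) (\<lambda>_. 0) j" using elim x by auto
    have "(h ^^ t) (X n) j \<le> (h ^^ t) (Y n) j \<and> surv (t + K n) j \<le> 1 - (h ^^ t) (Y n) j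
        \<and> 1 - (h ^^ t) (X n) j \<le> surv t j" if j: "j \<in> {1..N}" for j
    proof (intro conjI)
      show "(h ^^ t) (X n) j \<le> (h ^^ t) (Y n) j" using X Y XY j by (rule iterate_mono)
      show "surv (t + K n) j \<le> 1 - (h ^^ t) (Y n) j" unfolding surv_def funpow_add comp_def
        using iterate_mono[OF Y iterate_box[OF zero_in_box] YK j, of t] by simp
      have "(h ^^ t) (\<lambda>_. 0) j \<le> (h ^^ t) (X n) j" using X j by (intro iterate_mono zero_in_box) (auto simp: box_def)
      then show "1 - (h ^^ t) (X n) j \<le> surv t j" by (simp add: surv_def)
    qed
    then show ?case using x X Y iterate_box by auto
  qed
qed

lemma trapped_power_law:
  assumes tr: "trapped K X Y" and j: "j \<in> {1..N}" and d: "\<delta> > 0"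
    and law: "(\<lambda>t. surv t j * real t powr p) \<longlonglongrightarrow> c"
  shows "((\<lambda>x. (1 - (h ^^ snd x) (Y (fst x)) j) * real (snd x) powr p) \<longlongrightarrow> c) (linear_range \<delta>)"
    and "((\<lambda>x. (1 - (h ^^ snd x) (X (fst x)) j) * real (snd x) powr p) \<longlongrightarrow> c) (linear_range \<delta>)"
proof -
  let ?y = "\<lambda>x. (1 - (h ^^ snd x) (Y (fst x)) j) * real (snd x) powr p"
  let ?x = "\<lambda>x. (1 - (h ^^ snd x) (X (fst x)) j) * real (snd x) powr p"
  let ?low = "\<lambda>x. surv (snd x + K (fst x)) j * real (snd x) powr p"
  let ?high = "\<lambda>x. surv (snd x) j * real (snd x) powr p"
  let ?F = "linear_range \<delta>"
  have low: "((\<lambda>x. ?low x) \<longlongrightarrow> c) ?F"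
    using tr by (intro shifted_power_law[OF law _ d]) (simp add: trapped_def)
  have high: "((\<lambda>x. ?high x) \<longlongrightarrow> c) ?F"
    by (rule filterlim_compose[OF law filterlim_snd_linear_range[OF d]])
  have "\<forall>\<^sub>F x in ?F. ?low x \<le> ?y x
      \<and> ?y x \<le> ?x x
      \<and> ?x x \<le> ?high x"
    using trapped_bounds[OF tr, of \<delta>] by eventually_elim (use j in \<open>auto intro!: mult_right_mono\<close>)
  then have ev: "\<forall>\<^sub>F x in ?F. ?low x \<le> ?y x"
    "\<forall>\<^sub>F x in ?F. ?y x \<le> ?high x"
    "\<forall>\<^sub>F x in ?F. ?low x \<le> ?x x"
    "\<forall>\<^sub>F x in ?F. ?x x \<le> ?high x"
    by (eventually_elim; linarith)+
  show "((\<lambda>x. ?y x) \<longlongrightarrow> c) ?F"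
    by (rule tendsto_sandwich[OF ev(1,2) low high])
  show "((\<lambda>x. ?x x) \<longlongrightarrow> c) ?F"
    by (rule tendsto_sandwich[OF ev(3,4) low high])
qed

text \<open>
  The constant \<open>c\<close> must not depend on the starting points: only the limit \<open>L\<close> for the last type carries
  information about them.
\<close>

definition gap_factor :: "nat \<Rightarrow> real \<Rightarrow> bool" where
  "gap_factor i c \<longleftrightarrow> c > 0 \<and> (\<forall>K X Y L. trapped K X Y \<longrightarrow>
     (\<forall>\<delta>>0. ((\<lambda>(n, t). gap N X Y n t * real t powr 2) \<longlongrightarrow> L) (linear_range \<delta>)) \<longrightarrow>
     (\<forall>\<delta>>0. ((\<lambda>(n, t). gap i X Y n t * real t powr (1 + \<gamma> i)) \<longlongrightarrow> c * L) (linear_range \<delta>)))"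

lemma gap_factorD:
  assumes "gap_factor i c" "trapped K X Y"
    "\<And>\<delta>. \<delta> > 0 \<Longrightarrow> ((\<lambda>(n, t). gap N X Y n t * real t powr 2) \<longlongrightarrow> L) (linear_range \<delta>)" "\<delta> > 0"
  shows "((\<lambda>(n, t). gap i X Y n t * real t powr (1 + \<gamma> i)) \<longlongrightarrow> c * L) (linear_range \<delta>)"
  using assms(1) assms(2-) unfolding gap_factor_def by blast

text \<open>
  Along trapped orbits the difference in coordinate \<open>i\<close> contracts at the rate
  \<open>2 * b\<^sub>i * surv t i\<close> and is fed by the differences in the later coordinates.  Since that rate is
  \<open>t powr - \<gamma> i\<close> up to a constant, with \<open>\<gamma> i < 1\<close>, the initial difference is forgotten
  and the difference is proportional to the one for type \<open>i + 1\<close>.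
\<close>

lemma gap_power_law: "i \<in> {1..N} \<Longrightarrow> \<exists>c. gap_factor i c"
proof (induction "N - i" arbitrary: i rule: less_induct)
  case less
  note i = less.prems
  show ?case
  proof (cases "i = N")
    case True
    then show ?thesis by (intro exI[of _ 1]) (simp add: gap_factor_def \<gamma>_N)
  next
    case False
    then have i': "i \<in> {1..<N}" using i by auto
    have "\<exists>c. gap_factor j c" if "j \<in> {i<..N}" for j
      using that i by (intro less.hyps) auto
    then have "\<forall>j\<in>{i<..N}. \<exists>c. gap_factor j c" by blast
    from bchoice[OF this] obtain c where c: "\<And>j. j \<in> {i<..N} \<Longrightarrow> gap_factor j (c j)" by blast
    have "\<exists>c>0. (\<lambda>t. surv t j * real t powr \<gamma> j) \<longlonglongrightarrow> c" if "j \<in> {i..N}" for j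
      using that i by (intro surv_power_law) auto
    then have "\<forall>j\<in>{i..N}. \<exists>c. c > 0 \<and> (\<lambda>t. surv t j * real t powr \<gamma> j) \<longlonglongrightarrow> c" by blast
    from bchoice[OF this]
    obtain q where q: "\<And>j. j \<in> {i..N} \<Longrightarrow> q j > 0 \<and> (\<lambda>t. surv t j * real t powr \<gamma> j) \<longlonglongrightarrow> q j" by blast
    define c' where "c' = \<mu> i (Suc i) * c (Suc i) / (2 * b i * q i)"
    have "c (Suc i) > 0" using c[of "Suc i"] i' unfolding gap_factor_def by auto
    then have "c' > 0" unfolding c'_def using mean_next_pos[OF i'] q[of i] b_pos[OF i] i by auto
    moreover have "((\<lambda>(n, t). gap i X Y n t * real t powr (1 + \<gamma> i)) \<longlongrightarrow> c' * L) (linear_range \<delta>)"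
      if tr: "trapped K X Y" and lastL: "\<And>\<delta>. \<delta> > 0 \<Longrightarrow> ((\<lambda>(n, t). gap N X Y n t * real t powr 2) \<longlongrightarrow> L) (linear_range \<delta>)"
        and d: "\<delta> > 0" for K X Y L \<delta>
    proof -
      let ?x = "\<lambda>z. (h ^^ snd z) (X (fst z))" and ?y = "\<lambda>z. (h ^^ snd z) (Y (fst z))"
      define good where "good = (\<lambda>z. ?x z \<in> box \<and> ?y z \<in> box \<and> (\<forall>j\<in>{1..N}. ?x z j \<le> ?y z j))"
      define slope where "slope = (\<lambda>z e. h (?y z) i - h (?x z) i = (1 - e) * (?y z i - ?x z i) + inflow i (?y z) (?x z)
         \<and> 1 - f' i (?y z i) \<le> e \<and> e \<le> 1 - f' i (?x z i) + moments i * (\<Sum>j\<in>{i<..N}. 1 - ?y z j))"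
      define e where "e = (\<lambda>z. SOME e. slope z e)"
      have e: "slope z (e z)" if "good z" for z
      proof -
        have "\<exists>e. slope z e" unfolding slope_def
          using self_slope[OF i, of "?x z" "?y z"] that unfolding good_def by blast
        then show ?thesis unfolding e_def by (rule someI_ex)
      qed
      have good: "\<forall>\<^sub>F z in linear_range \<delta>. good z" for \<delta>
        using trapped_bounds[OF tr, of \<delta>] unfolding good_def by eventually_elim auto
      have surv_law: "(\<lambda>t. surv t j * real t powr \<gamma> j) \<longlonglongrightarrow> q j" if "j \<in> {i..N}" for j using q[OF that] by simp
      have "((\<lambda>(n, t). gap i X Y n t * real t powr (1 + \<gamma> i))
          \<longlongrightarrow> \<mu> i (Suc i) * (c (Suc i) * L) / (2 * b i * q i)) (linear_range \<delta>)"
      proof (rule forced_linear_recursion[where \<gamma> = "\<gamma> i" and \<epsilon> = "\<lambda>n t. e (n, t)"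
            and S = "\<lambda>n t. inflow i (?y (n, t)) (?x (n, t))"])
        show "0 < 2 * b i * q i" using b_pos[OF i] q[of i] i by auto
        show "0 < \<gamma> i" by (rule \<gamma>_pos)
        show "\<gamma> i < 1" using \<gamma>_less[of i N] \<gamma>_N i' by auto
        show "0 \<le> 1 + \<gamma> i" using \<gamma>_pos[of i] by simp
      next
        fix \<delta> :: real assume d: "\<delta> > 0"
        show "\<forall>\<^sub>F (n, t) in linear_range \<delta>. \<bar>gap i X Y n t\<bar> \<le> 1"
          using good[of \<delta>]
        proof eventually_elim
          case (elim z)
          then have "?x z i \<in> {0..1}" "?y z i \<in> {0..1}" using i unfolding good_def box_def by auto
          then show ?case by (auto simp: gap_def case_prod_beta' abs_le_iff)
        qed
        show "\<forall>\<^sub>F (n, t) in linear_range \<delta>. gap i X Y n (Suc t)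
            = (1 - e (n, t)) * gap i X Y n t + inflow i (?y (n, t)) (?x (n, t))"
          using good[of \<delta>] by eventually_elim (use e in \<open>auto simp: gap_def slope_def case_prod_beta'\<close>)
      next
        fix \<delta> :: real assume d: "\<delta> > 0"
        let ?F = "linear_range \<delta>"
        let ?T = "\<lambda>z::nat \<times> nat. real (snd z)"
        have T: "filterlim ?T at_top ?F"
          using filterlim_compose[OF filterlim_real_sequentially filterlim_snd_linear_range[OF d]] .
        have Ylaw: "((\<lambda>z. (1 - ?y z j) * ?T z powr \<gamma> j) \<longlongrightarrow> q j) ?F"
          and Xlaw: "((\<lambda>z. (1 - ?x z j) * ?T z powr \<gamma> j) \<longlongrightarrow> q j) ?F" if "j \<in> {i..N}" for j
          using trapped_power_law[OF tr _ d surv_law[OF that]] that i by auto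
        have T0: "\<forall>\<^sub>F z in ?F. ?T z > 0" using T unfolding filterlim_at_top_dense by blast
        have vanish: "((\<lambda>z. 1 - g z) \<longlongrightarrow> 0) ?F"
          if "((\<lambda>z. (1 - g z) * ?T z powr \<gamma> j) \<longlongrightarrow> r) ?F" for g :: "nat \<times> nat \<Rightarrow> real" and j r
        proof -
          have "((\<lambda>z. (1 - g z) * ?T z powr 0) \<longlongrightarrow> 0) ?F"
            by (rule powr_scaled_vanish[OF that T \<gamma>_pos])
          then show ?thesis
            by (rule Lim_transform_eventually) (use T0 in \<open>eventually_elim, simp\<close>)
        qed
        have pos: "\<forall>\<^sub>F z in ?F. 1 - ?y z i > 0 \<and> 1 - ?x z i > 0"
          using trapped_bounds[OF tr, of \<delta>]
        proof eventually_elim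
          case (elim z)
          then show ?case using surv_pos[OF i, of "snd z + K (fst z)"] i by fastforce
        qed
        have self: "((\<lambda>z. (1 - f' i (g z i)) * ?T z powr \<gamma> i) \<longlongrightarrow> 2 * b i * q i) ?F"
          if law: "((\<lambda>z. (1 - g z i) * ?T z powr \<gamma> i) \<longlongrightarrow> q i) ?F"
            and pos: "\<forall>\<^sub>F z in ?F. 1 - g z i > 0" for g :: "nat \<times> nat \<Rightarrow> nat \<Rightarrow> real"
        proof -
          have "filterlim (\<lambda>z. 1 - g z i) (at_right 0) ?F"
            using vanish[OF law] pos by (intro tendsto_imp_filterlim_at_right)
          from filterlim_compose[OF critical_offspring.pgf_deriv_expansion[OF critical_offspring[OF i]] this]
          have "((\<lambda>z. (1 - f' i (g z i)) / (1 - g z i)) \<longlongrightarrow> 2 * b i) ?F" by simp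
          from tendsto_mult[OF this law] show ?thesis
            by (rule Lim_transform_eventually) (use pos in \<open>eventually_elim, simp\<close>)
        qed
        have others: "((\<lambda>z. moments i * (\<Sum>j\<in>{i<..N}. (1 - ?y z j) * ?T z powr \<gamma> i)) \<longlongrightarrow> moments i * (\<Sum>j\<in>{i<..N}. 0)) ?F"
        proof (intro tendsto_intros)
          fix j assume j: "j \<in> {i<..N}"
          then have "((\<lambda>z. (1 - ?y z j) * ?T z powr \<gamma> j) \<longlongrightarrow> q j) ?F" by (intro Ylaw) auto
          then show "((\<lambda>z. (1 - ?y z j) * ?T z powr \<gamma> i) \<longlongrightarrow> 0) ?F"
            by (rule powr_scaled_vanish[OF _ T \<gamma>_less]) (use j in auto)
        qed
        have "((\<lambda>z. e z * ?T z powr \<gamma> i) \<longlongrightarrow> 2 * b i * q i) ?F"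
        proof (rule tendsto_sandwich)
          show "((\<lambda>z. (1 - f' i (?y z i)) * ?T z powr \<gamma> i) \<longlongrightarrow> 2 * b i * q i) ?F"
            using Ylaw[of i] pos i by (intro self) (auto elim: eventually_mono)
          have "((\<lambda>z. (1 - f' i (?x z i)) * ?T z powr \<gamma> i) \<longlongrightarrow> 2 * b i * q i) ?F"
            using Xlaw[of i] pos i by (intro self) (auto elim: eventually_mono)
          from tendsto_add[OF this others]
          show "((\<lambda>z. (1 - f' i (?x z i)) * ?T z powr \<gamma> i
              + moments i * (\<Sum>j\<in>{i<..N}. (1 - ?y z j) * ?T z powr \<gamma> i)) \<longlongrightarrow> 2 * b i * q i) ?F" by simp
          show "\<forall>\<^sub>F z in ?F. (1 - f' i (?y z i)) * ?T z powr \<gamma> i \<le> e z * ?T z powr \<gamma> i"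
            using good[of \<delta>] by eventually_elim (use e in \<open>auto simp: slope_def intro!: mult_right_mono\<close>)
          show "\<forall>\<^sub>F z in ?F. e z * ?T z powr \<gamma> i \<le> (1 - f' i (?x z i)) * ?T z powr \<gamma> i
              + moments i * (\<Sum>j\<in>{i<..N}. (1 - ?y z j) * ?T z powr \<gamma> i)"
            using good[of \<delta>]
          proof eventually_elim
            case (elim z)
            then have "e z \<le> 1 - f' i (?x z i) + moments i * (\<Sum>j\<in>{i<..N}. 1 - ?y z j)"
              using e by (simp add: slope_def)
            from mult_right_mono[OF this, of "?T z powr \<gamma> i"]
            have "e z * ?T z powr \<gamma> i \<le> (1 - f' i (?x z i) + moments i * (\<Sum>j\<in>{i<..N}. 1 - ?y z j)) * ?T z powr \<gamma> i"
              by simp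
            then show ?case by (simp only: distrib_right mult.assoc sum_distrib_right)
          qed
        qed
        then show "((\<lambda>(n, t). e (n, t) * real t powr \<gamma> i) \<longlongrightarrow> 2 * b i * q i) ?F"
          by (simp add: case_prod_beta')
        have "((\<lambda>z. inflow i (?y z) (?x z) * ?T z powr (1 + \<gamma> (Suc i)))
            \<longlongrightarrow> \<mu> i (Suc i) * (c (Suc i) * L)) ?F"
        proof (rule inflow_power_law[OF i', where p = "\<lambda>j. 1 + \<gamma> j" and d = "\<lambda>j. c j * L"])
          show "\<forall>\<^sub>F z in ?F. ?x z \<in> box \<and> ?y z \<in> box \<and> (\<forall>j\<in>{1..N}. ?x z j \<le> ?y z j)"
            using good[of \<delta>] unfolding good_def .
          show "((\<lambda>z. ?x z j) \<longlongrightarrow> 1) ?F" if "j \<in> {i..N}" for j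
          proof -
            have "((\<lambda>z. 1 - (1 - ?x z j)) \<longlongrightarrow> 1 - 0) ?F"
              using vanish[OF Xlaw[OF that]] by (intro tendsto_intros)
            then show ?thesis by simp
          qed
          show "1 + \<gamma> (Suc i) < 1 + \<gamma> j" if "j \<in> {Suc i<..N}" for j using that \<gamma>_less[of "Suc i" j] by simp
          show "((\<lambda>z. (?y z j - ?x z j) * ?T z powr (1 + \<gamma> j)) \<longlongrightarrow> c j * L) ?F" if "j \<in> {i<..N}" for j
          proof -
            have "((\<lambda>(n, t). gap j X Y n t * real t powr (1 + \<gamma> j)) \<longlongrightarrow> c j * L) ?F"
              by (rule gap_factorD[OF c[OF that] tr lastL d])
            then show ?thesis by (simp add: gap_def case_prod_beta')
          qed
        qed (rule T)
        then show "((\<lambda>(n, t). inflow i (?y (n, t)) (?x (n, t)) * real t powr (1 + \<gamma> i + \<gamma> i))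
            \<longlongrightarrow> \<mu> i (Suc i) * (c (Suc i) * L)) ?F"
          using \<gamma>_Suc[of i] i' by (simp add: case_prod_beta' add.assoc)
      qed (rule d)
      then show ?thesis by (simp add: c'_def mult.assoc)
    qed
    ultimately have "gap_factor i c'" unfolding gap_factor_def by blast
    then show ?thesis ..
  qed
qed

section \<open>The last type\<close>

definition ext :: "nat \<Rightarrow> real" where "ext t = (h ^^ t) (\<lambda>_. 0) N"

definition ext_step :: "nat \<Rightarrow> real" where "ext_step t = ext (Suc t) - ext t"

context
  assumes N1: "N \<ge> 1"
begin

lemma last_type: "N \<in> {1..N}" using N1 by simp

lemma ext_surv: "ext t = 1 - surv t N" by (simp add: ext_def surv_def)

lemma iterate_last: "(h ^^ t) x N = (f N ^^ t) (x N)"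
  using h_last[OF N1] by (induction t) auto

lemma ext_eq: "ext t = (f N ^^ t) 0" by (simp add: ext_def iterate_last)

lemma iterate_ext: "(f N ^^ t) (ext s) = ext (t + s)" by (simp add: ext_eq funpow_add)

lemma ext_range: "0 \<le> ext t" "ext t < 1" using surv_range[OF last_type, of t] surv_pos[OF last_type, of t] by (auto simp: ext_surv)

lemma ext_mono: "s \<le> t \<Longrightarrow> ext s \<le> ext t" using surv_decreasing[OF last_type] by (simp add: ext_surv)

lemma iterate_pgf:
  assumes "0 \<le> x" "x \<le> y" "y \<le> 1"
  shows "0 \<le> (f N ^^ t) x \<and> (f N ^^ t) x \<le> (f N ^^ t) y \<and> (f N ^^ t) y \<le> 1"
proof (induction t)
  case (Suc t)
  interpret co: critical_offspring M "child N N" "b N" using last_type by (rule critical_offspring)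
  show ?case using Suc co.pgf_mono co.pgf_range[of "(f N ^^ t) x"] co.pgf_range[of "(f N ^^ t) y"] by auto
qed (use assms in auto)

text \<open>
  A quotient of chords decreases under an increasing convex map, hence under all its iterates.
\<close>

lemma iterate_convex:
  assumes "0 \<le> x" "x \<le> y" "y \<le> v" "v \<le> w" "w \<le> 1"
  shows "((f N ^^ t) y - (f N ^^ t) x) * (w - v) \<le> ((f N ^^ t) w - (f N ^^ t) v) * (y - x)"
proof (induction t)
  case (Suc t)
  interpret co: critical_offspring M "child N N" "b N" using last_type by (rule critical_offspring)
  let ?x = "(f N ^^ t) x" and ?y = "(f N ^^ t) y" and ?v = "(f N ^^ t) v" and ?w = "(f N ^^ t) w"
  have o: "0 \<le> ?x" "?x \<le> ?y" "?y \<le> ?v" "?v \<le> ?w" "?w \<le> 1"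
    using assms iterate_pgf[of x y t] iterate_pgf[of y v t] iterate_pgf[of v w t] by auto
  have c: "(f N ?y - f N ?x) * (?w - ?v) \<le> (f N ?w - f N ?v) * (?y - ?x)" using o by (rule co.pgf_convex)
  have "(f N ?y - f N ?x) * (w - v) \<le> (f N ?w - f N ?v) * (y - x)"
  proof (cases "?w = ?v")
    case True
    then have "(?y - ?x) * (w - v) \<le> 0" using Suc by simp
    then have "?y = ?x \<or> w = v" using o assms by (auto simp: mult_le_0_iff)
    then show ?thesis using True by auto
  next
    case False
    then have pos: "?w - ?v > 0" using o by simp
    have "(f N ?y - f N ?x) * (w - v) * (?w - ?v) = (f N ?y - f N ?x) * (?w - ?v) * (w - v)" by simp
    also have "\<dots> \<le> (f N ?w - f N ?v) * (?y - ?x) * (w - v)" using c assms by (intro mult_right_mono) auto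
    also have "\<dots> = (f N ?w - f N ?v) * ((?y - ?x) * (w - v))" by simp
    also have "\<dots> \<le> (f N ?w - f N ?v) * ((?w - ?v) * (y - x))"
      using Suc co.pgf_mono[of ?v ?w] o by (intro mult_left_mono) auto
    finally have "(f N ?y - f N ?x) * (w - v) * (?w - ?v) \<le> (f N ?w - f N ?v) * (y - x) * (?w - ?v)"
      by (simp add: mult_ac)
    then show ?thesis using pos by simp
  qed
  then show ?case by simp
qed (simp add: mult.commute)

lemma ext_step_pos: "ext_step t > 0"
proof -
  have "1 - surv t N + two_children N * (surv t N)\<^sup>2 \<le> f N (1 - surv t N)" unfolding two_children_def
    using surv_range[OF last_type, of t] by (intro critical_offspring.pgf_strictly_convex[OF critical_offspring] last_type) auto
  moreover have "two_children N * (surv t N)\<^sup>2 > 0" using two_children_pos[OF last_type] surv_pos[OF last_type, of t] by simp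
  moreover have "ext (Suc t) = f N (1 - surv t N)" using ext_surv[of t] by (simp add: ext_eq)
  ultimately show ?thesis by (simp add: ext_step_def ext_surv)
qed

lemma ext_step_power_law: "(\<lambda>t. ext_step t * real t powr 2) \<longlonglongrightarrow> 1 / b N"
proof -
  have "(\<lambda>t. \<beta> N t * (surv t N * real t)\<^sup>2) \<longlonglongrightarrow> b N * (1 / b N)\<^sup>2"
    by (intro tendsto_intros \<beta>_tendsto last_type surv_last N1)
  then have "(\<lambda>t. \<beta> N t * (surv t N * real t)\<^sup>2) \<longlonglongrightarrow> 1 / b N"
    using b_pos[OF last_type] by (simp add: power2_eq_square)
  moreover have "ext_step t * real t powr 2 = \<beta> N t * (surv t N * real t)\<^sup>2" for t
  proof -
    have "ext_step t = \<beta> N t * (surv t N)\<^sup>2" using surv_recursion[OF last_type, of t] by (simp add: ext_step_def ext_surv inflow_last)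
    then show ?thesis by (simp add: power_mult_distrib)
  qed
  ultimately show ?thesis by simp
qed

text \<open>
  A point at distance about \<open>a / k\<close> below \<open>1\<close> is, in terms of the extinction probabilities of type \<open>N\<close>,
  reached at time about \<open>k / (b\<^sub>N * a)\<close>.
\<close>

lemma interlacing_index:
  fixes u k :: "nat \<Rightarrow> real"
  assumes u: "\<And>n. 0 \<le> u n" "\<And>n. u n < 1" and a: "a > 0"
    and lim: "(\<lambda>n. (1 - u n) * k n) \<longlonglongrightarrow> a" and k: "filterlim k at_top sequentially"
  obtains j where "\<And>n. ext (j n) \<le> u n" "\<And>n. u n \<le> ext (Suc (j n))"
    "filterlim j at_top sequentially" "(\<lambda>n. real (j n) / k n) \<longlonglongrightarrow> 1 / (b N * a)"
proof -
  have "ext \<longlonglongrightarrow> 1 - 0" unfolding ext_surv[abs_def] by (intro tendsto_intros surv_tendsto_0 last_type)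
  have ex: "\<exists>j. u n < ext (Suc j)" for n
  proof -
    have "(\<lambda>j. ext (Suc j)) \<longlonglongrightarrow> 1" using LIMSEQ_Suc[OF \<open>ext \<longlonglongrightarrow> 1 - 0\<close>] by simp
    from order_tendstoD(1)[OF this u(2)[of n]] show ?thesis
      unfolding eventually_sequentially by blast
  qed
  define j where "j = (\<lambda>n. LEAST j. u n < ext (Suc j))"
  have above: "u n < ext (Suc (j n))" for n unfolding j_def by (rule LeastI_ex[OF ex])
  have below: "ext (j n) \<le> u n" for n
  proof (cases "j n")
    case 0
    then show ?thesis using u(1)[of n] by (simp add: ext_def)
  next
    case (Suc i)
    then have "\<not> u n < ext (Suc i)" unfolding j_def by (intro not_less_Least) auto
    then show ?thesis using Suc by simp
  qed
  have "(\<lambda>n. (1 - u n) * k n * inverse (k n)) \<longlonglongrightarrow> a * 0"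
    by (intro tendsto_mult lim filterlim_compose[OF tendsto_inverse_0_at_top k] tendsto_inverse_0_at_top k)
  then have "(\<lambda>n. (1 - u n) * k n * inverse (k n)) \<longlonglongrightarrow> 0" by simp
  then have u1: "(\<lambda>n. 1 - u n) \<longlonglongrightarrow> 0"
  proof (rule Lim_transform_eventually)
    show "\<forall>\<^sub>F n in sequentially. (1 - u n) * k n * inverse (k n) = 1 - u n"
      using k[unfolded filterlim_at_top_dense, rule_format, of 0] by eventually_elim simp
  qed
  have jtop: "filterlim j at_top sequentially"
    unfolding filterlim_at_top
  proof
    fix J
    show "\<forall>\<^sub>F n in sequentially. J \<le> j n"
      using order_tendstoD(2)[OF u1 surv_pos[OF last_type, of J]]
    proof eventually_elim
      case (elim n)
      show ?case
      proof (rule ccontr)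
        assume "\<not> J \<le> j n"
        then have "ext (Suc (j n)) \<le> ext J" by (intro ext_mono) auto
        then show False using above[of n] elim by (simp add: ext_surv)
      qed
    qed
  qed
  have jr: "filterlim (\<lambda>n. real (j n)) at_top sequentially"
    by (rule filterlim_compose[OF filterlim_real_sequentially jtop])
  have "(\<lambda>n. (1 - u n) * real (j n)) \<longlonglongrightarrow> 1 / b N"
  proof (rule tendsto_sandwich)
    have "(\<lambda>t. surv (Suc t) N * real (Suc t) - surv (Suc t) N) \<longlonglongrightarrow> 1 / b N - 0"
      by (intro tendsto_diff LIMSEQ_Suc[OF surv_last[OF N1]] LIMSEQ_Suc[OF surv_tendsto_0[OF last_type]])
    from filterlim_compose[OF this jtop]
    show "(\<lambda>n. surv (Suc (j n)) N * real (j n)) \<longlonglongrightarrow> 1 / b N" by (simp add: algebra_simps)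
    show "(\<lambda>n. surv (j n) N * real (j n)) \<longlonglongrightarrow> 1 / b N"
      by (rule filterlim_compose[OF surv_last[OF N1] jtop])
    show "\<forall>\<^sub>F n in sequentially. surv (Suc (j n)) N * real (j n) \<le> (1 - u n) * real (j n)"
      using above by (intro always_eventually allI mult_right_mono) (auto simp: ext_surv algebra_simps intro: less_imp_le)
    show "\<forall>\<^sub>F n in sequentially. (1 - u n) * real (j n) \<le> surv (j n) N * real (j n)"
      using below by (intro always_eventually allI mult_right_mono) (auto simp: ext_surv algebra_simps)
  qed
  then have "(\<lambda>n. ((1 - u n) * real (j n)) / ((1 - u n) * k n)) \<longlonglongrightarrow> (1 / b N) / a"
    using a by (intro tendsto_divide lim) auto
  moreover have "((1 - u n) * real (j n)) / ((1 - u n) * k n) = real (j n) / k n" for n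
    using u(2)[of n] by simp
  ultimately have "(\<lambda>n. real (j n) / k n) \<longlonglongrightarrow> 1 / (b N * a)" by simp
  then show ?thesis using that[of j] below above jtop by (auto intro: less_imp_le)
qed

text \<open>
  Damping by \<open>exp (- lam / (b\<^sub>N * k))\<close> moves the extinction probability at time \<open>k\<close>, at distance
  \<open>1 / (b\<^sub>N * k)\<close> from \<open>1\<close>, to distance \<open>(1 + lam) / (b\<^sub>N * k)\<close>, that is, to the place of the extinction
  probability at time \<open>k / (1 + lam)\<close>.  There one step of the extinction probabilities is
  \<open>(1 + lam)\<^sup>2\<close> times as long as at time \<open>k\<close>.  By convexity the difference of the orbits, compared with a
  single step, is therefore smaller by that factor.  This is where the limit law comes from.
\<close>

lemma gap_last_power_law:
  fixes k :: "nat \<Rightarrow> nat"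
  assumes lam: "lam \<ge> 0" and k: "filterlim k at_top sequentially"
    and kn: "(\<lambda>n. real (k n) / real n) \<longlonglongrightarrow> 0"
    and Y: "\<And>n. Y n N = exp (- (lam / (b N * real (k n)))) * ext (k n)"
    and X: "\<And>n. X n N = exp (- (lam / (b N * real (k n)))) * ext (k n - 1)"
    and d: "\<delta> > 0"
  shows "((\<lambda>(n, t). gap N X Y n t * real t powr 2) \<longlongrightarrow> 1 / (b N * (1 + lam)\<^sup>2)) (linear_range \<delta>)"
proof -
  let ?r = "\<lambda>n. real (k n) / real (k n - 1)"
  let ?F = "linear_range \<delta>"
  have bN: "b N > 0" by (rule b_pos[OF last_type])
  define a where "a = (\<lambda>n. exp (- (lam / (b N * real (k n)))))"
  have a: "0 < a n" "a n \<le> 1" for n using lam bN by (auto simp: a_def)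
  have kr: "filterlim (\<lambda>n. real (k n)) at_top sequentially"
    by (rule filterlim_compose[OF filterlim_real_sequentially k])
  have k1: "filterlim (\<lambda>n. k n - 1) at_top sequentially"
    by (rule filterlim_compose[OF filterlim_minus_const_nat_at_top k])
  have kpos: "\<forall>\<^sub>F n in sequentially. 1 \<le> k n" using k unfolding filterlim_at_top by blast
  have "((\<lambda>x::real. x * (1 - exp (- (lam / b N / x)))) \<longlongrightarrow> lam / b N) at_top"
  proof (cases "lam = 0")
    case False
    have lim: "((\<lambda>x::real. x * (1 - exp (- (c / x)))) \<longlongrightarrow> c) at_top" if "c > 0" for c :: real
      using that by real_asymp
    show ?thesis by (rule lim) (use False lam bN in simp)
  qed simp
  from filterlim_compose[OF this kr]
  have a_lim: "(\<lambda>n. real (k n) * (1 - a n)) \<longlonglongrightarrow> lam / b N" by (simp add: a_def)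
  have "((\<lambda>x::real. exp (- (lam / b N / x))) \<longlongrightarrow> exp (- 0)) at_top"
    by (intro tendsto_intros real_tendsto_divide_at_top[OF tendsto_const] filterlim_ident)
  from filterlim_compose[OF this kr] have a1: "a \<longlonglongrightarrow> 1" by (simp add: a_def)
  have ratio: "(\<lambda>n. ?r n) \<longlonglongrightarrow> 1"
  proof -
    have "((\<lambda>x::real. x / (x - 1)) \<longlongrightarrow> 1) at_top" by real_asymp
    from filterlim_compose[OF this kr] show ?thesis
      by (rule Lim_transform_eventually) (use kpos in \<open>eventually_elim, simp add: of_nat_diff\<close>)
  qed
  have surv_k: "(\<lambda>n. surv (k n) N * real (k n)) \<longlonglongrightarrow> 1 / b N" by (rule filterlim_compose[OF surv_last[OF N1] k])
  have k2: "\<forall>\<^sub>F n in sequentially. 2 \<le> k n" using k unfolding filterlim_at_top by blast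
  have surv_k1: "(\<lambda>n. surv (k n - 1) N * real (k n)) \<longlonglongrightarrow> 1 / b N"
  proof -
    have "(\<lambda>n. surv (k n - 1) N * real (k n - 1) * (?r n)) \<longlonglongrightarrow> 1 / b N * 1"
      by (intro tendsto_mult ratio filterlim_compose[OF surv_last[OF N1] k1])
    then have "(\<lambda>n. surv (k n - 1) N * real (k n - 1) * (?r n)) \<longlonglongrightarrow> 1 / b N" by simp
    then show ?thesis by (rule Lim_transform_eventually) (use k2 in \<open>eventually_elim, simp\<close>)
  qed
  have dist: "(\<lambda>n. (1 - a n * ext (l n)) * real (k n)) \<longlonglongrightarrow> (1 + lam) / b N"
    if "(\<lambda>n. surv (l n) N * real (k n)) \<longlonglongrightarrow> 1 / b N" for l
  proof -
    have "(\<lambda>n. real (k n) * (1 - a n) + a n * (surv (l n) N * real (k n))) \<longlonglongrightarrow> lam / b N + 1 * (1 / b N)"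
      by (intro tendsto_intros a_lim a1 that)
    then show ?thesis by (simp add: ext_surv algebra_simps add_divide_distrib)
  qed
  have rng: "0 \<le> a n * ext l" "a n * ext l < 1" for n l
  proof -
    show "0 \<le> a n * ext l" using a[of n] ext_range[of l] by simp
    have "a n * ext l \<le> 1 * ext l" using a[of n] ext_range[of l] by (intro mult_right_mono) auto
    then show "a n * ext l < 1" using ext_range[of l] by simp
  qed
  have apos: "(1 + lam) / b N > 0" using lam bN by simp
  obtain j where j: "\<And>n. a n * ext (k n) \<le> ext (Suc (j n))"
      "filterlim j at_top sequentially" "(\<lambda>n. real (j n) / real (k n)) \<longlonglongrightarrow> 1 / (b N * ((1 + lam) / b N))"
    using interlacing_index[OF rng apos dist[OF surv_k] kr] by metis
  obtain i where i: "\<And>n. ext (i n) \<le> a n * ext (k n - 1)"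
      "filterlim i at_top sequentially" "(\<lambda>n. real (i n) / real (k n)) \<longlonglongrightarrow> 1 / (b N * ((1 + lam) / b N))"
    using interlacing_index[OF rng apos dist[OF surv_k1] kr] by metis
  have simpl: "1 / (b N * ((1 + lam) / b N)) = 1 / (1 + lam)" using bN by simp
  \<comment> \<open>The chord over one step from index \<open>J\<close> lies to the right of \<open>X n N, Y n N\<close>, and the one from
    index \<open>I\<close> to the left, as convexity requires.\<close>
  define J where "J = (\<lambda>n. Suc (j n))"
  define I where "I = (\<lambda>n. i n - 1)"
  have inv_k: "(\<lambda>n. 1 / real (k n)) \<longlonglongrightarrow> 0"
    using filterlim_compose[OF lim_inverse_n' k] by (simp add: divide_inverse)
  have Jk: "(\<lambda>n. real (J n) / real (k n)) \<longlonglongrightarrow> 1 / (1 + lam)"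
  proof -
    have "(\<lambda>n. real (j n) / real (k n) + 1 / real (k n)) \<longlonglongrightarrow> 1 / (1 + lam) + 0"
      using j(3) unfolding simpl by (intro tendsto_add inv_k)
    then show ?thesis by (simp add: J_def add_divide_distrib add.commute)
  qed
  have Jtop: "filterlim J at_top sequentially"
    unfolding J_def by (rule filterlim_at_top_mono[OF j(2)]) simp
  have ipos: "\<forall>\<^sub>F n in sequentially. 1 \<le> i n" using i(2) unfolding filterlim_at_top by blast
  have Ik: "(\<lambda>n. real (I n) / real (k n)) \<longlonglongrightarrow> 1 / (1 + lam)"
  proof -
    have "(\<lambda>n. real (i n) / real (k n) - 1 / real (k n)) \<longlonglongrightarrow> 1 / (1 + lam) - 0"
      using i(3) unfolding simpl by (intro tendsto_diff inv_k)
    then have "(\<lambda>n. real (i n) / real (k n) - 1 / real (k n)) \<longlonglongrightarrow> 1 / (1 + lam)" by simp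
    then show ?thesis
      by (rule Lim_transform_eventually) (use ipos in \<open>eventually_elim, simp add: I_def of_nat_diff diff_divide_distrib\<close>)
  qed
  have Itop: "filterlim I at_top sequentially"
    unfolding I_def by (rule filterlim_compose[OF filterlim_minus_const_nat_at_top i(2)])
  define \<Delta> where "\<Delta> = (\<lambda>n. a n * ext_step (k n - 1))"
  have \<Delta>_lim: "(\<lambda>n. \<Delta> n * (real (k n))\<^sup>2) \<longlonglongrightarrow> 1 / b N"
  proof -
    have "(\<lambda>n. a n * (ext_step (k n - 1) * real (k n - 1) powr 2) * (?r n)\<^sup>2) \<longlonglongrightarrow> 1 * (1 / b N) * 1\<^sup>2"
      by (intro tendsto_intros a1 ratio filterlim_compose[OF ext_step_power_law k1])
    then have "(\<lambda>n. a n * (ext_step (k n - 1) * real (k n - 1) powr 2) * (?r n)\<^sup>2) \<longlonglongrightarrow> 1 / b N" by simp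
    then show ?thesis
      by (rule Lim_transform_eventually)
        (use k2 in \<open>eventually_elim, simp add: \<Delta>_def power_divide\<close>)
  qed
  let ?s = "\<lambda>l n. \<Delta> n * (real (k n))\<^sup>2 / (ext_step (l n) * real (l n) powr 2) * (real (l n) / real (k n))\<^sup>2"
  have side: "((\<lambda>x. ext_step (snd x + l (fst x)) * real (snd x) powr 2 * (\<Delta> (fst x) / ext_step (l (fst x))))
      \<longlongrightarrow> 1 / (b N * (1 + lam)\<^sup>2)) ?F"
    if l: "(\<lambda>n. real (l n) / real (k n)) \<longlonglongrightarrow> 1 / (1 + lam)" and ltop: "filterlim l at_top sequentially" for l
  proof -
    have "(\<lambda>n. real (l n) / real (k n) * (real (k n) / real n)) \<longlonglongrightarrow> 1 / (1 + lam) * 0"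
      by (intro tendsto_mult l kn)
    then have "(\<lambda>n. real (l n) / real (k n) * (real (k n) / real n)) \<longlonglongrightarrow> 0" by simp
    then have "(\<lambda>n. real (l n) / real n) \<longlonglongrightarrow> 0"
      by (rule Lim_transform_eventually) (use kpos in \<open>eventually_elim, simp\<close>)
    from shifted_power_law[OF ext_step_power_law this d]
    have 1: "((\<lambda>x. ext_step (snd x + l (fst x)) * real (snd x) powr 2) \<longlongrightarrow> 1 / b N) ?F" .
    have "(\<lambda>n. ?s l n)
        \<longlonglongrightarrow> 1 / b N / (1 / b N) * (1 / (1 + lam))\<^sup>2"
      by (intro tendsto_intros \<Delta>_lim l filterlim_compose[OF ext_step_power_law ltop]) (use bN in auto)
    then have "(\<lambda>n. ?s l n)
        \<longlonglongrightarrow> 1 / (1 + lam)\<^sup>2" using bN by (simp add: power_divide)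
    then have "(\<lambda>n. \<Delta> n / ext_step (l n)) \<longlonglongrightarrow> 1 / (1 + lam)\<^sup>2"
    proof (rule Lim_transform_eventually)
      have "\<forall>\<^sub>F n in sequentially. 1 \<le> l n" using ltop unfolding filterlim_at_top by blast
      then show "\<forall>\<^sub>F n in sequentially. \<Delta> n * (real (k n))\<^sup>2 / (ext_step (l n) * real (l n) powr 2)
          * (real (l n) / real (k n))\<^sup>2 = \<Delta> n / ext_step (l n)"
        using kpos by eventually_elim (simp add: power_divide)
    qed
    from tendsto_mult[OF 1 filterlim_compose[OF this filterlim_fst_linear_range]]
    show ?thesis by simp
  qed
  have YX: "Y n N = a n * ext (k n)" "X n N = a n * ext (k n - 1)" for n by (simp_all add: X Y a_def)
  have pos: "\<forall>\<^sub>F x in ?F. 1 \<le> k (fst x) \<and> 1 \<le> i (fst x)"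
    using eventually_compose_filterlim[OF eventually_conj[OF kpos ipos] filterlim_fst_linear_range] .
  have XY: "0 \<le> X n N" "X n N \<le> Y n N" "Y n N \<le> 1" for n
    using rng[of n "k n"] rng[of n "k n - 1"] a[of n] ext_mono[of "k n - 1" "k n"] unfolding YX
    by (auto intro: mult_left_mono less_imp_le)
  have gap_eq: "gap N X Y n t = (f N ^^ t) (Y n N) - (f N ^^ t) (X n N)" for n t
    by (simp add: gap_def iterate_last)
  have "((\<lambda>x. gap N X Y (fst x) (snd x) * real (snd x) powr 2) \<longlongrightarrow> 1 / (b N * (1 + lam)\<^sup>2)) ?F"
  proof (rule tendsto_sandwich)
    show "((\<lambda>x. ext_step (snd x + I (fst x)) * real (snd x) powr 2 * (\<Delta> (fst x) / ext_step (I (fst x))))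
      \<longlongrightarrow> 1 / (b N * (1 + lam)\<^sup>2)) ?F" by (rule side[OF Ik Itop])
    show "((\<lambda>x. ext_step (snd x + J (fst x)) * real (snd x) powr 2 * (\<Delta> (fst x) / ext_step (J (fst x))))
      \<longlongrightarrow> 1 / (b N * (1 + lam)\<^sup>2)) ?F" by (rule side[OF Jk Jtop])
    show "\<forall>\<^sub>F x in ?F. ext_step (snd x + I (fst x)) * real (snd x) powr 2 * (\<Delta> (fst x) / ext_step (I (fst x)))
        \<le> gap N X Y (fst x) (snd x) * real (snd x) powr 2"
      using pos
    proof eventually_elim
      case (elim x)
      obtain n t where x: "x = (n, t)" by fastforce
      have \<Delta>: "Y n N - X n N = \<Delta> n" using elim x by (simp add: YX \<Delta>_def ext_step_def right_diff_distrib)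
      have SI: "Suc (I n) = i n" using elim x by (simp add: I_def)
      have "((f N ^^ t) (ext (Suc (I n))) - (f N ^^ t) (ext (I n))) * (Y n N - X n N)
          \<le> ((f N ^^ t) (Y n N) - (f N ^^ t) (X n N)) * (ext (Suc (I n)) - ext (I n))"
        using XY[of n] ext_range[of "I n"] ext_mono[of "I n" "i n"] i(1)[of n] SI
        by (intro iterate_convex) (auto simp: YX)
      then have "ext_step (t + I n) * \<Delta> n \<le> gap N X Y n t * ext_step (I n)"
        unfolding gap_eq \<Delta> by (simp only: iterate_ext ext_step_def add_Suc_right)
      then have "ext_step (t + I n) * (\<Delta> n / ext_step (I n)) \<le> gap N X Y n t" using ext_step_pos[of "I n"] by (simp add: field_simps)
      from mult_right_mono[OF this, of "real t powr 2"] show ?case using x by (simp add: mult_ac)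
    qed
    show "\<forall>\<^sub>F x in ?F. gap N X Y (fst x) (snd x) * real (snd x) powr 2
        \<le> ext_step (snd x + J (fst x)) * real (snd x) powr 2 * (\<Delta> (fst x) / ext_step (J (fst x)))"
      using pos
    proof eventually_elim
      case (elim x)
      obtain n t where x: "x = (n, t)" by fastforce
      have \<Delta>: "Y n N - X n N = \<Delta> n" using elim x by (simp add: YX \<Delta>_def ext_step_def right_diff_distrib)
      have "((f N ^^ t) (Y n N) - (f N ^^ t) (X n N)) * (ext (Suc (J n)) - ext (J n))
          \<le> ((f N ^^ t) (ext (Suc (J n))) - (f N ^^ t) (ext (J n))) * (Y n N - X n N)"
        using XY[of n] ext_range[of "Suc (J n)"] ext_mono[of "J n" "Suc (J n)"] j(1)[of n]
        by (intro iterate_convex) (auto simp: J_def YX)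
      then have "gap N X Y n t * ext_step (J n) \<le> ext_step (t + J n) * \<Delta> n"
        unfolding gap_eq \<Delta> by (simp only: iterate_ext ext_step_def add_Suc_right)
      then have "gap N X Y n t \<le> ext_step (t + J n) * (\<Delta> n / ext_step (J n))" using ext_step_pos[of "J n"] by (simp add: field_simps)
      from mult_right_mono[OF this, of "real t powr 2"] show ?case using x by (simp add: mult_ac)
    qed
  qed
  then show ?thesis by (simp add: case_prod_beta')
qed

end

section \<open>The conditional limit law\<close>

lemma trapped_weights:
  assumes s: "\<And>n j. j \<in> {1..N} \<Longrightarrow> s n j \<in> {0..1}" and k: "(\<lambda>n. real (k n) / real n) \<longlonglongrightarrow> 0"
  shows "trapped k (\<lambda>n j. s n j * (h ^^ (k n - 1)) (\<lambda>_. 0) j) (\<lambda>n j. s n j * (h ^^ k n) (\<lambda>_. 0) j)"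
proof -
  have r: "0 \<le> (h ^^ t) (\<lambda>_. 0) j \<and> (h ^^ t) (\<lambda>_. 0) j \<le> 1" if "j \<in> {1..N}" for t j
    using iterate_box[OF zero_in_box, of t] that by (auto simp: box_def)
  have in_box: "(\<lambda>j. s n j * (h ^^ t) (\<lambda>_. 0) j) \<in> box" for n t
    unfolding box_def using s r by (auto intro!: mult_le_one)
  have "s n j * (h ^^ (k n - 1)) (\<lambda>_. 0) j \<le> s n j * (h ^^ k n) (\<lambda>_. 0) j
      \<and> s n j * (h ^^ k n) (\<lambda>_. 0) j \<le> (h ^^ k n) (\<lambda>_. 0) j" if j: "j \<in> {1..N}" for n j
  proof
    have "(h ^^ (k n - 1)) (\<lambda>_. 0) j \<le> (h ^^ k n) (\<lambda>_. 0) j"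
      using surv_decreasing[OF j, of "k n - 1" "k n"] by (simp add: surv_def)
    then show "s n j * (h ^^ (k n - 1)) (\<lambda>_. 0) j \<le> s n j * (h ^^ k n) (\<lambda>_. 0) j"
      using s[OF j, of n] by (intro mult_left_mono) auto
    show "s n j * (h ^^ k n) (\<lambda>_. 0) j \<le> (h ^^ k n) (\<lambda>_. 0) j"
      using s[OF j, of n] r[OF j, of "k n"] by (intro mult_left_le_one_le) auto
  qed
  then show ?thesis unfolding trapped_def using k in_box by auto
qed

text \<open>
  All weights share the exponent and the constant \<open>c\<close>, so that these cancel in quotients; the weights
  of the types before \<open>N\<close> are forgotten, and that of type \<open>N\<close> enters through \<open>(1 + lam)\<^sup>2\<close>.
\<close>

lemma weighted_extinction_law:
  assumes N1: "N \<ge> 1" and c: "gap_factor 1 c" and lam: "lam \<ge> 0"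
    and s: "\<And>n j. j \<in> {1..N} \<Longrightarrow> s n j \<in> {0..1}"
    and sN: "\<And>n. s n N = exp (- (lam / (b N * real (k n))))"
    and k: "filterlim k at_top sequentially" and kn: "(\<lambda>n. real (k n) / real n) \<longlonglongrightarrow> 0"
    and mk: "\<forall>\<^sub>F n in sequentially. n = m n + k n"
    and Z: "Z = pop (unit_population 1)"
  shows "(\<lambda>n. (\<integral>\<omega>. weight (s n) (\<lambda>j. Z (m n) j \<omega>)
        * indicator {\<omega> \<in> space M. extinction_time N Z \<omega> = enat n} \<omega> \<partial>M) * real (m n) powr (1 + \<gamma> 1))
    \<longlonglongrightarrow> c * (1 / (b N * (1 + lam)\<^sup>2))"
proof -
  let ?R = "\<lambda>n. real (m n) powr (1 + \<gamma> 1)"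
  define X where "X = (\<lambda>n j. s n j * (h ^^ (k n - 1)) (\<lambda>_. 0) j)"
  define Y where "Y = (\<lambda>n j. s n j * (h ^^ k n) (\<lambda>_. 0) j)"
  have tr: "trapped k X Y" unfolding X_def Y_def using s kn by (rule trapped_weights)
  have YN: "Y n N = exp (- (lam / (b N * real (k n)))) * ext (k n)"
    and XN: "X n N = exp (- (lam / (b N * real (k n)))) * ext (k n - 1)" for n
    using sN ext_def by (simp_all add: X_def Y_def)
  have last: "((\<lambda>(n, t). gap N X Y n t * real t powr 2) \<longlongrightarrow> 1 / (b N * (1 + lam)\<^sup>2)) (linear_range \<delta>)"
    if "\<delta> > 0" for \<delta>
    using N1 lam k kn YN XN that by (rule gap_last_power_law)
  have "((\<lambda>(n, t). gap 1 X Y n t * real t powr (1 + \<gamma> 1)) \<longlongrightarrow> c * (1 / (b N * (1 + lam)\<^sup>2))) (linear_range (1 / 2))"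
    by (rule gap_factorD[OF c tr last]) auto
  moreover have "\<forall>\<^sub>F n in sequentially. 1 / 2 * real n \<le> real (m n)"
  proof -
    have "\<forall>\<^sub>F n in sequentially. real (k n) / real n < 1 / 2" by (rule order_tendstoD(2)[OF kn]) simp
    then show ?thesis using mk eventually_gt_at_top[of 0]
    proof eventually_elim
      case (elim n)
      then have "real (k n) < 1 / 2 * real n" by (simp add: field_simps)
      moreover have "real n = real (m n) + real (k n)" using elim(2) by (metis of_nat_add)
      ultimately show ?case by linarith
    qed
  qed
  ultimately have "(\<lambda>n. gap 1 X Y n (m n) * ?R n) \<longlonglongrightarrow> c * (1 / (b N * (1 + lam)\<^sup>2))"
    using filterlim_compose[OF _ filterlim_Pair_linear_range] by fastforce
  then show ?thesis
  proof (rule Lim_transform_eventually)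
    have "\<forall>\<^sub>F n in sequentially. 1 \<le> k n" using k unfolding filterlim_at_top by blast
    then show "\<forall>\<^sub>F n in sequentially. gap 1 X Y n (m n) * ?R n
        = (\<integral>\<omega>. weight (s n) (\<lambda>j. Z (m n) j \<omega>)
          * indicator {\<omega> \<in> space M. extinction_time N Z \<omega> = enat n} \<omega> \<partial>M) * ?R n"
      using mk
    proof eventually_elim
      case (elim n)
      have "\<forall>j\<in>{1..N}. s n j \<in> {0..1}" using s by blast
      from expectation_at_extinction[OF this N1 elim(1) Z, of "m n"] elim(2)[symmetric]
      show ?case by (simp only: gap_def X_def Y_def)
    qed
  qed
qed

end

theorem theorem2:
  fixes M :: "'w measure" and N :: nat and \<eta> :: "'w offspring"
    and Z :: "nat \<Rightarrow> nat \<Rightarrow> 'w \<Rightarrow> nat" and T :: "'w \<Rightarrow> enat"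
    and m :: "nat \<Rightarrow> nat" and k :: "nat \<Rightarrow> real"
    and s :: "nat \<Rightarrow> real" and lam :: real
  assumes "N \<ge> 2"
    and "decomposable_galton_watson M N \<eta>"
    and "hypothesis_A M N \<eta>"
    and Z_eq: "Z = population N \<eta> (unit_population 1)"
    and T_eq: "T = extinction_time N Z"
    and k_eq: "\<And>n. k n = real n - real (m n)"
    and "filterlim k at_top sequentially"
    and "k \<in> o(\<lambda>n. real n)"
    and "\<And>j. j \<in> {1..<N} \<Longrightarrow> s j \<in> {0..1}"
    and "lam > 0"
  shows "(\<lambda>n. expectation_given M
            (\<lambda>\<omega>. (\<Prod>j\<in>{1..<N}. s j ^ Z (m n) j \<omega>) *
                  exp (- lam * (real (Z (m n) N \<omega>) / (half_variance M \<eta> N * k n))))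
            {\<omega> \<in> space M. T \<omega> = enat n})
         \<longlonglongrightarrow> 1 / (1 + lam)\<^sup>2"
proof -
  interpret decomposable_galton_watson M N \<eta> by fact
  interpret critical_decomposable_gw M N \<eta> by unfold_locales fact
  have N1: "N \<ge> 1" using \<open>N \<ge> 2\<close> by simp
  define l where "l = (\<lambda>n. n - m n)"
  have k_pos: "\<forall>\<^sub>F n in sequentially. 0 < k n"
    using \<open>filterlim k at_top sequentially\<close> unfolding filterlim_at_top_dense by blast
  have l_k: "\<forall>\<^sub>F n in sequentially. real (l n) = k n \<and> n = m n + l n"
    using k_pos by eventually_elim (auto simp: l_def k_eq of_nat_diff)
  have l: "filterlim l at_top sequentially" unfolding filterlim_at_top
  proof
    fix K :: nat
    have "\<forall>\<^sub>F n in sequentially. real K \<le> k n"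
      using \<open>filterlim k at_top sequentially\<close> unfolding filterlim_at_top by blast
    then show "\<forall>\<^sub>F n in sequentially. K \<le> l n" using l_k by eventually_elim auto
  qed
  have ln: "(\<lambda>n. real (l n) / real n) \<longlonglongrightarrow> 0"
    using smalloD_tendsto[OF \<open>k \<in> o(\<lambda>n. real n)\<close>]
    by (rule Lim_transform_eventually) (use l_k in \<open>eventually_elim, simp\<close>)
  have mk: "\<forall>\<^sub>F n in sequentially. n = m n + l n" using l_k by eventually_elim simp
  obtain c where c: "gap_factor 1 c" using gap_power_law[of 1] N1 by auto
  have c_pos: "c > 0" using c by (simp add: gap_factor_def)
  have bN: "b N > 0" using b_pos N1 by simp
  define w where "w = (\<lambda>n j. if j = N then exp (- (lam / (b N * real (l n)))) else s j)"
  define A where "A = (\<lambda>n. {\<omega> \<in> space M. T \<omega> = enat n})"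
  define E where "E = (\<lambda>v n. \<integral>\<omega>. weight (v n) (\<lambda>j. Z (m n) j \<omega>) * indicator (A n) \<omega> \<partial>M)"
  have w_range: "w n j \<in> {0..1}" if "j \<in> {1..N}" for n j
    using assms(9)[of j] that bN \<open>lam > 0\<close> by (auto simp: w_def)
  let ?R = "\<lambda>n. real (m n) powr (1 + \<gamma> 1)"
  have num: "(\<lambda>n. E w n * ?R n) \<longlonglongrightarrow> c * (1 / (b N * (1 + lam)\<^sup>2))"
    unfolding E_def A_def T_eq
    by (rule weighted_extinction_law[OF N1 c _ w_range _ l ln mk Z_eq]) (use \<open>lam > 0\<close> in \<open>auto simp: w_def\<close>)
  \<comment> \<open>The trivial weight, with \<open>lam = 0\<close>, gives the asymptotics of the probability of \<open>T = n\<close>.\<close>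
  have den: "(\<lambda>n. E (\<lambda>_ _. 1) n * ?R n) \<longlonglongrightarrow> c * (1 / (b N * (1 + 0)\<^sup>2))"
    unfolding E_def A_def T_eq
    by (rule weighted_extinction_law[OF N1 c _ _ _ l ln mk Z_eq]) auto
  have prob_A: "E (\<lambda>_ _. 1) n = prob (A n)" for n
  proof -
    have "A n \<inter> space M = A n" by (auto simp: A_def)
    then show ?thesis by (simp add: E_def weight_def)
  qed
  have "\<forall>\<^sub>F n in sequentially. 0 < E (\<lambda>_ _. 1) n * ?R n"
    by (rule order_tendstoD(1)[OF den]) (use c_pos bN in simp)
  then have ev_pos: "\<forall>\<^sub>F n in sequentially. 0 < prob (A n) \<and> 0 < ?R n"
    by eventually_elim (auto simp: prob_A zero_less_mult_iff)
  have "(\<lambda>n. (E w n * ?R n) / (E (\<lambda>_ _. 1) n * ?R n))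
      \<longlonglongrightarrow> (c * (1 / (b N * (1 + lam)\<^sup>2))) / (c * (1 / (b N * (1 + 0)\<^sup>2)))"
    by (intro tendsto_divide num den) (use c_pos bN in simp)
  then have "(\<lambda>n. (E w n * ?R n) / (E (\<lambda>_ _. 1) n * ?R n))
      \<longlonglongrightarrow> 1 / (1 + lam)\<^sup>2" using c_pos bN by simp
  then show ?thesis
  proof (rule Lim_transform_eventually)
    show "\<forall>\<^sub>F n in sequentially. (E w n * ?R n) / (E (\<lambda>_ _. 1) n * ?R n)
      = expectation_given M
            (\<lambda>\<omega>. (\<Prod>j\<in>{1..<N}. s j ^ Z (m n) j \<omega>) *
                  exp (- lam * (real (Z (m n) N \<omega>) / (half_variance M \<eta> N * k n))))
            {\<omega> \<in> space M. T \<omega> = enat n}"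
      using ev_pos l_k
    proof eventually_elim
      case (elim n)
      have integrand: "(\<Prod>j\<in>{1..<N}. s j ^ Z (m n) j \<omega>) *
          exp (- lam * (real (Z (m n) N \<omega>) / (half_variance M \<eta> N * k n)))
          = weight (w n) (\<lambda>j. Z (m n) j \<omega>)" for \<omega>
      proof -
        have "{1..N} = insert N {1..<N}" using N1 by auto
        then have "weight (w n) (\<lambda>j. Z (m n) j \<omega>)
            = exp (- (lam / (b N * k n))) ^ Z (m n) N \<omega> * (\<Prod>j\<in>{1..<N}. s j ^ Z (m n) j \<omega>)"
          using elim by (simp add: weight_def w_def)
        then show ?thesis by (simp add: mult.commute flip: exp_of_nat_mult)
      qed
      have "A n \<in> sets M" using elim measure_notin_sets[of "A n" M] by force
      moreover have "(\<lambda>\<omega>. weight (w n) (\<lambda>j. Z (m n) j \<omega>)) \<in> borel_measurable M"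
        unfolding weight_def Z_eq
        by (intro borel_measurable_prod measurable_compose[OF population_measurable]) auto
      ultimately have "expectation_given M (\<lambda>\<omega>. weight (w n) (\<lambda>j. Z (m n) j \<omega>)) (A n) = E w n / prob (A n)"
        using elim prob_space_axioms unfolding E_def by (intro expectation_given_eq) auto
      then show ?case unfolding integrand using elim by (simp add: prob_A A_def)
    qed
  qed
qed

end
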